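(* In the setting described in the context, suppose that Assumptions 1, 2, 3 and 4 (stated in full in the context) hold. Then for any $y_0=(x_0,z_0)$ one has $P^{\theta_*}_{y_0}(T_B<\infty)=1$ and, for some $p>0$, $$E^{\theta_*}_{y_0}[T_B]=O\Big(c_\Delta^{p}\log c_\Delta+\log\Big(\frac1{c_\Delta\Delta}\Big)\Big)\qquad\text{as }\Delta\searrow0,$$ where $T_B=\inf\{n>0:Y_n\in B\}$ is the termination time of the state-dependent importance sampling algorithm.
   Context: Model. $X=(X_n:n\ge 0)$ is a Markov chain with finite state space $\mathcal S$ and transition matrix $(K(x,y):x,y\in\mathcal S)$. $((\xi_n,\eta_n):n\ge1)$ is a sequence of i.i.d. two-dimensional random variables independent of $X$. $\gamma(x,z)$ and $\lambda(x,z)$ ($x\in\mathcal S$, $z\in\mathbb R$) are deterministic real-valued functions, with $\lambda\ge 0$. For $\Delta>0$ let $S_{k+1}=S_k+\gamma(X_{k+1},\xi_{k+1})$, $D_{k+1}=D_k+\Delta\,\lambda(X_{k+1},\eta_{k+1})e^{S_{k+1}}$ (nominal dynamics). Notation. $E_x$ is nominal expectation given $X_0=x$. Let $\exp(\chi(x,\theta))=E\exp(\theta\gamma(x,\xi_1))$ and $Q_\theta(x,y)=K(x,y)\exp(\chi(y,\theta))$. For $\theta$ such that $\chi(\cdot,\theta)$ is finite, $\exp(\psi(\theta))$ denotes the Perron–Frobenius eigenvalue of $Q_\theta$, with strictly positive eigenvector $u_\theta$ (unique up to scaling): $Q_\theta u_\theta=e^{\psi(\theta)}u_\theta$. Otherwise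 $\psi(\theta)=\infty$. The scaling is chosen so that $\theta\mapsto u_\theta(x)$ is continuous on $(0,\theta_*]$ for each $x$. Assumption 1: $X$ is irreducible on the finite state space $\mathcal S$, and $\sup_{x\in\mathcal S,\theta\in\mathcal N}E\exp(\theta\gamma(x,\xi_1))<\infty$ for some neighborhood $\mathcal N$ of the origin. Assumption 2 (Cramér's condition): there exists $\theta_*>0$ with $\psi(\theta_* )=0$, and there exists $\theta>\theta_*$ with $\psi(\theta)<\infty$. Assumption 3: $\sup_{x\in\mathcal S}E_x[\lambda(X_1,\eta_1)^\alpha]<\infty$ for each $\alpha\in(0,\infty)$. Assumption 4: for each $x\in\mathcal S$, $\mathrm{Var}(\gamma(x,\xi_1))>0$. Parameters. $\rho_\Delta=1/\log(1/\Delta)$ and $c_\Delta=(B_2/B_1)\rho_\Delta^{-(1+1/(2\theta_*-\rho_\Delta))}$. Here $B_1,B_2\in(0,\infty)$ are constants such that, for all sufficiently small $\Delta$, $B_1\rho_\Delta<1$ and $\frac{b_0b_2\rho_\Delta}{B_2^{2\theta_*-\rho_\Delta}}+\frac{1-\rho_\Delta\mu+b_1\rho_\Delta^2}{(1-B_1\rho_\Delta)^{2\theta_*-\rho_\Delta}}\le1$, where $\mu=\psi'(\theta_* )>0$, $0<1/[\inf_{\theta\in(0,\theta_* ),x}u_\theta(x)]^2\le b_0<\infty$, $b_1>0$ satisfies $\exp(\psi(\theta_*-\delta))\le1-\delta\mu+b_1\delta^2$ for each $\delta\in(0,\theta_* )$, and $b_2\in(0,\infty)$ satisfies $\sup_{x\in\mathcal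 S,\delta\in(0,\theta_* )}E_x[\lambda(X_1,\eta_1)^{2\theta_*-\delta}\exp((\theta_*-\delta)\gamma(X_1,\xi_1))]\le b_2$. Sampler in terms of $Y$. Let $Z_n=(1-D_n)e^{-S_n}$ and $Y_n=(X_n,Z_n)$, so that $Y_{n+1}=(X_{n+1},\,Z_ne^{-\gamma(X_{n+1},\xi_{n+1})}-\Delta\lambda(X_{n+1},\eta_{n+1}))$. Let $g_\Delta(x)=u_{\theta_*}(x)^{1/(2\theta_*-\rho_\Delta)}u_{\theta_*-\rho_\Delta}(x)^{1/(2\theta_*-\rho_\Delta)}$ and define the regions $C=\{(x,z):z>c_\Delta\Delta\,g_\Delta(x)\}$, $C'=\{(x,z):0<z\le c_\Delta\Delta\,g_\Delta(x)\}$, $B=\{(x,z):z\le0\}$ ($B$ is the termination set of the algorithm). $P^{\theta_*}_{y_0}$, $E^{\theta_*}_{y_0}$ are the probability and expectation for the Markov process $Y$ started at $Y_0=y_0=(x_0,z_0)$ with the following transitions. If $Y_n\in C$ with $X_n=x$: $X_{n+1}=y$ is drawn with probability $K(x,y)\exp(\chi(y,\theta_* ))u_{\theta_*}(y)/u_{\theta_*}(x)$; given $y$, $\gamma(y,\xi_{n+1})$ has law $e^{\theta_* z-\chi(y,\theta_* )}P(\gamma(y,\xi_1)\in dz)$; and given $y$ and $\gamma(y,\xi_{n+1})=z$, $\lambda(y,\eta_{n+1})$ has its nominal conditional law. If $Y_n\notin C$, the transition is nominal (no tilting).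
   Formalization: It is additionally assumed that P(λ(x,η_1)>0)>0 for some state x; if λ vanishes almost surely for every x, then Z_n=z_0e^{-S_n} stays positive for z_0>0, the algorithm never terminates, and the claim fails. *)

theory Defs
  imports "HOL-Probability.Probability" "HOL-Library.Landau_Symbols"
begin

text \<open>
  The transition matrix is \<open>K(x,y) = pmf (K x) y\<close>.  The i.i.d. pairs \<open>(\<xi>\<^sub>n, \<eta>\<^sub>n)\<close> enter only through
  their common law \<open>\<nu>\<close> on the plane, so \<open>\<xi>\<^sub>1\<close> is \<open>fst\<close> and \<open>\<eta>\<^sub>1\<close> is \<open>snd\<close> on the space \<open>\<nu>\<close>.
\<close>

primrec n_step :: "('s \<Rightarrow> 's pmf) \<Rightarrow> nat \<Rightarrow> 's \<Rightarrow> 's pmf" where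
  "n_step K 0 x = return_pmf x"
| "n_step K (Suc n) x = bind_pmf (K x) (n_step K n)"

definition irreducible_chain :: "('s \<Rightarrow> 's pmf) \<Rightarrow> bool" where
  "irreducible_chain K \<longleftrightarrow> (\<forall>x y. \<exists>n. 0 < pmf (n_step K n x) y)"

text \<open>\<open>E\<^sub>x[f(X\<^sub>1, (\<xi>\<^sub>1, \<eta>\<^sub>1))]\<close> under the nominal dynamics, with values in \<open>[0, \<infinity>]\<close>.\<close>

definition nominal_E ::
    "('s \<Rightarrow> 's pmf) \<Rightarrow> (real \<times> real) measure \<Rightarrow> 's \<Rightarrow> ('s \<Rightarrow> real \<times> real \<Rightarrow> real) \<Rightarrow> ennreal" where
  "nominal_E K \<nu> x f = (\<integral>\<^sup>+ y. (\<integral>\<^sup>+ w. ennreal (f y w) \<partial>\<nu>) \<partial>measure_pmf (K x))"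

definition chi_finite :: "(real \<times> real) measure \<Rightarrow> ('s \<Rightarrow> real \<Rightarrow> real) \<Rightarrow> real \<Rightarrow> bool" where
  "chi_finite \<nu> \<gamma> \<theta> \<longleftrightarrow> (\<forall>x. integrable \<nu> (\<lambda>w. exp (\<theta> * \<gamma> x (fst w))))"

definition chi :: "(real \<times> real) measure \<Rightarrow> ('s \<Rightarrow> real \<Rightarrow> real) \<Rightarrow> 's \<Rightarrow> real \<Rightarrow> real" where
  "chi \<nu> \<gamma> x \<theta> = ln (\<integral>w. exp (\<theta> * \<gamma> x (fst w)) \<partial>\<nu>)"

definition Q_matrix :: "('s::finite \<Rightarrow> 's pmf) \<Rightarrow> (real \<times> real) measure \<Rightarrow> ('s \<Rightarrow> real \<Rightarrow> real)
    \<Rightarrow> real \<Rightarrow> real ^ 's ^ 's" where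
  "Q_matrix K \<nu> \<gamma> \<theta> = (\<chi> x y. pmf (K x) y * exp (chi \<nu> \<gamma> y \<theta>))"

text \<open>
  The Perron--Frobenius eigenvalue of an irreducible nonnegative matrix is its spectral radius,
  the maximal modulus of a complex eigenvalue.
\<close>

definition pf_eigenvalue :: "real ^ 's::finite ^ 's \<Rightarrow> real" where
  "pf_eigenvalue A = Max {cmod l | l. \<exists>v. v \<noteq> 0 \<and> (\<chi> x y. complex_of_real (A $ x $ y)) *v v = l *s v}"

definition psi :: "('s::finite \<Rightarrow> 's pmf) \<Rightarrow> (real \<times> real) measure \<Rightarrow> ('s \<Rightarrow> real \<Rightarrow> real)
    \<Rightarrow> real \<Rightarrow> ereal" where
  "psi K \<nu> \<gamma> \<theta> =
     (if chi_finite \<nu> \<gamma> \<theta> then ereal (ln (pf_eigenvalue (Q_matrix K \<nu> \<gamma> \<theta>))) else \<infinity>)"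

definition rho :: "real \<Rightarrow> real" where
  "rho \<Delta> = 1 / ln (1 / \<Delta>)"

definition c_level :: "real \<Rightarrow> real \<Rightarrow> real \<Rightarrow> real \<Rightarrow> real" where
  "c_level B1 B2 \<theta>s \<Delta> = (B2 / B1) * rho \<Delta> powr (- (1 + 1 / (2 * \<theta>s - rho \<Delta>)))"

definition g_fun :: "(real \<Rightarrow> real ^ 's) \<Rightarrow> real \<Rightarrow> real \<Rightarrow> 's::finite \<Rightarrow> real" where
  "g_fun u \<theta>s \<Delta> x = (u \<theta>s $ x) powr (1 / (2 * \<theta>s - rho \<Delta>))
     * (u (\<theta>s - rho \<Delta>) $ x) powr (1 / (2 * \<theta>s - rho \<Delta>))"

definition region_C :: "(real \<Rightarrow> real ^ 's) \<Rightarrow> real \<Rightarrow> real \<Rightarrow> real \<Rightarrow> real \<Rightarrow> ('s::finite \<times> real) set" where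
  "region_C u \<theta>s B1 B2 \<Delta> = {(x, z). z > c_level B1 B2 \<theta>s \<Delta> * \<Delta> * g_fun u \<theta>s \<Delta> x}"

definition region_B :: "('s \<times> real) set" where
  "region_B = {(x, z). z \<le> 0}"

text \<open>Nominal joint law of \<open>(\<gamma>(y,\<xi>\<^sub>1), \<lambda>(y,\<eta>\<^sub>1))\<close>.\<close>

definition increment_law :: "(real \<times> real) measure \<Rightarrow> ('s \<Rightarrow> real \<Rightarrow> real) \<Rightarrow> ('s \<Rightarrow> real \<Rightarrow> real)
    \<Rightarrow> 's \<Rightarrow> (real \<times> real) measure" where
  "increment_law \<nu> \<gamma> lam y = distr \<nu> borel (\<lambda>w. (\<gamma> y (fst w), lam y (snd w)))"

text \<open>
  Tilting the first marginal by \<open>exp (\<theta> g - \<chi>(y,\<theta>))\<close> while keeping the conditional law of the second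
  coordinate amounts to giving the joint law that density; see \<open>density_fst_disintegration\<close> below.
\<close>

definition tilted_increment_law :: "(real \<times> real) measure \<Rightarrow> ('s \<Rightarrow> real \<Rightarrow> real)
    \<Rightarrow> ('s \<Rightarrow> real \<Rightarrow> real) \<Rightarrow> real \<Rightarrow> 's \<Rightarrow> (real \<times> real) measure" where
  "tilted_increment_law \<nu> \<gamma> lam \<theta> y =
     density (increment_law \<nu> \<gamma> lam y) (\<lambda>(g, l). ennreal (exp (\<theta> * g - chi \<nu> \<gamma> y \<theta>)))"

lemma density_fst_disintegration:
  fixes J :: "(real \<times> real) measure" and \<kappa> :: "real \<Rightarrow> real measure" and f :: "real \<Rightarrow> ennreal"
  defines "M \<equiv> distr J borel fst"
  assumes sJ: "sets J = sets borel"
    and \<kappa>[measurable]: "\<kappa> \<in> borel \<rightarrow>\<^sub>M prob_algebra borel"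
    and J: "\<And>A. A \<in> sets borel \<Longrightarrow> emeasure J A = (\<integral>\<^sup>+ g. emeasure (\<kappa> g) {l. (g, l) \<in> A} \<partial>M)"
    and f[measurable]: "f \<in> borel_measurable borel"
    and A: "A \<in> sets borel"
  shows "emeasure (density J (\<lambda>(g, l). f g)) A
    = (\<integral>\<^sup>+ g. emeasure (\<kappa> g) {l. (g, l) \<in> A} \<partial>density M f)"
proof -
  have sM: "sets M = sets borel" by (simp add: M_def)
  have \<kappa>': "\<kappa> \<in> borel \<rightarrow>\<^sub>M subprob_algebra borel"
    using \<kappa> by (rule measurable_prob_algebraD)
  have em[measurable]: "(\<lambda>g. emeasure (\<kappa> g) {l. (g, l) \<in> B}) \<in> borel_measurable borel"
    if B: "B \<in> sets borel" for B
  proof -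
    have "(SIGMA g:space borel. Pair g -` B) = B"
      by auto
    moreover have "B \<in> sets (borel \<Otimes>\<^sub>M borel)"
      using B by (simp only: borel_prod)
    ultimately have "(\<lambda>g. emeasure (\<kappa> g) (Pair g -` B)) \<in> borel_measurable borel"
      by (intro emeasure_measurable_subprob_algebra2[OF _ \<kappa>']) simp
    then show ?thesis by (simp add: vimage_def)
  qed
  have mJ: "(\<lambda>w. h (fst w) * indicator B w) \<in> borel_measurable J"
    if [measurable]: "h \<in> borel_measurable borel" "B \<in> sets borel" for h :: "real \<Rightarrow> ennreal" and B
  proof -
    have "(\<lambda>w::real \<times> real. h (fst w) * indicator B w) \<in> borel_measurable borel"
      by (intro borel_measurable_times_ennreal borel_measurable_indicator that
          measurable_compose[OF _ that(1)] borel_measurable_continuous_onI continuous_intros)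
    then show ?thesis by (simp add: measurable_cong_sets[OF sJ refl])
  qed
  have mM: "(\<lambda>g. h g * emeasure (\<kappa> g) {l. (g, l) \<in> B}) \<in> borel_measurable M"
    if "h \<in> borel_measurable borel" "B \<in> sets borel" for h :: "real \<Rightarrow> ennreal" and B
    using that by (simp add: measurable_cong_sets[OF sM refl] em borel_measurable_times_ennreal)
  have key: "(\<integral>\<^sup>+ w. h (fst w) * indicator B w \<partial>J) = (\<integral>\<^sup>+ g. h g * emeasure (\<kappa> g) {l. (g, l) \<in> B} \<partial>M)"
    if h: "h \<in> borel_measurable borel" and B: "B \<in> sets borel" for h :: "real \<Rightarrow> ennreal" and B
    using h
  proof (induction rule: borel_measurable_induct)
    case (cong f g)
    then show ?case by simp
  next
    case (set A)
    have AB: "B \<inter> (A \<times> UNIV) \<in> sets borel"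
      using B set by (metis borel_Times borel_open open_UNIV sets.Int)
    have "(\<integral>\<^sup>+ w. indicator A (fst w) * indicator B w \<partial>J) = (\<integral>\<^sup>+ w. indicator (B \<inter> (A \<times> UNIV)) w \<partial>J)"
      by (intro nn_integral_cong) (auto split: split_indicator)
    also have "\<dots> = emeasure J (B \<inter> (A \<times> UNIV))"
      using AB sJ by simp
    also have "\<dots> = (\<integral>\<^sup>+ g. emeasure (\<kappa> g) {l. (g, l) \<in> B \<inter> (A \<times> UNIV)} \<partial>M)"
      by (rule J[OF AB])
    also have "\<dots> = (\<integral>\<^sup>+ g. indicator A g * emeasure (\<kappa> g) {l. (g, l) \<in> B} \<partial>M)"
      by (intro nn_integral_cong) (auto split: split_indicator)
    finally show ?case .
  next
    case (mult u c)
    then show ?case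
      by (simp add: mult.assoc nn_integral_cmult mJ[OF _ B] mM[OF _ B])
  next
    case (add u v)
    then show ?case
      by (simp add: distrib_right nn_integral_add mJ[OF _ B] mM[OF _ B])
  next
    case (seq U)
    have [simp]: "incseq (\<lambda>i x. U i (fst x) * indicator B x)"
      "incseq (\<lambda>i x. U i x * emeasure (\<kappa> x) {l. (x, l) \<in> B})"
      using seq(3) by (auto simp: incseq_def le_fun_def mult_right_mono)
    have "(\<integral>\<^sup>+ w. (SUP i. U i) (fst w) * indicator B w \<partial>J) = (\<integral>\<^sup>+ w. (SUP i. U i (fst w) * indicator B w) \<partial>J)"
      by (simp add: SUP_apply SUP_mult_right_ennreal image_image)
    also have "\<dots> = (SUP i. \<integral>\<^sup>+ w. U i (fst w) * indicator B w \<partial>J)"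
      by (rule nn_integral_monotone_convergence_SUP)
         (simp_all add: mJ[OF seq(1) B])
    also have "\<dots> = (SUP i. \<integral>\<^sup>+ g. U i g * emeasure (\<kappa> g) {l. (g, l) \<in> B} \<partial>M)"
      using seq by simp
    also have "\<dots> = (\<integral>\<^sup>+ g. (SUP i. U i g * emeasure (\<kappa> g) {l. (g, l) \<in> B}) \<partial>M)"
      by (rule nn_integral_monotone_convergence_SUP[symmetric])
         (simp_all add: mM[OF seq(1) B])
    also have "\<dots> = (\<integral>\<^sup>+ g. (SUP i. U i) g * emeasure (\<kappa> g) {l. (g, l) \<in> B} \<partial>M)"
      by (simp add: SUP_apply SUP_mult_right_ennreal image_image)
    finally show ?case .
  qed
  have "(\<lambda>w. f (fst w)) \<in> borel_measurable J"
    using mJ[OF f, of UNIV] by simp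
  then have "emeasure (density J (\<lambda>(g, l). f g)) A = (\<integral>\<^sup>+ w. f (fst w) * indicator A w \<partial>J)"
    using A sJ by (simp add: emeasure_density case_prod_beta)
  also have "\<dots> = (\<integral>\<^sup>+ g. f g * emeasure (\<kappa> g) {l. (g, l) \<in> A} \<partial>M)"
    by (rule key[OF f A])
  also have "\<dots> = (\<integral>\<^sup>+ g. emeasure (\<kappa> g) {l. (g, l) \<in> A} \<partial>density M f)"
    using f A by (simp add: nn_integral_density measurable_cong_sets[OF sM refl] em)
  finally show ?thesis .
qed

definition state_space :: "('s \<times> real) measure" where
  "state_space = count_space UNIV \<Otimes>\<^sub>M borel"

definition tilted_state :: "('s::finite \<Rightarrow> 's pmf) \<Rightarrow> (real \<times> real) measure \<Rightarrow> ('s \<Rightarrow> real \<Rightarrow> real)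
    \<Rightarrow> (real \<Rightarrow> real ^ 's) \<Rightarrow> real \<Rightarrow> 's \<Rightarrow> 's pmf" where
  "tilted_state K \<nu> \<gamma> u \<theta> x =
     embed_pmf (\<lambda>y. pmf (K x) y * exp (chi \<nu> \<gamma> y \<theta>) * (u \<theta> $ y) / (u \<theta> $ x))"

definition Y_step :: "real \<Rightarrow> 's pmf \<Rightarrow> ('s \<Rightarrow> (real \<times> real) measure) \<Rightarrow> real
    \<Rightarrow> ('s \<times> real) measure" where
  "Y_step \<Delta> p J z =
     measure_pmf p \<bind> (\<lambda>y. distr (J y) state_space (\<lambda>(g, l). (y, z * exp (- g) - \<Delta> * l)))"

definition sampler_kernel :: "('s::finite \<Rightarrow> 's pmf) \<Rightarrow> (real \<times> real) measure \<Rightarrow> ('s \<Rightarrow> real \<Rightarrow> real)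
    \<Rightarrow> ('s \<Rightarrow> real \<Rightarrow> real) \<Rightarrow> (real \<Rightarrow> real ^ 's) \<Rightarrow> real \<Rightarrow> real \<Rightarrow> real \<Rightarrow> real
    \<Rightarrow> 's \<times> real \<Rightarrow> ('s \<times> real) measure" where
  "sampler_kernel K \<nu> \<gamma> lam u \<theta>s B1 B2 \<Delta> = (\<lambda>(x, z).
     if (x, z) \<in> region_C u \<theta>s B1 B2 \<Delta>
     then Y_step \<Delta> (tilted_state K \<nu> \<gamma> u \<theta>s x) (tilted_increment_law \<nu> \<gamma> lam \<theta>s) z
     else Y_step \<Delta> (K x) (increment_law \<nu> \<gamma> lam) z)"

text \<open>Law on path space of the time-homogeneous Markov process with kernel \<open>k\<close> started at \<open>y\<^sub>0\<close>.\<close>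

definition markov_steps :: "'a measure \<Rightarrow> ('a \<Rightarrow> 'a measure) \<Rightarrow> 'a \<Rightarrow> nat \<Rightarrow> (nat \<Rightarrow> 'a) \<Rightarrow> 'a measure" where
  "markov_steps S k y0 n \<omega> = (case n of 0 \<Rightarrow> return S y0 | Suc m \<Rightarrow> k (\<omega> m))"

definition markov_law :: "'a measure \<Rightarrow> ('a \<Rightarrow> 'a measure) \<Rightarrow> 'a \<Rightarrow> (nat \<Rightarrow> 'a) measure" where
  "markov_law S k y0 =
     projective_family.lim UNIV (Ionescu_Tulcea.CI (markov_steps S k y0) (\<lambda>_. S)) (\<lambda>_. S)"

lemma Ionescu_Tulcea_markov_steps:
  assumes k[measurable]: "k \<in> S \<rightarrow>\<^sub>M prob_algebra S" and y0: "y0 \<in> space S"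
  shows "Ionescu_Tulcea (markov_steps S k y0) (\<lambda>_. S)"
proof (rule Ionescu_Tulcea.intro)
  have k': "k \<in> S \<rightarrow>\<^sub>M subprob_algebra S"
    using k by (rule measurable_prob_algebraD)
  show "markov_steps S k y0 i \<in> Pi\<^sub>M {0..<i} (\<lambda>_. S) \<rightarrow>\<^sub>M subprob_algebra S" for i
  proof (cases i)
    case 0
    then show ?thesis
      using y0 by (simp add: markov_steps_def[abs_def] prob_space_return prob_space_imp_subprob_space
          space_subprob_algebra)
  next
    case (Suc m)
    then have "(\<lambda>\<omega>. k (\<omega> m)) \<in> Pi\<^sub>M {0..<i} (\<lambda>_. S) \<rightarrow>\<^sub>M subprob_algebra S"
      by (intro measurable_compose[OF _ k'] measurable_component_singleton) simp
    then show ?thesis using Suc by (simp add: markov_steps_def[abs_def])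
  qed
  show "prob_space (markov_steps S k y0 i \<omega>)" if "\<omega> \<in> space (Pi\<^sub>M {0..<i} (\<lambda>_. S))" for i \<omega>
  proof (cases i)
    case 0
    then show ?thesis using y0 by (simp add: markov_steps_def prob_space_return)
  next
    case (Suc m)
    then have "\<omega> m \<in> space S" using that by (auto simp: space_PiM)
    then show ?thesis
      using measurable_space[OF k] Suc by (simp add: markov_steps_def space_prob_algebra)
  qed
qed

definition T_B :: "(nat \<Rightarrow> 's \<times> real) \<Rightarrow> enat" where
  "T_B \<omega> = (INF n \<in> {n. 0 < n \<and> \<omega> n \<in> region_B}. enat n)"

definition sampler_law :: "('s::finite \<Rightarrow> 's pmf) \<Rightarrow> (real \<times> real) measure \<Rightarrow> ('s \<Rightarrow> real \<Rightarrow> real)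
    \<Rightarrow> ('s \<Rightarrow> real \<Rightarrow> real) \<Rightarrow> (real \<Rightarrow> real ^ 's) \<Rightarrow> real \<Rightarrow> real \<Rightarrow> real \<Rightarrow> real
    \<Rightarrow> 's \<times> real \<Rightarrow> (nat \<Rightarrow> 's \<times> real) measure" where
  "sampler_law K \<nu> \<gamma> lam u \<theta>s B1 B2 \<Delta> =
     markov_law state_space (sampler_kernel K \<nu> \<gamma> lam u \<theta>s B1 B2 \<Delta>)"

end

theory Submission
  imports Defs "HOL-Real_Asymp.Real_Asymp"
begin

text \<open>
  Why the sampler terminates quickly.  The set \<open>z \<le> 0\<close> is absorbing, so the expected termination time is at
  most \<open>1 + (\<Sum>n. P (Z\<^sub>n > 0))\<close> and everything reduces to iterating the one-step operator \<open>f \<mapsto> E\<^sub>y f(Y\<^sub>1)\<close>.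
  It then suffices to find a nonnegative \<open>\<Psi>\<close> with \<open>E\<^sub>y \<Psi>(Y\<^sub>1) + 1 \<le> \<Psi>(y)\<close> as long as \<open>z > 0\<close>: the sum is
  at most \<open>\<Psi>(y\<^sub>0)\<close>.  The function \<open>\<Psi>\<close> has one part for each regime.
  
  Above the threshold the steps are tilted.  For small \<open>\<delta> > 0\<close> put
  \<open>V(x,z) = (z\<^sup>+)\<^sup>\<delta> u\<^bsub>\<theta>-\<delta>\<^esub>(x) / u\<^bsub>\<theta>\<^esub>(x)\<close> with \<open>\<theta> = \<theta>\<^sub>*\<close>.  The tilting turns the eigenvector equation at
  \<open>\<theta> - \<delta>\<close> into \<open>E V(Y\<^sub>1) \<le> q V(y)\<close> with \<open>q = exp (\<psi>(\<theta> - \<delta>))\<close>, and \<open>q < 1\<close> because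
  \<open>q \<le> 1 - \<delta>\<mu> + b\<^sub>1\<delta>\<^sup>2\<close>.  By concavity of the logarithm, a multiple \<open>F\<close> of \<open>ln (1 + V/v\<^sub>0)\<close> loses at least 1 per
  step there.  Below the threshold the step is nominal and \<open>E F(Y\<^sub>1)\<close> is bounded, since
  \<open>exp (- \<delta> \<gamma>)\<close> is integrable and \<open>V\<close> is homogeneous in \<open>z\<close>.
  
  Below the threshold progress comes from a chance to terminate that is at least a negative power of \<open>c\<close>.  Tilted steps
  restricted to \<open>\<gamma> \<le> M\<close>, for a large \<open>M\<close>, are dominated by a constant times the actual step of either regime.  The
  truncated operator keeps mass at least \<open>\<surd>q\<close> per step but still contracts \<open>V\<close> by \<open>q\<close>, so after
  \<open>n = O(log c)\<close> steps at least half of the mass that is left sits at \<open>z \<le> \<kappa>\<Delta>\<close>.  From there irreducibility and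
  \<open>\<lambda> > 0\<close> with positive probability lead to \<open>z \<le> 0\<close> within a bounded number of steps.  Altogether
  \<open>P\<^sub>y (T > N) \<le> 1 - \<epsilon>\<close> with \<open>N = O(log c)\<close> and \<open>1/\<epsilon> = O(c\<^sup>p)\<close>.  Then
  \<open>\<Phi>(y) = E\<^sub>y (min T N)\<close> drops by \<open>\<epsilon>\<close> on average in each step below the threshold and never increases on
  average, and \<open>\<Psi> = F + const/\<epsilon> \<cdot> \<Phi>\<close> works in both regimes.  As \<open>\<Phi> \<le> N\<close>, the bound is of order
  \<open>F(y\<^sub>0) + N/\<epsilon>\<close>, that is \<open>log (1/(c\<Delta>)) + c\<^sup>p log c\<close>.
  
  The lemmas that carry this are \<open>expected_time_le\<close> (combining the two regimes),
  \<open>weighted_step_tilted_potential\<close> (contraction of \<open>V\<close>), \<open>log_potential_drift_outer\<close>,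
  \<open>descent_probability\<close>, \<open>hits_from_below_exists\<close> and \<open>hit_probability_lower_bound\<close>.
\<close>

section \<open>Markov kernels as operators, and the marginals of the path law\<close>

definition kernel_op :: "('a \<Rightarrow> 'a measure) \<Rightarrow> ('a \<Rightarrow> ennreal) \<Rightarrow> 'a \<Rightarrow> ennreal" where
  "kernel_op k f y = (\<integral>\<^sup>+ y'. f y' \<partial>k y)"

context
  fixes S :: "'a measure" and k
  assumes k: "k \<in> S \<rightarrow>\<^sub>M prob_algebra S"
begin

lemma kernel_sets: "y \<in> space S \<Longrightarrow> sets (k y) = sets S"
  using measurable_space[OF k] by (simp add: space_prob_algebra)

lemma kernel_space: "y \<in> space S \<Longrightarrow> space (k y) = space S"
  using kernel_sets sets_eq_imp_space_eq by blast

lemma kernel_prob: "y \<in> space S \<Longrightarrow> prob_space (k y)"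
  using measurable_space[OF k] by (simp add: space_prob_algebra)

lemma kernel_measurable: "y \<in> space S \<Longrightarrow> f \<in> borel_measurable S \<Longrightarrow> f \<in> borel_measurable (k y)"
  using measurable_cong_sets[OF kernel_sets refl] by blast

lemma kernel_op_measurable:
  "f \<in> borel_measurable S \<Longrightarrow> kernel_op k f \<in> borel_measurable S"
  unfolding kernel_op_def[abs_def]
  by (rule measurable_compose[OF measurable_prob_algebraD[OF k] nn_integral_measurable_subprob_algebra])

lemma kernel_op_iter_measurable:
  "f \<in> borel_measurable S \<Longrightarrow> (kernel_op k ^^ n) f \<in> borel_measurable S"
  by (induction n) (auto intro: kernel_op_measurable)

lemma kernel_op_mono:
  "y \<in> space S \<Longrightarrow> (\<And>z. z \<in> space S \<Longrightarrow> f z \<le> g z) \<Longrightarrow> kernel_op k f y \<le> kernel_op k g y"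
  unfolding kernel_op_def by (intro nn_integral_mono) (simp add: kernel_space)

lemma kernel_op_add:
  "y \<in> space S \<Longrightarrow> f \<in> borel_measurable S \<Longrightarrow> g \<in> borel_measurable S \<Longrightarrow>
    kernel_op k (\<lambda>z. f z + g z) y = kernel_op k f y + kernel_op k g y"
  unfolding kernel_op_def by (intro nn_integral_add) (auto intro: kernel_measurable)

lemma kernel_op_cmult:
  "y \<in> space S \<Longrightarrow> f \<in> borel_measurable S \<Longrightarrow>
    kernel_op k (\<lambda>z. c * f z) y = c * kernel_op k f y"
  unfolding kernel_op_def by (intro nn_integral_cmult) (auto intro: kernel_measurable)

lemma kernel_op_sum:
  "y \<in> space S \<Longrightarrow> (\<And>i. i \<in> I \<Longrightarrow> f i \<in> borel_measurable S) \<Longrightarrow>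
    kernel_op k (\<lambda>z. \<Sum>i\<in>I. f i z) y = (\<Sum>i\<in>I. kernel_op k (f i) y)"
  unfolding kernel_op_def by (intro nn_integral_sum) (auto intro: kernel_measurable)

lemma kernel_op_const: "y \<in> space S \<Longrightarrow> kernel_op k (\<lambda>_. c) y = c"
  unfolding kernel_op_def using prob_space.emeasure_space_1[OF kernel_prob] by simp

lemma kernel_op_iter_mono:
  "y \<in> space S \<Longrightarrow> (\<And>z. z \<in> space S \<Longrightarrow> f z \<le> g z) \<Longrightarrow> (kernel_op k ^^ n) f y \<le> (kernel_op k ^^ n) g y"
  by (induction n arbitrary: y) (auto intro: kernel_op_mono)

lemma kernel_op_cong:
  "y \<in> space S \<Longrightarrow> (\<And>z. z \<in> space S \<Longrightarrow> f z = g z) \<Longrightarrow> kernel_op k f y = kernel_op k g y"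
  unfolding kernel_op_def by (intro nn_integral_cong) (simp add: kernel_space)

lemma kernel_op_iter_cmult:
  assumes y: "y \<in> space S" and f: "f \<in> borel_measurable S"
  shows "(kernel_op k ^^ n) (\<lambda>z. c * f z) y = c * (kernel_op k ^^ n) f y"
  using y
proof (induction n arbitrary: y)
  case (Suc n)
  have "kernel_op k ((kernel_op k ^^ n) (\<lambda>z. c * f z)) y = kernel_op k (\<lambda>z. c * (kernel_op k ^^ n) f z) y"
    using Suc by (intro kernel_op_cong) auto
  also have "\<dots> = c * kernel_op k ((kernel_op k ^^ n) f) y"
    using Suc.prems f by (intro kernel_op_cmult kernel_op_iter_measurable) auto
  finally show ?case by simp
qed simp

lemma kernel_op_iter_split:
  assumes y: "y \<in> space S" and A: "A \<in> sets S"
  shows "(kernel_op k ^^ n) (indicator A) y + (kernel_op k ^^ n) (indicator (- A)) y = 1"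
proof -
  have m: "indicator (- A) \<in> borel_measurable S"
    using A by (subst measurable_cong[where g="indicator (space S - A)"]) (auto split: split_indicator)
  show ?thesis using y
  proof (induction n arbitrary: y)
    case 0 then show ?case by (auto split: split_indicator)
  next
    case (Suc n)
    have "kernel_op k ((kernel_op k ^^ n) (indicator A)) y + kernel_op k ((kernel_op k ^^ n) (indicator (- A))) y
      = kernel_op k (\<lambda>z. (kernel_op k ^^ n) (indicator A) z + (kernel_op k ^^ n) (indicator (- A)) z) y"
      using Suc.prems A m by (intro kernel_op_add[symmetric] kernel_op_iter_measurable) auto
    also have "\<dots> = kernel_op k (\<lambda>_. 1) y"
      using Suc by (intro kernel_op_cong) auto
    also have "\<dots> = 1" using Suc.prems by (rule kernel_op_const)
    finally show ?case by simp
  qed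
qed

text \<open>
  By construction the law of the first \<open>n + 1\<close> coordinates is an iterated kernel composition, so integrating a
  function of the last coordinate peels off one application of the kernel at a time.
\<close>

lemma markov_law_facts:
  assumes y0: "y0 \<in> space S"
  shows sets_markov_law: "sets (markov_law S k y0) = sets (PiM UNIV (\<lambda>_. S))"
    and prob_space_markov_law: "prob_space (markov_law S k y0)"
    and nn_integral_markov_law: "f \<in> borel_measurable S \<Longrightarrow>
      (\<integral>\<^sup>+ \<omega>. f (\<omega> n) \<partial>markov_law S k y0) = (kernel_op k ^^ n) f y0"
proof -
  interpret IT: Ionescu_Tulcea "markov_steps S k y0" "\<lambda>_. S"
    using k y0 by (rule Ionescu_Tulcea_markov_steps)
  have ml: "markov_law S k y0 = IT.PF.lim"
    by (simp add: markov_law_def)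
  show s: "sets (markov_law S k y0) = sets (PiM UNIV (\<lambda>_. S))"
    unfolding ml by simp
  have d: "distr IT.PF.lim (PiM J (\<lambda>_. S)) (\<lambda>x. restrict x J) = IT.CI J" if "finite J" for J
    using that by (rule IT.distr_lim)
  have rm: "(\<lambda>x. restrict x J) \<in> markov_law S k y0 \<rightarrow>\<^sub>M PiM J (\<lambda>_. S)" for J
    unfolding measurable_cong_sets[OF s refl] by (rule measurable_restrict_subset) simp
  show "prob_space (markov_law S k y0)"
  proof (rule prob_space_distrD[of "\<lambda>x. restrict x {}"])
    show "(\<lambda>x. restrict x {}) \<in> markov_law S k y0 \<rightarrow>\<^sub>M PiM {} (\<lambda>_. S)" by (rule rm)
    show "prob_space (distr (markov_law S k y0) (PiM {} (\<lambda>_. S)) (\<lambda>x. restrict x {}))"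
      unfolding ml d[OF finite.emptyI] by (rule IT.PF.prob_space_P) simp_all
  qed
  show "(\<integral>\<^sup>+ \<omega>. f (\<omega> n) \<partial>markov_law S k y0) = (kernel_op k ^^ n) f y0"
    if f: "f \<in> borel_measurable S"
  proof -
    let ?J = "{0..<Suc n}"
    have u: "IT.up_to ?J = Suc n"
      by (intro antisym) (auto simp: IT.up_to_iff_Ico Suc_le_eq IT.up_to_less)
    have un: "(\<lambda>x. undefined) \<in> space (PiM {0..<0::nat} (\<lambda>_. S))"
      by (simp add: space_PiM)
    have fm: "(\<lambda>\<omega>. g (\<omega> m)) \<in> borel_measurable (PiM {0..<Suc m} (\<lambda>_. S))"
      if "g \<in> borel_measurable S" for m and g :: "'a \<Rightarrow> ennreal"
      by (rule measurable_compose[where N=S, OF _ that]) (simp add: measurable_component_singleton)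
    have "(\<integral>\<^sup>+ \<omega>. f (\<omega> n) \<partial>markov_law S k y0) = (\<integral>\<^sup>+ \<omega>. f (restrict \<omega> ?J n) \<partial>markov_law S k y0)"
      by (intro nn_integral_cong) simp
    also have "\<dots> = (\<integral>\<^sup>+ \<omega>. f (\<omega> n) \<partial>distr (markov_law S k y0) (PiM ?J (\<lambda>_. S)) (\<lambda>x. restrict x ?J))"
      using fm[OF f] by (intro nn_integral_distr[symmetric] rm) auto
    also have "\<dots> = (\<integral>\<^sup>+ \<omega>. f (\<omega> n) \<partial>IT.CI ?J)"
      unfolding ml by (subst d) simp_all
    also have "\<dots> = (\<integral>\<^sup>+ \<omega>. f (\<omega> n) \<partial>IT.C 0 (Suc n) (\<lambda>x. undefined))"
      unfolding IT.CI_def u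
      using fm[OF f] by (subst nn_integral_distr)
        (auto intro!: measurable_restrict simp: measurable_cong_sets[OF IT.sets_C[OF un] refl] simp del: IT.C.simps)
    also have "\<dots> = (kernel_op k ^^ n) f y0"
      using f
    proof (induction n arbitrary: f)
      case 0
      have "(\<integral>\<^sup>+ \<omega>. f (\<omega> 0) \<partial>IT.C 0 (Suc 0) (\<lambda>x. undefined))
        = (\<integral>\<^sup>+ \<omega>. (\<integral>\<^sup>+ \<omega>'. f (\<omega>' 0) \<partial>IT.eP 0 \<omega>) \<partial>return (PiM {0..<0} (\<lambda>_. S)) (\<lambda>x. undefined))"
        using fm[OF 0, of 0] IT.measurable_eP[of 0]
        unfolding IT.C.simps add_0_left
        by (subst nn_integral_bind[where B="PiM {0..<Suc 0} (\<lambda>_. S)"]) (simp_all only: measurable_return1 measurable_cong_sets[OF sets_return refl])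
      also have "\<dots> = (\<integral>\<^sup>+ \<omega>'. f (\<omega>' 0) \<partial>IT.eP 0 (\<lambda>x. undefined))"
        using un by (intro nn_integral_return measurable_compose[OF IT.measurable_eP nn_integral_measurable_subprob_algebra] fm 0) 
      also have "\<dots> = f y0"
        using fm[OF 0, of 0] un y0 0 by (subst IT.nn_integral_eP) (simp_all add: markov_steps_def nn_integral_return)
      finally show ?case by simp
    next
      case (Suc n)
      let ?C = "IT.C 0 (Suc n) (\<lambda>x. undefined)"
      have "(\<integral>\<^sup>+ \<omega>. f (\<omega> (Suc n)) \<partial>IT.C 0 (Suc (Suc n)) (\<lambda>x. undefined))
        = (\<integral>\<^sup>+ \<omega>. (\<integral>\<^sup>+ \<omega>'. f (\<omega>' (Suc n)) \<partial>IT.eP (Suc n) \<omega>) \<partial>?C)"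
        using fm[OF Suc.prems, of "Suc n"] IT.measurable_eP[of "Suc n"]
        unfolding IT.C.simps(2)[of 0 "Suc n"] add_0_left
        by (subst nn_integral_bind[where B="PiM {0..<Suc (Suc n)} (\<lambda>_. S)"])
          (simp_all only: measurable_cong_sets[OF IT.sets_C[OF un, of "Suc n"] refl] add_0_left)
      also have "\<dots> = (\<integral>\<^sup>+ \<omega>. kernel_op k f (\<omega> n) \<partial>?C)"
        using IT.space_C[OF un, of "Suc n"] fm[OF Suc.prems, of "Suc n"]
        by (intro nn_integral_cong) (simp add: IT.nn_integral_eP markov_steps_def kernel_op_def del: IT.C.simps)
      also have "\<dots> = (kernel_op k ^^ Suc n) f y0"
        by (subst Suc.IH) (auto intro: kernel_op_measurable Suc.prems simp: funpow_swap1)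
      finally show ?case .
    qed
    finally show ?thesis .
  qed
qed

text \<open>
  Iterating the hypothesis gives \<open>(\<Sum>n<N. P\<^sup>n 1\<^sub>A) + P\<^sup>N \<Psi> \<le> \<Psi>\<close>; the sum is the expected time spent in \<open>A\<close>.
\<close>

section \<open>Expected hitting times from drift conditions\<close>

lemma sum_iter_le_of_supersolution:
  assumes A: "A \<in> sets S" and \<Psi>: "\<Psi> \<in> borel_measurable S"
    and drift: "\<And>y. y \<in> space S \<Longrightarrow> kernel_op k \<Psi> y + indicator A y \<le> \<Psi> y"
    and y: "y \<in> space S"
  shows "(\<Sum>n. (kernel_op k ^^ n) (indicator A) y) \<le> \<Psi> y"
proof -
  have "(\<Sum>n<N. (kernel_op k ^^ n) (indicator A) y) + (kernel_op k ^^ N) \<Psi> y \<le> \<Psi> y" for N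
  proof (induction N)
    case (Suc N)
    have "(kernel_op k ^^ N) (indicator A) y + (kernel_op k ^^ N) (kernel_op k \<Psi>) y \<le> (kernel_op k ^^ N) \<Psi> y"
      using y
    proof (induction N arbitrary: y)
      case 0 then show ?case using drift[of y] by (simp add: add.commute)
    next
      case (Suc N)
      have "kernel_op k ((kernel_op k ^^ N) (indicator A)) y + kernel_op k ((kernel_op k ^^ N) (kernel_op k \<Psi>)) y
        = kernel_op k (\<lambda>z. (kernel_op k ^^ N) (indicator A) z + (kernel_op k ^^ N) (kernel_op k \<Psi>) z) y"
        using Suc.prems A \<Psi>
        by (intro kernel_op_add[symmetric] kernel_op_iter_measurable kernel_op_measurable) auto
      also have "\<dots> \<le> kernel_op k ((kernel_op k ^^ N) \<Psi>) y"
        using Suc by (intro kernel_op_mono) auto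
      finally show ?case by simp
    qed
    then have "(\<Sum>n<N. (kernel_op k ^^ n) (indicator A) y)
        + ((kernel_op k ^^ N) (indicator A) y + (kernel_op k ^^ Suc N) \<Psi> y)
      \<le> (\<Sum>n<N. (kernel_op k ^^ n) (indicator A) y) + (kernel_op k ^^ N) \<Psi> y"
      by (intro add_left_mono) (simp add: funpow_swap1)
    also note Suc.IH
    finally show ?case by (simp add: add.assoc)
  qed simp
  then have "(\<Sum>n<N. (kernel_op k ^^ n) (indicator A) y) \<le> \<Psi> y" for N
    by (meson le_iff_add order_trans)
  then show ?thesis
    unfolding suminf_eq_SUP by (rule SUP_least)
qed

text \<open>
  Here \<open>A\<close> is the set of states that are still alive.  Outside \<open>D\<close> the function \<open>F\<close> decreases by 1.  Inside \<open>D\<close>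
  it may jump up to \<open>b\<close>, which is paid for by the chance \<open>\<epsilon>\<close> of leaving \<open>A\<close> within \<open>N\<close> steps: the expected time
  \<open>\<Phi>\<close> spent in \<open>A\<close> before step \<open>N\<close> satisfies \<open>P \<Phi> + 1\<^sub>A = \<Phi> + P\<^sup>N 1\<^sub>A\<close>, hence loses \<open>\<epsilon>\<close> inside \<open>D\<close> and gains
  nothing elsewhere.
\<close>

lemma expected_time_le:
  fixes N :: nat and b \<epsilon> :: real
  assumes A: "A \<in> sets S" and F: "F \<in> borel_measurable S"
    and b: "0 \<le> b" and \<epsilon>: "0 < \<epsilon>"
    and absorb: "\<And>y. y \<in> space S \<Longrightarrow> y \<notin> A \<Longrightarrow> kernel_op k (indicator A) y = 0"
    and F_off: "\<And>y. y \<notin> A \<Longrightarrow> F y = 0"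
    and outer: "\<And>y. y \<in> A \<Longrightarrow> y \<notin> D \<Longrightarrow> kernel_op k F y + 1 \<le> F y"
    and inner: "\<And>y. y \<in> A \<Longrightarrow> y \<in> D \<Longrightarrow> kernel_op k F y \<le> ennreal b"
    and hit: "\<And>y. y \<in> A \<Longrightarrow> y \<in> D \<Longrightarrow> (kernel_op k ^^ N) (indicator A) y + ennreal \<epsilon> \<le> 1"
    and y: "y \<in> space S"
  shows "(\<Sum>n. (kernel_op k ^^ n) (indicator A) y) \<le> F y + ennreal ((1 + b) / \<epsilon> * N)"
proof -
  \<comment> \<open>The loss of \<open>\<epsilon>\<close> in \<open>\<Phi>\<close> must pay for the level \<open>b\<close> of \<open>F\<close> and for the required decrease by 1.\<close>
  define c where "c = ennreal ((1 + b) / \<epsilon>)"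
  define H where "H n = (kernel_op k ^^ n) (indicator A)" for n
  define \<Phi> where "\<Phi> z = (\<Sum>n<N. H n z)" for z
  have AS: "y \<in> A \<Longrightarrow> y \<in> space S" for y using A sets.sets_into_space by blast
  have Hm: "H n \<in> borel_measurable S" for n
    unfolding H_def using A by (intro kernel_op_iter_measurable) simp
  have \<Phi>m: "\<Phi> \<in> borel_measurable S"
    unfolding \<Phi>_def using Hm by auto
  have H1: "H n z \<le> 1" if "z \<in> space S" for n z
    unfolding H_def using kernel_op_iter_split[OF that A, of n] by (metis le_iff_add)
  have Hoff: "H n z = 0" if "z \<in> space S" "z \<notin> A" for n z
    using that
  proof (induction n arbitrary: z)
    case (Suc n)
    have "kernel_op k (H n) z \<le> kernel_op k (indicator A) z"
      using Suc by (intro kernel_op_mono) (auto split: split_indicator intro: H1)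
    then show ?case using absorb[OF Suc.prems] by (simp add: H_def)
  qed (simp add: H_def)
  have K\<Phi>: "kernel_op k \<Phi> z + indicator A z = \<Phi> z + H N z" if "z \<in> space S" for z
  proof -
    have "kernel_op k \<Phi> z = (\<Sum>n<N. H (Suc n) z)"
      unfolding \<Phi>_def using that Hm by (subst kernel_op_sum) (auto simp: H_def)
    then have "kernel_op k \<Phi> z + H 0 z = (\<Sum>n<Suc N. H n z)"
      by (simp add: sum.lessThan_Suc_shift add.commute del: sum.lessThan_Suc)
    then show ?thesis by (simp add: \<Phi>_def H_def)
  qed
  have \<Phi>N: "\<Phi> z \<le> ennreal N" if "z \<in> space S" for z
    unfolding \<Phi>_def using sum_mono[of "{..<N}" "\<lambda>n. H n z" "\<lambda>_. 1"] H1[OF that] by (simp add: ennreal_of_nat_eq_real_of_nat)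
  have \<Phi>le: "kernel_op k \<Phi> z \<le> \<Phi> z" if z: "z \<in> A" for z
  proof -
    have "kernel_op k \<Phi> z + 1 = \<Phi> z + H N z" using K\<Phi>[OF AS[OF z]] z by simp
    also have "\<dots> \<le> \<Phi> z + 1" using H1[OF AS[OF z]] by (intro add_left_mono)
    finally show ?thesis by (simp add: ennreal_add_left_cancel_le add.commute[of _ 1])
  qed
  have \<Phi>gain: "kernel_op k \<Phi> z + ennreal \<epsilon> \<le> \<Phi> z" if z: "z \<in> A" "z \<in> D" for z
  proof -
    have "H N z + (kernel_op k \<Phi> z + ennreal \<epsilon>) \<le> kernel_op k \<Phi> z + 1"
      using add_left_mono[OF hit[OF z], of "kernel_op k \<Phi> z"] by (simp add: H_def ac_simps)
    also have "\<dots> = H N z + \<Phi> z" using K\<Phi>[OF AS[OF z(1)]] z by (simp add: add.commute)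
    finally show ?thesis
      using H1[OF AS[OF z(1)], of N] by (auto simp: ennreal_add_left_cancel_le top_unique)
  qed
  have c\<epsilon>: "c * ennreal \<epsilon> = 1 + ennreal b"
    unfolding c_def using b \<epsilon> ennreal_plus[of 1 b] by (simp add: ennreal_mult[symmetric] del: ennreal_plus)
  define \<Psi> where "\<Psi> z = F z + c * \<Phi> z" for z
  have K\<Psi>: "kernel_op k \<Psi> z = kernel_op k F z + c * kernel_op k \<Phi> z" if "z \<in> space S" for z
    unfolding \<Psi>_def using that F \<Phi>m by (subst kernel_op_add) (auto simp: kernel_op_cmult)
  have "(\<Sum>n. (kernel_op k ^^ n) (indicator A) y) \<le> \<Psi> y"
  proof (rule sum_iter_le_of_supersolution[OF A _ _ y])
    show "\<Psi> \<in> borel_measurable S" unfolding \<Psi>_def using F \<Phi>m by auto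
    fix z assume z: "z \<in> space S"
    consider "z \<notin> A" | "z \<in> A" "z \<in> D" | "z \<in> A" "z \<notin> D" by blast
    then show "kernel_op k \<Psi> z + indicator A z \<le> \<Psi> z"
    proof cases
      case 1
      have "kernel_op k \<Psi> z \<le> kernel_op k (\<lambda>x. \<infinity> * indicator A x) z"
        using z Hoff F_off by (intro kernel_op_mono) (auto simp: \<Psi>_def \<Phi>_def split: split_indicator)
      also have "\<dots> = 0" using absorb[OF z 1] A z by (subst kernel_op_cmult) auto
      finally show ?thesis using 1 by simp
    next
      case 2
      have "kernel_op k \<Psi> z + 1 \<le> (ennreal b + c * kernel_op k \<Phi> z) + 1"
        unfolding K\<Psi>[OF z] using inner[OF 2] by (intro add_right_mono) auto
      also have "\<dots> = c * (kernel_op k \<Phi> z + ennreal \<epsilon>)"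
        by (simp add: distrib_left c\<epsilon> ac_simps)
      also have "\<dots> \<le> c * \<Phi> z" using \<Phi>gain[OF 2] by (rule mult_left_mono) simp
      also have "\<dots> \<le> \<Psi> z" unfolding \<Psi>_def by simp
      finally show ?thesis using 2 by simp
    next
      case 3
      have "kernel_op k \<Psi> z + 1 = (kernel_op k F z + 1) + c * kernel_op k \<Phi> z"
        unfolding K\<Psi>[OF z] by (simp add: ac_simps)
      also have "\<dots> \<le> F z + c * \<Phi> z"
        using outer[OF 3] \<Phi>le[OF 3(1)] by (intro add_mono mult_left_mono) auto
      finally show ?thesis using 3 by (simp add: \<Psi>_def)
    qed
  qed
  also have "\<dots> \<le> F y + c * ennreal N"
    unfolding \<Psi>_def using \<Phi>N[OF y] by (intro add_left_mono mult_left_mono) auto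
  also have "c * ennreal N = ennreal ((1 + b) / \<epsilon> * N)"
    unfolding c_def using b \<epsilon> by (simp add: ennreal_mult[symmetric])
  finally show ?thesis .
qed

end

section \<open>The termination time on path space\<close>

text \<open>
  Only the first visit matters for \<open>T_B\<close>, so counting all times at which the path is outside \<open>region_B\<close> can only
  overestimate it; this removes the stopping time from the analysis.
\<close>

lemma T_B_le_sum:
  "ennreal_of_enat (T_B \<omega>) \<le> 1 + (\<Sum>n. indicator (- region_B) (\<omega> (Suc n)))"
proof -
  define f :: "nat \<Rightarrow> ennreal" where "f n = indicator (- region_B) (\<omega> (Suc n))" for n
  have *: "of_nat n \<le> (\<Sum>n. f n)" if n: "enat n < T_B \<omega>" for n
  proof -
    have "f i = 1" if "i < n" for i
    proof -
      have "\<omega> (Suc i) \<notin> region_B"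
      proof
        assume "\<omega> (Suc i) \<in> region_B"
        then have "T_B \<omega> \<le> enat (Suc i)" unfolding T_B_def by (intro INF_lower) auto
        also have "\<dots> \<le> enat n" using that by simp
        finally show False using n by simp
      qed
      then show ?thesis by (simp add: f_def)
    qed
    then have "of_nat n = (\<Sum>i<n. f i)" by simp
    also have "\<dots> \<le> (\<Sum>n. f n)" by (rule sum_le_suminf) auto
    finally show ?thesis .
  qed
  show ?thesis unfolding f_def[symmetric]
  proof (cases "T_B \<omega>")
    case (enat m)
    show "ennreal_of_enat (T_B \<omega>) \<le> 1 + (\<Sum>n. f n)"
    proof (cases m)
      case (Suc j)
      then show ?thesis using *[of j] enat by (simp add: add_left_mono)
    qed (simp add: enat)
  next
    case infinity
    have "(SUP n. of_nat n) \<le> (\<Sum>n. f n)"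
      using * infinity by (intro SUP_least) auto
    then have "(\<Sum>n. f n) = \<infinity>"
      by (simp add: ennreal_SUP_of_nat_eq_top top_unique)
    then show "ennreal_of_enat (T_B \<omega>) \<le> 1 + (\<Sum>n. f n)" by simp
  qed
qed

lemma space_state_space [simp]: "space state_space = UNIV"
  by (simp add: state_space_def space_pair_measure)

lemma measurable_state_space:
  fixes f :: "'s::finite \<times> real \<Rightarrow> 'b"
  assumes "\<And>x. (\<lambda>z. f (x, z)) \<in> borel \<rightarrow>\<^sub>M N"
  shows "f \<in> state_space \<rightarrow>\<^sub>M N"
  unfolding state_space_def using assms by (intro measurable_pair_measure_countable1) auto

lemma measurable_state_space_slice:
  assumes "f \<in> (state_space :: ('s \<times> real) measure) \<rightarrow>\<^sub>M N"
  shows "(\<lambda>z. f (x, z)) \<in> borel \<rightarrow>\<^sub>M N"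
  using assms unfolding state_space_def by (rule measurable_compose[rotated]) simp

lemma sublevel_sets:
  "{y :: 's::finite \<times> real. snd y \<le> t} \<in> sets state_space"
proof -
  have "snd -` {..t} \<inter> space (state_space :: ('s \<times> real) measure) \<in> sets state_space"
    unfolding state_space_def by (rule measurable_sets[OF measurable_snd]) simp
  then show ?thesis by (simp add: vimage_def)
qed

lemma region_B_sets: "(region_B :: ('s::finite \<times> real) set) \<in> sets state_space"
proof -
  have "{y :: 's \<times> real. snd y \<le> 0} = region_B" by (auto simp: region_B_def)
  with sublevel_sets[where 's='s, of 0] show ?thesis by (rule back_subst)
qed

lemma indicator_region_B_measurable [simp]:
  "(indicator region_B :: 's::finite \<times> real \<Rightarrow> ennreal) \<in> borel_measurable state_space"
  by (rule borel_measurable_indicator[OF region_B_sets])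

lemma T_B_expectation_le:
  fixes k :: "'s::finite \<times> real \<Rightarrow> ('s \<times> real) measure"
  assumes k: "k \<in> state_space \<rightarrow>\<^sub>M prob_algebra state_space"
  shows "(\<integral>\<^sup>+ \<omega>. ennreal_of_enat (T_B \<omega>) \<partial>markov_law state_space k y0)
    \<le> 1 + (\<Sum>n. (kernel_op k ^^ n) (indicator (- region_B)) y0)"
    and "(\<Sum>n. (kernel_op k ^^ n) (indicator (- region_B)) y0) < \<infinity> \<Longrightarrow>
      measure (markov_law state_space k y0) {\<omega> \<in> space (markov_law state_space k y0). T_B \<omega> < \<infinity>} = 1"
proof -
  let ?L = "markov_law state_space k y0"
  have y0: "y0 \<in> space state_space" by simp
  interpret prob_space ?L by (rule prob_space_markov_law[OF k y0])
  have cm: "(\<lambda>\<omega>. \<omega> n) \<in> ?L \<rightarrow>\<^sub>M state_space" for n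
    unfolding measurable_cong_sets[OF sets_markov_law[OF k y0] refl]
    by (rule measurable_component_singleton) simp
  have cB: "- (region_B :: ('s \<times> real) set) \<in> sets state_space"
    using sets.compl_sets[OF region_B_sets] by (simp add: Compl_eq_Diff_UNIV)
  have im: "(\<lambda>\<omega>. indicator (- region_B) (\<omega> n) :: ennreal) \<in> borel_measurable ?L" for n
    using cB by (intro measurable_compose[OF cm] borel_measurable_indicator)
  have sm: "(\<integral>\<^sup>+ \<omega>. (\<Sum>n. indicator (- region_B) (\<omega> (Suc n))) \<partial>?L)
    = (\<Sum>n. (kernel_op k ^^ Suc n) (indicator (- region_B)) y0)"
    using im cB by (subst nn_integral_suminf)
      (auto intro!: suminf_cong nn_integral_markov_law[OF k y0] simp del: funpow.simps)
  also have "\<dots> \<le> (\<Sum>n. (kernel_op k ^^ n) (indicator (- region_B)) y0)"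
    unfolding suminf_eq_SUP
  proof (rule SUP_least)
    fix n
    have "(\<Sum>i<n. (kernel_op k ^^ Suc i) (indicator (- region_B)) y0) \<le> (\<Sum>i<Suc n. (kernel_op k ^^ i) (indicator (- region_B)) y0)"
      by (simp add: sum.lessThan_Suc_shift del: sum.lessThan_Suc)
    also have "\<dots> \<le> (SUP n. \<Sum>i<n. (kernel_op k ^^ i) (indicator (- region_B)) y0)"
      by (rule SUP_upper) simp
    finally show "(\<Sum>i<n. (kernel_op k ^^ Suc i) (indicator (- region_B)) y0) \<le> (SUP n. \<Sum>i<n. (kernel_op k ^^ i) (indicator (- region_B)) y0)" .
  qed
  finally have le: "(\<integral>\<^sup>+ \<omega>. (\<Sum>n. indicator (- region_B) (\<omega> (Suc n))) \<partial>?L)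
    \<le> (\<Sum>n. (kernel_op k ^^ n) (indicator (- region_B)) y0)" .
  have "(\<integral>\<^sup>+ \<omega>. ennreal_of_enat (T_B \<omega>) \<partial>?L) \<le> (\<integral>\<^sup>+ \<omega>. 1 + (\<Sum>n. indicator (- region_B) (\<omega> (Suc n))) \<partial>?L)"
    by (intro nn_integral_mono T_B_le_sum)
  also have "\<dots> = 1 + (\<integral>\<^sup>+ \<omega>. (\<Sum>n. indicator (- region_B) (\<omega> (Suc n))) \<partial>?L)"
    using im by (subst nn_integral_add) (auto simp: emeasure_space_1)
  also have "\<dots> \<le> 1 + (\<Sum>n. (kernel_op k ^^ n) (indicator (- region_B)) y0)"
    using le by (rule add_left_mono)
  finally show "(\<integral>\<^sup>+ \<omega>. ennreal_of_enat (T_B \<omega>) \<partial>?L)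
    \<le> 1 + (\<Sum>n. (kernel_op k ^^ n) (indicator (- region_B)) y0)" .
  assume fin: "(\<Sum>n. (kernel_op k ^^ n) (indicator (- region_B)) y0) < \<infinity>"
  then have "(\<integral>\<^sup>+ \<omega>. (\<Sum>n. indicator (- region_B) (\<omega> (Suc n))) \<partial>?L) \<noteq> \<infinity>"
    using le by auto
  then have "AE \<omega> in ?L. (\<Sum>n. indicator (- region_B) (\<omega> (Suc n)) :: ennreal) \<noteq> \<infinity>"
    using im by (intro nn_integral_noteq_infinite) auto
  then have ae: "AE \<omega> in ?L. T_B \<omega> < \<infinity>"
  proof eventually_elim
    case (elim \<omega>)
    then show ?case using T_B_le_sum[of \<omega>] by (cases "T_B \<omega>") (auto simp: top_unique)
  qed
  have iff: "T_B \<omega> < \<infinity> \<longleftrightarrow> (\<exists>n. \<omega> (Suc n) \<in> region_B)" for \<omega>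
  proof -
    have "T_B \<omega> < \<infinity> \<longleftrightarrow> (\<exists>n. 0 < n \<and> \<omega> n \<in> region_B)"
      unfolding T_B_def INF_less_iff by auto
    then show ?thesis by (metis zero_less_Suc gr0_conv_Suc)
  qed
  have "{\<omega> \<in> space ?L. T_B \<omega> < \<infinity>} = (\<Union>n. (\<lambda>\<omega>. \<omega> (Suc n)) -` region_B \<inter> space ?L)"
    unfolding iff by blast
  also have "\<dots> \<in> sets ?L"
    by (intro sets.countable_UN image_subsetI measurable_sets[OF cm region_B_sets])
  finally show "measure ?L {\<omega> \<in> space ?L. T_B \<omega> < \<infinity>} = 1"
    using ae by (simp add: prob_Collect_eq_1)
qed

section \<open>Two elementary estimates\<close>

text \<open>
  The tangent of the concave function \<open>s \<mapsto> ln (1 + s)\<close> at \<open>m\<close>, with nonnegative coefficients.  Integrating it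
  is Jensen's inequality for nonnegative integrals.
\<close>

lemma log_tangent_bound:
  fixes s m :: real
  assumes "0 \<le> s" "0 \<le> m"
  shows "ln (1 + s) \<le> (ln (1 + m) - m / (1 + m)) + s / (1 + m)" "0 \<le> ln (1 + m) - m / (1 + m)"
proof -
  have "ln ((1 + s) / (1 + m)) \<le> (1 + s) / (1 + m) - 1"
    using assms by (intro ln_le_minus_one) auto
  moreover have "(1 + s) / (1 + m) - 1 = s / (1 + m) - m / (1 + m)"
  proof -
    have "1 + m \<noteq> 0" using assms by linarith
    then show ?thesis by (simp add: divide_diff_eq_iff diff_divide_distrib[symmetric])
  qed
  moreover have "ln ((1 + s) / (1 + m)) = ln (1 + s) - ln (1 + m)"
    using assms by (simp add: ln_div)
  ultimately show "ln (1 + s) \<le> (ln (1 + m) - m / (1 + m)) + s / (1 + m)" by linarith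
  have "ln (1 / (1 + m)) \<le> 1 / (1 + m) - 1" using assms by (intro ln_le_minus_one) auto
  then show "0 \<le> ln (1 + m) - m / (1 + m)"
    using assms by (simp add: ln_div field_simps)
qed

text \<open>
  Choosing \<open>n\<close> just large enough for \<open>s\<^sup>n\<close> to beat a fixed power of \<open>L\<close> makes \<open>n\<close> logarithmic in \<open>L\<close>, and then
  any other geometric sequence at index \<open>n\<close> is at least a negative power of \<open>L\<close>.
\<close>

lemma logarithmic_step_count:
  fixes s c A \<delta> :: real
  assumes s: "0 < s" "s < 1" and c: "0 < c" "c \<le> 1" and A: "1 \<le> A" and \<delta>: "0 < \<delta>"
  obtains C p where "0 < C" "0 < p"
    "\<And>L. exp 1 \<le> L \<Longrightarrow> \<exists>n::nat. real n \<le> C * ln L \<and> s ^ n * (A * L powr \<delta>) \<le> 1 / 2 \<and> L powr (- p) \<le> (c * s) ^ n"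
proof -
  let ?r = "ln (1 / s)"
  define C where "C = (ln (2 * A) + \<delta>) / ?r + 1"
  define p where "p = C * ln (1 / (c * s))"
  have r: "0 < ?r" using s by simp
  have lA: "0 \<le> ln (2 * A)" using A by simp
  have C: "0 < C" unfolding C_def using r lA \<delta> by (simp add: add_nonneg_pos)
  have "c * s \<le> 1 * s" using c s by (intro mult_right_mono) auto
  then have "c * s < 1" using s by linarith
  moreover have "0 < c * s" using c s by simp
  ultimately have cs: "0 < c * s" "c * s < 1" by auto
  have lcs: "0 < ln (1 / (c * s))" using cs by simp
  have p: "0 < p" unfolding p_def using C lcs by simp
  have "\<exists>n::nat. real n \<le> C * ln L \<and> s ^ n * (A * L powr \<delta>) \<le> 1 / 2 \<and> L powr (- p) \<le> (c * s) ^ n"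
    if L: "exp 1 \<le> L" for L
  proof -
    have L0: "0 < L" using L by (meson exp_gt_zero less_le_trans)
    have lL: "1 \<le> ln L" using L L0 by (simp add: ln_ge_iff)
    define x where "x = (ln (2 * A) + \<delta> * ln L) / ?r"
    have x0: "0 \<le> x" unfolding x_def using lA \<delta> lL r by simp
    define n where "n = nat \<lceil>x\<rceil>"
    have n: "x \<le> real n" "real n \<le> x + 1"
      unfolding n_def using x0 by linarith+
    have pw: "t ^ n = exp (- (real n * ln (1 / t)))" if "0 < t" for t :: real
      using that by (simp add: ln_div exp_of_nat_mult)
    have "x + 1 \<le> C * ln L"
    proof -
      have "ln (2 * A) + \<delta> * ln L \<le> (ln (2 * A) + \<delta>) * ln L"
        using mult_left_mono[OF lL lA] by (simp add: distrib_right)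
      then have "x \<le> (ln (2 * A) + \<delta>) * ln L / ?r"
        unfolding x_def using r by (intro divide_right_mono) auto
      then show ?thesis using lL by (simp add: C_def distrib_right)
    qed
    with n have nC: "real n \<le> C * ln L" by simp
    have "x * ?r = ln (2 * A) + \<delta> * ln L" unfolding x_def using r by simp
    moreover have "x * ?r \<le> real n * ?r" using n r by (intro mult_right_mono) auto
    ultimately have "ln (2 * A) + \<delta> * ln L \<le> real n * ?r" by simp
    then have "s ^ n \<le> exp (- (ln (2 * A) + \<delta> * ln L))"
      unfolding pw[OF s(1)] by simp
    also have "\<dots> = 1 / (2 * A * L powr \<delta>)"
      unfolding exp_minus exp_add powr_def using A L0 by (simp add: inverse_eq_divide)
    finally have "s ^ n * (A * L powr \<delta>) \<le> 1 / (2 * A * L powr \<delta>) * (A * L powr \<delta>)"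
      using A by (intro mult_right_mono) auto
    also have "\<dots> = 1 / 2" using A L0 by simp
    finally have half: "s ^ n * (A * L powr \<delta>) \<le> 1 / 2" .
    have "real n * ln (1 / (c * s)) \<le> C * ln L * ln (1 / (c * s))"
      using nC lcs by (intro mult_right_mono) auto
    then have "L powr (- p) \<le> (c * s) ^ n"
      unfolding pw[OF cs(1)] using L0 by (simp add: powr_def p_def mult_ac)
    with nC half show ?thesis by blast
  qed
  with C p show ?thesis by (rule that)
qed

section \<open>The tilted chain and its potential\<close>

text \<open>
  In the application \<open>\<theta> = \<theta>\<^sub>*\<close>, \<open>a = u\<^bsub>\<theta>\<^esub>\<close>, \<open>v = u\<^bsub>\<theta>-\<delta>\<^esub>\<close> and \<open>q = exp (\<psi>(\<theta> - \<delta>))\<close>.  The eigenvector equations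
  are stated with expectations of exponentials in place of \<open>\<chi>\<close>, which is the form in which they get used.
\<close>

locale tilted_chain =
  fixes K :: "'s::finite \<Rightarrow> 's pmf" and \<nu> :: "(real \<times> real) measure"
    and \<gamma> lam :: "'s \<Rightarrow> real \<Rightarrow> real" and \<theta> \<delta> q :: real and a v :: "'s \<Rightarrow> real"
  assumes prob_nu: "prob_space \<nu>" and sets_nu: "sets \<nu> = sets borel"
    and meas_gamma: "\<And>x. \<gamma> x \<in> borel_measurable borel"
    and meas_lam: "\<And>x. lam x \<in> borel_measurable borel"
    and lam_nonneg: "\<And>x z. 0 \<le> lam x z"
    and lam_pos: "\<exists>x. 0 < measure \<nu> {w. 0 < lam x (snd w)}"
    and irreducible: "irreducible_chain K"
    and theta_nonneg: "0 \<le> \<theta>" and delta: "0 < \<delta>" "\<delta> \<le> 1" and q: "0 < q" "q < 1"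
    and a_pos: "\<And>x. 0 < a x" and v_pos: "\<And>x. 0 < v x"
    and eigen_a: "\<And>x. (\<Sum>y\<in>UNIV. ennreal (pmf (K x) y * a y) *
        (\<integral>\<^sup>+ w. ennreal (exp (\<theta> * \<gamma> y (fst w))) \<partial>\<nu>)) = ennreal (a x)"
    and eigen_v: "\<And>x. (\<Sum>y\<in>UNIV. ennreal (pmf (K x) y * v y) *
        (\<integral>\<^sup>+ w. ennreal (exp ((\<theta> - \<delta>) * \<gamma> y (fst w))) \<partial>\<nu>)) = ennreal (q * v x)"
    and moment: "\<And>y. (\<integral>\<^sup>+ w. ennreal (exp (- \<delta> * \<gamma> y (fst w))) \<partial>\<nu>) < \<infinity>"
begin

sublocale nu: prob_space \<nu> by (rule prob_nu)

lemma meas_fst [measurable]: "(\<lambda>w. \<gamma> x (fst w)) \<in> borel_measurable \<nu>"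
  unfolding measurable_cong_sets[OF sets_nu refl] borel_prod[symmetric]
  by (rule measurable_compose[OF measurable_fst meas_gamma])

lemma meas_snd [measurable]: "(\<lambda>w. lam x (snd w)) \<in> borel_measurable \<nu>"
  unfolding measurable_cong_sets[OF sets_nu refl] borel_prod[symmetric]
  by (rule measurable_compose[OF measurable_snd meas_lam])

lemma space_nu [simp]: "space \<nu> = UNIV"
  using sets_eq_imp_space_eq[OF sets_nu] by simp

definition move :: "real \<Rightarrow> 's \<Rightarrow> real \<times> real \<Rightarrow> real \<Rightarrow> real" where
  "move \<Delta> y w z = z * exp (- \<gamma> y (fst w)) - \<Delta> * lam y (snd w)"

text \<open>
  Every transition that occurs has a density \<open>W x y w\<close> relative to a nominal step from \<open>x\<close> to \<open>y\<close> with noise \<open>w\<close>,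
  so comparing transitions amounts to comparing weights.  The truncated weight describes a transition that loses
  mass.
\<close>

definition weighted_step :: "('s \<Rightarrow> 's \<Rightarrow> real \<times> real \<Rightarrow> real) \<Rightarrow> real \<Rightarrow> ('s \<times> real \<Rightarrow> ennreal) \<Rightarrow> 's \<Rightarrow> real \<Rightarrow> ennreal" where
  "weighted_step W \<Delta> f x z = (\<Sum>y\<in>UNIV. ennreal (pmf (K x) y) *
     (\<integral>\<^sup>+ w. ennreal (W x y w) * f (y, move \<Delta> y w z) \<partial>\<nu>))"

definition nominal_weight :: "'s \<Rightarrow> 's \<Rightarrow> real \<times> real \<Rightarrow> real" where
  "nominal_weight x y w = 1"

definition tilted_weight :: "'s \<Rightarrow> 's \<Rightarrow> real \<times> real \<Rightarrow> real" where
  "tilted_weight x y w = exp (\<theta> * \<gamma> y (fst w)) * a y / a x"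

definition truncated_weight :: "real \<Rightarrow> 's \<Rightarrow> 's \<Rightarrow> real \<times> real \<Rightarrow> real" where
  "truncated_weight M x y w = (if \<gamma> y (fst w) \<le> M then tilted_weight x y w else 0)"

lemma weight_measurable [measurable]:
  "nominal_weight x y \<in> borel_measurable \<nu>"
  "tilted_weight x y \<in> borel_measurable \<nu>"
  "truncated_weight M x y \<in> borel_measurable \<nu>"
  unfolding nominal_weight_def[abs_def] tilted_weight_def[abs_def] truncated_weight_def[abs_def]
  by measurable

lemma move_measurable [measurable]: "(\<lambda>w. move \<Delta> y w z) \<in> borel_measurable \<nu>"
  unfolding move_def by measurable

lemma f_move_measurable:
  assumes f: "f \<in> borel_measurable state_space"
  shows "(\<lambda>w. f (y, move \<Delta> y w z)) \<in> borel_measurable \<nu>"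
  by (rule measurable_compose[OF move_measurable measurable_state_space_slice[OF f]])

text \<open>
  A kernel is described by its action on functions.  The threshold \<open>h\<close> is left arbitrary, so that constants
  obtained in this locale are visibly independent of \<open>\<Delta>\<close> and of the threshold.
\<close>

definition tilted_kernel :: "real \<Rightarrow> ('s \<Rightarrow> real) \<Rightarrow> ('s \<times> real \<Rightarrow> ('s \<times> real) measure) \<Rightarrow> bool" where
  "tilted_kernel \<Delta> h k \<longleftrightarrow> 0 < \<Delta> \<and> (\<forall>x. 0 < h x) \<and> k \<in> state_space \<rightarrow>\<^sub>M prob_algebra state_space \<and>
    (\<forall>f\<in>borel_measurable state_space. \<forall>x z. kernel_op k f (x, z) =
       weighted_step (if h x < z then tilted_weight else nominal_weight) \<Delta> f x z)"

text \<open>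
  As the ratio \<open>v / a\<close> turns the tilting weight \<open>a y / a x\<close> into \<open>v y / a x\<close>, this is, on \<open>z > 0\<close> and for \<open>\<Delta> = 0\<close>,
  an eigenfunction of the tilted step with eigenvalue \<open>q\<close>; the power of \<open>z\<close> supplies the factor
  \<open>exp (- \<delta> \<gamma>)\<close>.
\<close>

definition potential :: "'s \<times> real \<Rightarrow> real" where
  "potential y = (max 0 (snd y)) powr \<delta> * (v (fst y) / a (fst y))"

lemma potential_nonneg: "0 \<le> potential y"
  using a_pos[of "fst y"] v_pos[of "fst y"] by (simp add: potential_def)

lemma real_measurable_state_space:
  fixes f :: "'s \<times> real \<Rightarrow> real"
  assumes "\<And>x. (\<lambda>z. f (x, z)) \<in> borel_measurable borel"
  shows "(\<lambda>y. ennreal (f y)) \<in> borel_measurable state_space"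
  using assms by (intro measurable_state_space) simp

lemma potential_measurable: "(\<lambda>y. ennreal (potential y)) \<in> borel_measurable state_space"
  unfolding potential_def by (intro real_measurable_state_space) simp

text \<open>
  Subtracting \<open>\<Delta> \<lambda> \<ge> 0\<close> only lowers \<open>z\<close>, and the potential is increasing and homogeneous in \<open>z\<^sup>+\<close>.
\<close>

lemma potential_move_le:
  assumes "0 \<le> \<Delta>"
  shows "potential (y, move \<Delta> y w z) \<le> (max 0 z) powr \<delta> * exp (- \<delta> * \<gamma> y (fst w)) * (v y / a y)"
proof -
  have "max 0 (move \<Delta> y w z) \<le> max 0 z * exp (- \<gamma> y (fst w))"
  proof -
    have "z * exp (- \<gamma> y (fst w)) \<le> max 0 z * exp (- \<gamma> y (fst w))"
      by (intro mult_right_mono) auto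
    moreover have "0 \<le> \<Delta> * lam y (snd w)" using assms lam_nonneg by simp
    ultimately have "move \<Delta> y w z \<le> max 0 z * exp (- \<gamma> y (fst w))" unfolding move_def by linarith
    then show ?thesis by simp
  qed
  then have "(max 0 (move \<Delta> y w z)) powr \<delta> \<le> (max 0 z * exp (- \<gamma> y (fst w))) powr \<delta>"
    using delta by (intro powr_mono2) auto
  also have "\<dots> = (max 0 z) powr \<delta> * exp (- \<delta> * \<gamma> y (fst w))"
    by (simp add: powr_mult powr_def[of "exp _"] mult.commute)
  finally show ?thesis
    unfolding potential_def fst_conv snd_conv using a_pos[of y] v_pos[of y] by (intro mult_right_mono) auto
qed

text \<open>
  After the bound on the move, the weight \<open>exp (\<theta> \<gamma>)\<close> and the factor \<open>exp (- \<delta> \<gamma>)\<close> combine to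
  \<open>exp ((\<theta> - \<delta>) \<gamma>)\<close>, and \<open>a y\<close> cancels.  What remains is the eigenvector equation for \<open>v\<close>.
\<close>

lemma weighted_step_tilted_potential:
  assumes "0 \<le> \<Delta>"
  shows "weighted_step tilted_weight \<Delta> (\<lambda>y. ennreal (potential y)) x z \<le> ennreal (q * potential (x, z))"
proof -
  let ?c = "(max 0 z) powr \<delta> / a x"
  let ?I = "\<lambda>y. \<integral>\<^sup>+ w. ennreal (exp ((\<theta> - \<delta>) * \<gamma> y (fst w))) \<partial>\<nu>"
  have "(\<integral>\<^sup>+ w. ennreal (tilted_weight x y w) * ennreal (potential (y, move \<Delta> y w z)) \<partial>\<nu>)
      \<le> ennreal (?c * v y) * ?I y" for y
  proof -
    have "(\<integral>\<^sup>+ w. ennreal (tilted_weight x y w) * ennreal (potential (y, move \<Delta> y w z)) \<partial>\<nu>)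
      \<le> (\<integral>\<^sup>+ w. ennreal (?c * v y) * ennreal (exp ((\<theta> - \<delta>) * \<gamma> y (fst w))) \<partial>\<nu>)"
    proof (rule nn_integral_mono)
      fix w
      have "tilted_weight x y w * potential (y, move \<Delta> y w z)
        \<le> tilted_weight x y w * ((max 0 z) powr \<delta> * exp (- \<delta> * \<gamma> y (fst w)) * (v y / a y))"
        using potential_move_le[OF assms] a_pos[of x] a_pos[of y]
        by (intro mult_left_mono) (auto simp: tilted_weight_def)
      also have "\<dots> = ?c * v y * exp ((\<theta> - \<delta>) * \<gamma> y (fst w))"
        using a_pos[of x] a_pos[of y]
        by (simp add: tilted_weight_def field_simps exp_add[symmetric])
      finally show "ennreal (tilted_weight x y w) * ennreal (potential (y, move \<Delta> y w z))
        \<le> ennreal (?c * v y) * ennreal (exp ((\<theta> - \<delta>) * \<gamma> y (fst w)))"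
        using potential_nonneg a_pos[of x] a_pos[of y] v_pos[of y]
        by (simp add: ennreal_mult[symmetric] tilted_weight_def)
    qed
    also have "\<dots> = ennreal (?c * v y) * ?I y" by (rule nn_integral_cmult) measurable
    finally show ?thesis .
  qed
  then have "weighted_step tilted_weight \<Delta> (\<lambda>y. ennreal (potential y)) x z
    \<le> (\<Sum>y\<in>UNIV. ennreal (pmf (K x) y) * (ennreal (?c * v y) * ?I y))"
    unfolding weighted_step_def by (intro sum_mono mult_left_mono) auto
  also have "\<dots> = ennreal ?c * (\<Sum>y\<in>UNIV. ennreal (pmf (K x) y * v y) * ?I y)"
    unfolding sum_distrib_left
  proof (intro sum.cong refl)
    fix y
    have "ennreal (?c * v y) = ennreal ?c * ennreal (v y)"
      by (rule ennreal_mult) (use a_pos[of x] v_pos[of y] in auto)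
    moreover have "ennreal (pmf (K x) y * v y) = ennreal (pmf (K x) y) * ennreal (v y)"
      by (rule ennreal_mult) (use v_pos[of y] in auto)
    ultimately show "ennreal (pmf (K x) y) * (ennreal (?c * v y) * ?I y)
      = ennreal ?c * (ennreal (pmf (K x) y * v y) * ?I y)"
      by (simp only: mult_ac)
  qed
  also have "\<dots> = ennreal (q * potential (x, z))"
    unfolding eigen_v potential_def using a_pos[of x] v_pos[of x] q
    by (simp add: ennreal_mult[symmetric] field_simps)
  finally show ?thesis .
qed

lemma weighted_step_nominal_potential:
  obtains b where "0 < b"
    "\<And>\<Delta> x z. 0 \<le> \<Delta> \<Longrightarrow>
       weighted_step nominal_weight \<Delta> (\<lambda>y. ennreal (potential y)) x z \<le> ennreal ((max 0 z) powr \<delta> * b)"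
proof -
  define I where "I y = (\<integral>\<^sup>+ w. ennreal (exp (- \<delta> * \<gamma> y (fst w))) \<partial>\<nu>)" for y
  have I: "I y = ennreal (enn2real (I y))" for y
    using moment[of y] by (simp add: I_def ennreal_enn2real)
  define b where "b = 1 + (\<Sum>y\<in>UNIV. v y / a y * enn2real (I y))"
  have nn: "0 \<le> v y / a y * enn2real (I y)" for y
    using a_pos[of y] v_pos[of y] by simp
  have b: "v y / a y * enn2real (I y) \<le> b" for y
    using member_le_sum[of y UNIV "\<lambda>y. v y / a y * enn2real (I y)"] nn by (simp add: b_def)
  have "weighted_step nominal_weight \<Delta> (\<lambda>y. ennreal (potential y)) x z \<le> ennreal ((max 0 z) powr \<delta> * b)"
    if \<Delta>: "0 \<le> \<Delta>" for \<Delta> x z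
  proof -
    have "(\<integral>\<^sup>+ w. ennreal (nominal_weight x y w) * ennreal (potential (y, move \<Delta> y w z)) \<partial>\<nu>)
      \<le> ennreal ((max 0 z) powr \<delta> * b)" for y
    proof -
      have "(\<integral>\<^sup>+ w. ennreal (nominal_weight x y w) * ennreal (potential (y, move \<Delta> y w z)) \<partial>\<nu>)
        \<le> (\<integral>\<^sup>+ w. ennreal ((max 0 z) powr \<delta> * (v y / a y)) * ennreal (exp (- \<delta> * \<gamma> y (fst w))) \<partial>\<nu>)"
      proof (rule nn_integral_mono)
        fix w
        have "potential (y, move \<Delta> y w z) \<le> (max 0 z) powr \<delta> * (v y / a y) * exp (- \<delta> * \<gamma> y (fst w))"
          using potential_move_le[OF \<Delta>, of y w z] by (simp add: mult_ac)
        then show "ennreal (nominal_weight x y w) * ennreal (potential (y, move \<Delta> y w z))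
          \<le> ennreal ((max 0 z) powr \<delta> * (v y / a y)) * ennreal (exp (- \<delta> * \<gamma> y (fst w)))"
          using a_pos[of y] v_pos[of y] by (simp add: nominal_weight_def ennreal_mult[symmetric] ennreal_leI)
      qed
      also have "\<dots> = ennreal ((max 0 z) powr \<delta> * (v y / a y)) * I y"
        unfolding I_def by (rule nn_integral_cmult) measurable
      also have "\<dots> = ennreal ((max 0 z) powr \<delta> * (v y / a y * enn2real (I y)))"
        using a_pos[of y] v_pos[of y] by (subst I) (simp add: ennreal_mult[symmetric] mult.assoc)
      also have "\<dots> \<le> ennreal ((max 0 z) powr \<delta> * b)"
        using b[of y] by (intro ennreal_leI mult_left_mono) auto
      finally show ?thesis .
    qed
    then have "weighted_step nominal_weight \<Delta> (\<lambda>y. ennreal (potential y)) x z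
      \<le> (\<Sum>y\<in>UNIV. ennreal (pmf (K x) y) * ennreal ((max 0 z) powr \<delta> * b))"
      unfolding weighted_step_def by (intro sum_mono mult_left_mono) auto
    also have "\<dots> = ennreal (\<Sum>y\<in>UNIV. pmf (K x) y) * ennreal ((max 0 z) powr \<delta> * b)"
      by (simp add: sum_distrib_right[symmetric])
    also have "(\<Sum>y\<in>UNIV. pmf (K x) y) = 1" by (rule sum_pmf_eq_1) auto
    finally show ?thesis by simp
  qed
  moreover have "0 < b" unfolding b_def using nn by (simp add: sum_nonneg add_pos_nonneg)
  ultimately show ?thesis by (rule that[rotated])
qed

text \<open>
  Without truncation the mass is 1, because \<open>a\<close> is an eigenvector with eigenvalue 1.  By monotone convergence
  the mass tends to 1 as \<open>M\<close> grows, and \<open>\<surd>q\<close> is a value strictly between \<open>q\<close> and 1.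
\<close>

lemma truncated_mass:
  obtains M where "0 \<le> M"
    "\<And>x \<Delta> z. ennreal (sqrt q) \<le> weighted_step (truncated_weight M) \<Delta> (\<lambda>_. 1) x z"
proof -
  define m where "m i x = (\<Sum>y\<in>UNIV. ennreal (pmf (K x) y) * (\<integral>\<^sup>+ w. ennreal (truncated_weight (real i) x y w) \<partial>\<nu>))" for i :: nat and x
  have "(\<lambda>i. m i x) \<longlonglongrightarrow> 1" for x
  proof -
    have "(\<lambda>i. \<integral>\<^sup>+ w. ennreal (truncated_weight (real i) x y w) \<partial>\<nu>) \<longlonglongrightarrow> (\<integral>\<^sup>+ w. ennreal (tilted_weight x y w) \<partial>\<nu>)" for y
    proof (rule nn_integral_LIMSEQ)
      show "incseq (\<lambda>i w. ennreal (truncated_weight (real i) x y w))"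
        using a_pos[of x] a_pos[of y]
        by (auto simp: incseq_def le_fun_def truncated_weight_def tilted_weight_def)
      show "(\<lambda>w. ennreal (truncated_weight (real i) x y w)) \<in> borel_measurable \<nu>" for i by measurable
      fix w :: "real \<times> real"
      obtain n where n: "\<gamma> y (fst w) \<le> real n" using real_arch_simple by blast
      have "\<forall>\<^sub>F i in sequentially. ennreal (truncated_weight (real i) x y w) = ennreal (tilted_weight x y w)"
        using eventually_ge_at_top[of n] by eventually_elim (use n in \<open>auto simp: truncated_weight_def\<close>)
      then show "(\<lambda>i. ennreal (truncated_weight (real i) x y w)) \<longlonglongrightarrow> ennreal (tilted_weight x y w)"
        by (rule tendsto_eventually)
    qed
    then have "(\<lambda>i. m i x) \<longlonglongrightarrow> (\<Sum>y\<in>UNIV. ennreal (pmf (K x) y) * (\<integral>\<^sup>+ w. ennreal (tilted_weight x y w) \<partial>\<nu>))"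
      unfolding m_def by (intro tendsto_sum ennreal_tendsto_cmult) auto
    also have "(\<Sum>y\<in>UNIV. ennreal (pmf (K x) y) * (\<integral>\<^sup>+ w. ennreal (tilted_weight x y w) \<partial>\<nu>))
      = ennreal (1 / a x) * (\<Sum>y\<in>UNIV. ennreal (pmf (K x) y * a y) * (\<integral>\<^sup>+ w. ennreal (exp (\<theta> * \<gamma> y (fst w))) \<partial>\<nu>))"
      unfolding sum_distrib_left
    proof (intro sum.cong refl)
      fix y
      have "(\<integral>\<^sup>+ w. ennreal (tilted_weight x y w) \<partial>\<nu>) = (\<integral>\<^sup>+ w. ennreal (a y / a x) * ennreal (exp (\<theta> * \<gamma> y (fst w))) \<partial>\<nu>)"
        using a_pos[of x] a_pos[of y] by (simp add: tilted_weight_def ennreal_mult[symmetric] mult.commute)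
      also have "\<dots> = ennreal (a y / a x) * (\<integral>\<^sup>+ w. ennreal (exp (\<theta> * \<gamma> y (fst w))) \<partial>\<nu>)"
        by (rule nn_integral_cmult) measurable
      finally show "ennreal (pmf (K x) y) * (\<integral>\<^sup>+ w. ennreal (tilted_weight x y w) \<partial>\<nu>)
        = ennreal (1 / a x) * (ennreal (pmf (K x) y * a y) * (\<integral>\<^sup>+ w. ennreal (exp (\<theta> * \<gamma> y (fst w))) \<partial>\<nu>))"
        using a_pos[of x] a_pos[of y] by (simp add: mult.assoc[symmetric] ennreal_mult[symmetric])
    qed
    also have "\<dots> = 1"
      unfolding eigen_a using a_pos[of x] by (simp add: ennreal_mult[symmetric])
    finally show ?thesis .
  qed
  moreover have "ennreal (sqrt q) < 1" using q by (simp add: ennreal_less_one_iff)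
  ultimately have "\<forall>\<^sub>F i in sequentially. ennreal (sqrt q) < m i x" for x
    by (rule order_tendstoD)
  then have "\<forall>\<^sub>F i in sequentially. \<forall>x. ennreal (sqrt q) < m i x"
    by (rule eventually_all_finite)
  then obtain i where "\<forall>x. ennreal (sqrt q) < m i x"
    using eventually_happens by force
  then show ?thesis
    by (intro that[of "real i"]) (auto simp: weighted_step_def m_def less_imp_le)
qed

text \<open>
  The normalisation \<open>ln (2 / (1 + q))\<close> is the least decrease of \<open>ln (1 + V/v0)\<close> in a step that contracts \<open>V\<close> by
  \<open>q\<close> from a level \<open>V \<ge> v0\<close>; that minimum is attained at \<open>V = v0\<close>.
\<close>

section \<open>Logarithmic drift of the potential\<close>

definition log_potential :: "real \<Rightarrow> 's \<times> real \<Rightarrow> real" where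
  "log_potential v0 y = ln (1 + potential y / v0) / ln (2 / (1 + q))"

lemma rate_pos: "0 < ln (2 / (1 + q))"
  using q by simp

lemma log_potential_measurable: "0 < v0 \<Longrightarrow> (\<lambda>y. ennreal (log_potential v0 y)) \<in> borel_measurable state_space"
  unfolding log_potential_def potential_def by (intro real_measurable_state_space) simp

lemma log_potential_drift_outer:
  assumes k: "tilted_kernel \<Delta> h k" and z: "h x < z" and v0: "0 < v0" "v0 \<le> potential (x, z)"
  shows "kernel_op k (\<lambda>y. ennreal (log_potential v0 y)) (x, z) + 1 \<le> ennreal (log_potential v0 (x, z))"
proof -
  have kk: "k \<in> state_space \<rightarrow>\<^sub>M prob_algebra state_space" and \<Delta>: "0 < \<Delta>"
    using k by (auto simp: tilted_kernel_def)
  let ?\<alpha> = "ln (2 / (1 + q))"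
  define t where "t = potential (x, z) / v0"
  have t: "1 \<le> t" using v0 by (simp add: t_def)
  define m where "m = q * t"
  have m: "0 \<le> m" using t q by (simp add: m_def)
  \<comment> \<open>Coefficients of the tangent at the contracted level \<open>m\<close>.\<close>
  define c0 where "c0 = (ln (1 + m) - m / (1 + m)) / ?\<alpha>"
  define c1 where "c1 = 1 / (v0 * (1 + m) * ?\<alpha>)"
  have c0: "0 \<le> c0" unfolding c0_def using log_tangent_bound(2)[of 0 m] m rate_pos by simp
  have c1: "0 \<le> c1" unfolding c1_def using m v0 rate_pos by simp
  have F_le: "ennreal (log_potential v0 y) \<le> ennreal c0 + ennreal c1 * ennreal (potential y)" for y
  proof -
    have "log_potential v0 y \<le> ((ln (1 + m) - m / (1 + m)) + potential y / v0 / (1 + m)) / ?\<alpha>"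
      unfolding log_potential_def using log_tangent_bound(1)[of "potential y / v0" m] potential_nonneg[of y] m v0 rate_pos
      by (intro divide_right_mono) auto
    also have "\<dots> = c0 + c1 * potential y"
      by (simp add: c0_def c1_def add_divide_distrib mult.assoc)
    finally show ?thesis
      using c0 c1 potential_nonneg[of y] by (simp add: ennreal_mult[symmetric] ennreal_plus[symmetric] del: ennreal_plus)
  qed
  have "kernel_op k (\<lambda>y. ennreal (log_potential v0 y)) (x, z) \<le> kernel_op k (\<lambda>y. ennreal c0 + ennreal c1 * ennreal (potential y)) (x, z)"
    using F_le by (intro kernel_op_mono[OF kk]) auto
  also have "\<dots> = ennreal c0 + ennreal c1 * kernel_op k (\<lambda>y. ennreal (potential y)) (x, z)"
    using potential_measurable by (simp add: kernel_op_add[OF kk] kernel_op_cmult[OF kk] kernel_op_const[OF kk])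
  also have "kernel_op k (\<lambda>y. ennreal (potential y)) (x, z) = weighted_step tilted_weight \<Delta> (\<lambda>y. ennreal (potential y)) x z"
    using k z potential_measurable by (simp add: tilted_kernel_def)
  also have "\<dots> \<le> ennreal (q * potential (x, z))"
    using \<Delta> by (intro weighted_step_tilted_potential) simp
  finally have "kernel_op k (\<lambda>y. ennreal (log_potential v0 y)) (x, z) \<le> ennreal c0 + ennreal c1 * ennreal (q * potential (x, z))"
    by (simp add: add_left_mono mult_left_mono)
  also have "\<dots> = ennreal (c0 + c1 * (q * potential (x, z)))"
    using c0 c1 potential_nonneg q by (simp add: ennreal_mult)
  also have "c0 + c1 * (q * potential (x, z)) = ln (1 + m) / ?\<alpha>"
  proof -
    have "potential (x, z) = v0 * t" using v0 by (simp add: t_def)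
    then have "c1 * (q * potential (x, z)) = m / (1 + m) / ?\<alpha>"
      using v0 by (simp add: c1_def m_def)
    then show ?thesis by (simp add: c0_def diff_divide_distrib)
  qed
  finally have "kernel_op k (\<lambda>y. ennreal (log_potential v0 y)) (x, z) + 1 \<le> ennreal (ln (1 + m) / ?\<alpha>) + 1"
    by (rule add_right_mono)
  also have "\<dots> = ennreal (ln (1 + m) / ?\<alpha> + 1)"
    using m rate_pos by simp
  also have "\<dots> \<le> ennreal (log_potential v0 (x, z))"
  proof (rule ennreal_leI)
    \<comment> \<open>The difference of the two sides is \<open>(t - 1) (1 - q)\<close>.\<close>
    have "(1 + m) * 2 \<le> (1 + t) * (1 + q)"
    proof -
      have "0 \<le> (t - 1) * (1 - q)" using t q by simp
      then show ?thesis by (simp add: m_def algebra_simps)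
    qed
    then have "(1 + m) * (2 / (1 + q)) \<le> 1 + t"
      using q by (simp add: field_simps)
    then have "ln ((1 + m) * (2 / (1 + q))) \<le> ln (1 + t)"
      using m q t by (subst ln_le_cancel_iff) (auto intro!: mult_pos_pos add_pos_nonneg dest: order_less_le_trans)
    then have "ln (1 + m) + ?\<alpha> \<le> ln (1 + t)"
      using m q by (subst (asm) ln_mult) auto
    then show "ln (1 + m) / ?\<alpha> + 1 \<le> log_potential v0 (x, z)"
    proof -
      have "ln (1 + m) / ?\<alpha> + 1 = (ln (1 + m) + ?\<alpha>) / ?\<alpha>"
        using rate_pos by (simp add: add_divide_distrib)
      also have "\<dots> \<le> ln (1 + t) / ?\<alpha>"
        using rate_pos \<open>ln (1 + m) + ?\<alpha> \<le> ln (1 + t)\<close> by (intro divide_right_mono) auto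
      finally show ?thesis by (simp add: log_potential_def t_def)
    qed
  qed
  finally show ?thesis .
qed

text \<open>
  Crude bound from \<open>ln (1 + s) \<le> s\<close>.  With \<open>v0\<close> of the order of the \<open>\<delta>\<close>-th power of the threshold it is a
  constant, whatever the scale of the threshold.
\<close>

lemma log_potential_drift_inner:
  assumes b: "\<And>\<Delta> x z. 0 \<le> \<Delta> \<Longrightarrow>
       weighted_step nominal_weight \<Delta> (\<lambda>y. ennreal (potential y)) x z \<le> ennreal ((max 0 z) powr \<delta> * b)"
    and k: "tilted_kernel \<Delta> h k" and z: "z \<le> h x" and v0: "0 < v0"
  shows "kernel_op k (\<lambda>y. ennreal (log_potential v0 y)) (x, z) \<le> ennreal ((max 0 z) powr \<delta> * b / (v0 * ln (2 / (1 + q))))"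
proof -
  have kk: "k \<in> state_space \<rightarrow>\<^sub>M prob_algebra state_space" and \<Delta>: "0 < \<Delta>"
    using k by (auto simp: tilted_kernel_def)
  let ?\<alpha> = "ln (2 / (1 + q))"
  have F_le: "ennreal (log_potential v0 y) \<le> ennreal (1 / (v0 * ?\<alpha>)) * ennreal (potential y)" for y
  proof -
    have "log_potential v0 y \<le> (potential y / v0) / ?\<alpha>"
      unfolding log_potential_def using potential_nonneg[of y] v0 rate_pos by (intro divide_right_mono ln_add_one_self_le_self) auto
    then show ?thesis using v0 rate_pos potential_nonneg[of y] by (simp add: ennreal_mult[symmetric] ennreal_leI)
  qed
  have "kernel_op k (\<lambda>y. ennreal (log_potential v0 y)) (x, z) \<le> kernel_op k (\<lambda>y. ennreal (1 / (v0 * ?\<alpha>)) * ennreal (potential y)) (x, z)"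
    using F_le by (intro kernel_op_mono[OF kk]) auto
  also have "\<dots> = ennreal (1 / (v0 * ?\<alpha>)) * kernel_op k (\<lambda>y. ennreal (potential y)) (x, z)"
    using potential_measurable by (simp add: kernel_op_cmult[OF kk])
  also have "kernel_op k (\<lambda>y. ennreal (potential y)) (x, z) = weighted_step nominal_weight \<Delta> (\<lambda>y. ennreal (potential y)) x z"
    using k z potential_measurable by (simp add: tilted_kernel_def)
  also have "ennreal (1 / (v0 * ?\<alpha>)) * \<dots> \<le> ennreal (1 / (v0 * ?\<alpha>)) * ennreal ((max 0 z) powr \<delta> * b)"
    using \<Delta> by (intro mult_left_mono b) auto
  also have "\<dots> = ennreal ((max 0 z) powr \<delta> * b / (v0 * ?\<alpha>))"
    using v0 rate_pos by (subst ennreal_mult'[symmetric]) auto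
  finally show ?thesis .
qed

section \<open>Termination from heights of order \<open>\<Delta>\<close>\<close>

lemma region_B_absorbing:
  assumes k: "tilted_kernel \<Delta> h k" and z: "z \<le> 0"
  shows "kernel_op k (indicator region_B) (x, z) = 1"
proof -
  have \<Delta>: "0 < \<Delta>" and h: "0 < h x" using k by (auto simp: tilted_kernel_def)
  have "kernel_op k (indicator region_B) (x, z) = weighted_step nominal_weight \<Delta> (indicator region_B) x z"
  proof -
    have "\<not> h x < z" using h z by linarith
    then show ?thesis using k by (simp add: tilted_kernel_def)
  qed
  also have "\<dots> = (\<Sum>y\<in>UNIV. ennreal (pmf (K x) y))"
    unfolding weighted_step_def
  proof (intro sum.cong refl)
    fix y
    have "move \<Delta> y w z \<le> 0" for w
      using z \<Delta> lam_nonneg[of y "snd w"] by (simp add: move_def mult_nonpos_nonneg order_trans[of _ 0])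
    then show "ennreal (pmf (K x) y) * (\<integral>\<^sup>+ w. ennreal (nominal_weight x y w) * indicator region_B (y, move \<Delta> y w z) \<partial>\<nu>)
      = ennreal (pmf (K x) y)"
      by (simp add: region_B_def nominal_weight_def nu.emeasure_space_1[unfolded space_nu])
  qed
  also have "\<dots> = ennreal (\<Sum>y\<in>UNIV. pmf (K x) y)" by simp
  also have "(\<Sum>y\<in>UNIV. pmf (K x) y) = 1" by (rule sum_pmf_eq_1) auto
  finally show ?thesis by simp
qed

text \<open>
  On the event \<open>E\<close> the tilted weight is at least \<open>exp (- \<theta> M) a y / a x\<close>, so both regimes charge \<open>E\<close>, and the
  bound does not depend on the regime of the current state.
\<close>

lemma kernel_lower_bound:
  assumes k: "tilted_kernel \<Delta> h k" and f: "f \<in> borel_measurable state_space"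
    and E: "E \<in> sets \<nu>" "\<And>w. w \<in> E \<Longrightarrow> - M \<le> \<gamma> y (fst w)"
    and fE: "\<And>w. w \<in> E \<Longrightarrow> ennreal \<epsilon> \<le> f (y, move \<Delta> y w z)" and \<epsilon>: "0 \<le> \<epsilon>"
  shows "ennreal (pmf (K x) y * min 1 (exp (- (\<theta> * M)) * a y / a x) * measure \<nu> E * \<epsilon>) \<le> kernel_op k f (x, z)"
proof -
  let ?c = "min 1 (exp (- (\<theta> * M)) * a y / a x)"
  have c: "0 \<le> ?c" using a_pos[of x] a_pos[of y] by simp
  define W where "W = (if h x < z then tilted_weight else nominal_weight)"
  have W: "?c \<le> W x y w" if "w \<in> E" for w
  proof -
    have "exp (- (\<theta> * M)) \<le> exp (\<theta> * \<gamma> y (fst w))"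
      using mult_left_mono[OF E(2)[OF that] theta_nonneg] by simp
    then have "exp (- (\<theta> * M)) * a y / a x \<le> tilted_weight x y w"
      unfolding tilted_weight_def using a_pos[of x] a_pos[of y]
      by (intro divide_right_mono mult_right_mono) auto
    then show ?thesis by (auto simp: W_def nominal_weight_def min_le_iff_disj)
  qed
  have "ennreal (?c * measure \<nu> E * \<epsilon>) = (\<integral>\<^sup>+ w. ennreal (?c * \<epsilon>) * indicator E w \<partial>\<nu>)"
  proof -
    have "(\<integral>\<^sup>+ w. ennreal (?c * \<epsilon>) * indicator E w \<partial>\<nu>) = ennreal (?c * \<epsilon>) * emeasure \<nu> E"
      by (rule nn_integral_cmult_indicator[OF E(1)])
    also have "\<dots> = ennreal (?c * \<epsilon> * measure \<nu> E)"
      using c \<epsilon> unfolding nu.emeasure_eq_measure by (intro ennreal_mult[symmetric]) auto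
    finally show ?thesis by (simp only: mult_ac)
  qed
  also have "\<dots> \<le> (\<integral>\<^sup>+ w. ennreal (W x y w) * f (y, move \<Delta> y w z) \<partial>\<nu>)"
  proof (intro nn_integral_mono)
    fix w
    show "ennreal (?c * \<epsilon>) * indicator E w \<le> ennreal (W x y w) * f (y, move \<Delta> y w z)"
    proof (cases "w \<in> E")
      case True
      have "ennreal (?c * \<epsilon>) = ennreal ?c * ennreal \<epsilon>" using c \<epsilon> by (rule ennreal_mult)
      also have "\<dots> \<le> ennreal (W x y w) * f (y, move \<Delta> y w z)"
        using W[OF True] fE[OF True] by (intro mult_mono ennreal_leI) auto
      finally show ?thesis using True by simp
    qed simp
  qed
  finally have "ennreal (pmf (K x) y) * ennreal (?c * measure \<nu> E * \<epsilon>)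
    \<le> ennreal (pmf (K x) y) * (\<integral>\<^sup>+ w. ennreal (W x y w) * f (y, move \<Delta> y w z) \<partial>\<nu>)"
    by (rule mult_left_mono) simp
  also have "\<dots> \<le> weighted_step W \<Delta> f x z"
    unfolding weighted_step_def by (rule member_le_sum) auto
  also have "\<dots> = kernel_op k f (x, z)"
    using k f by (simp add: tilted_kernel_def W_def)
  finally show ?thesis
    using c \<epsilon> by (simp add: ennreal_mult'[symmetric] mult_ac)
qed

text \<open>
  The constants are required to serve all \<open>\<Delta>\<close> and all thresholds at once.  The starting height is measured in
  multiples of \<open>\<Delta>\<close>, because one jump lowers \<open>z\<close> by an amount of order \<open>\<Delta>\<close>.
\<close>

definition hits_from_below :: "'s \<Rightarrow> nat \<Rightarrow> real \<Rightarrow> real \<Rightarrow> bool" where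
  "hits_from_below x m \<kappa> \<epsilon> \<longleftrightarrow> 0 < \<kappa> \<and> 0 < \<epsilon> \<and> (\<forall>\<Delta> h k z. tilted_kernel \<Delta> h k \<longrightarrow> z \<le> \<kappa> * \<Delta> \<longrightarrow>
     ennreal \<epsilon> \<le> (kernel_op k ^^ m) (indicator region_B) (x, z))"

lemma exists_gamma_bound:
  assumes A: "A \<in> sets \<nu>" "0 < measure \<nu> A"
  obtains M where "0 \<le> M" "0 < measure \<nu> {w \<in> A. - M \<le> \<gamma> y (fst w)}"
    "{w \<in> A. - M \<le> \<gamma> y (fst w)} \<in> sets \<nu>"
proof -
  define E where "E i = {w \<in> A. - real i \<le> \<gamma> y (fst w)}" for i
  have Es: "E i \<in> sets \<nu>" for i
  proof -
    have "E i = A \<inter> {w \<in> space \<nu>. - real i \<le> \<gamma> y (fst w)}" by (auto simp: E_def)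
    also have "\<dots> \<in> sets \<nu>"
    proof (rule sets.Int[OF A(1)])
      show "{w \<in> space \<nu>. - real i \<le> \<gamma> y (fst w)} \<in> sets \<nu>" by measurable
    qed
    finally show ?thesis .
  qed
  have "(\<lambda>i. measure \<nu> (E i)) \<longlonglongrightarrow> measure \<nu> (\<Union>i. E i)"
    using Es by (intro nu.finite_Lim_measure_incseq) (auto simp: incseq_def E_def)
  also have "(\<Union>i. E i) = A"
  proof -
    have "\<exists>i. - real i \<le> \<gamma> y (fst w)" for w :: "real \<times> real"
      using real_arch_simple[of "- \<gamma> y (fst w)"] by (metis minus_le_iff)
    then show ?thesis by (auto simp: E_def)
  qed
  finally have "\<forall>\<^sub>F i in sequentially. 0 < measure \<nu> (E i)"
    using A(2) by (rule order_tendstoD)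
  then obtain i where "0 < measure \<nu> (E i)" using eventually_happens by force
  then show ?thesis using Es[of i] by (intro that[of "real i"]) (auto simp: E_def)
qed

text \<open>
  Move to \<open>y\<close> while \<open>\<gamma> \<ge> - M\<close>: the height grows by a factor at most \<open>exp M\<close>, so \<open>\<kappa>\<close> shrinks by that factor.
\<close>

lemma hits_from_below_step:
  assumes y: "hits_from_below y m \<kappa> \<epsilon>" and xy: "y \<in> set_pmf (K x)"
  shows "\<exists>m \<kappa> \<epsilon>. hits_from_below x m \<kappa> \<epsilon>"
proof -
  have \<kappa>: "0 < \<kappa>" and \<epsilon>: "0 < \<epsilon>" using y by (auto simp: hits_from_below_def)
  have m: "0 < measure \<nu> UNIV" using nu.prob_space by simp
  have s: "UNIV \<in> sets \<nu>" using sets.top[of \<nu>] by simp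
  obtain M where M: "0 \<le> M" "0 < measure \<nu> {w \<in> UNIV. - M \<le> \<gamma> y (fst w)}"
    "{w \<in> UNIV. - M \<le> \<gamma> y (fst w)} \<in> sets \<nu>"
    by (rule exists_gamma_bound[OF s m])
  let ?E = "{w \<in> (UNIV :: (real \<times> real) set). - M \<le> \<gamma> y (fst w)}"
  let ?e = "pmf (K x) y * min 1 (exp (- (\<theta> * M)) * a y / a x) * measure \<nu> ?E * \<epsilon>"
  have e: "0 < ?e"
    using xy M(2) \<epsilon> a_pos[of x] a_pos[of y] by (simp add: pmf_positive)
  have "hits_from_below x (Suc m) (\<kappa> * exp (- M)) ?e"
    unfolding hits_from_below_def
  proof (intro conjI allI impI)
    fix \<Delta> h k z
    assume k: "tilted_kernel \<Delta> h k" and z: "z \<le> \<kappa> * exp (- M) * \<Delta>"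
    have kk: "k \<in> state_space \<rightarrow>\<^sub>M prob_algebra state_space" and \<Delta>: "0 < \<Delta>"
      using k by (auto simp: tilted_kernel_def)
    have "ennreal ?e \<le> kernel_op k ((kernel_op k ^^ m) (indicator region_B)) (x, z)"
    proof (rule kernel_lower_bound[OF k _ M(3)])
      show "(kernel_op k ^^ m) (indicator region_B) \<in> borel_measurable state_space"
        by (intro kernel_op_iter_measurable[OF kk]) simp
      fix w assume w: "w \<in> ?E"
      have "z * exp (- \<gamma> y (fst w)) \<le> \<kappa> * exp (- M) * \<Delta> * exp (- \<gamma> y (fst w))"
        using z by (rule mult_right_mono) simp
      also have "\<dots> \<le> \<kappa> * exp (- M) * \<Delta> * exp M"
        using w \<kappa> \<Delta> by (intro mult_left_mono) auto
      also have "\<dots> = \<kappa> * \<Delta>" by (simp add: exp_minus)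
      finally have "move \<Delta> y w z \<le> \<kappa> * \<Delta>"
        using lam_nonneg[of y "snd w"] \<Delta> by (simp add: move_def add_increasing2 diff_le_eq)
      then show "ennreal \<epsilon> \<le> (kernel_op k ^^ m) (indicator region_B) (y, move \<Delta> y w z)"
        using y k by (auto simp: hits_from_below_def)
    qed (use \<epsilon> in auto)
    then show "ennreal ?e \<le> (kernel_op k ^^ Suc m) (indicator region_B) (x, z)" by simp
  qed (use \<kappa> e in auto)
  then show ?thesis by blast
qed

text \<open>
  With positive probability the jump at \<open>y\<close> exceeds some \<open>l > 0\<close> while \<open>\<gamma> \<ge> - M\<close>; from \<open>z \<le> l exp (- M) \<Delta>\<close>
  this single step ends at a nonpositive height.
\<close>

lemma hits_from_below_pred:
  assumes y: "0 < measure \<nu> {w. 0 < lam y (snd w)}" and xy: "y \<in> set_pmf (K x)"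
  shows "\<exists>m \<kappa> \<epsilon>. hits_from_below x m \<kappa> \<epsilon>"
proof -
  define L where "L i = {w :: real \<times> real. 1 / real (Suc i) \<le> lam y (snd w)}" for i
  have Ls: "L i \<in> sets \<nu>" for i
  proof -
    have "{w \<in> space \<nu>. 1 / real (Suc i) \<le> lam y (snd w)} \<in> sets \<nu>" by measurable
    then show ?thesis by (simp add: L_def)
  qed
  have "(\<lambda>i. measure \<nu> (L i)) \<longlonglongrightarrow> measure \<nu> (\<Union>i. L i)"
  proof (rule nu.finite_Lim_measure_incseq)
    have "L i \<subseteq> L j" if "i \<le> j" for i j
    proof -
      have "1 / real (Suc j) \<le> 1 / real (Suc i)" using that by (intro frac_le) auto
      then show ?thesis unfolding L_def using order_trans by blast
    qed
    then show "incseq L" by (simp add: incseq_def)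
  qed (use Ls in auto)
  also have "(\<Union>i. L i) = {w. 0 < lam y (snd w)}"
  proof -
    have "0 < lam y t \<longleftrightarrow> (\<exists>i. 1 / real (Suc i) \<le> lam y t)" for t
    proof
      assume "0 < lam y t"
      then obtain i where "inverse (real (Suc i)) < lam y t" using reals_Archimedean by blast
      then show "\<exists>i. 1 / real (Suc i) \<le> lam y t" by (intro exI[of _ i]) (simp add: inverse_eq_divide)
    next
      assume "\<exists>i. 1 / real (Suc i) \<le> lam y t"
      then show "0 < lam y t" by (auto intro: order_less_le_trans[rotated])
    qed
    then show ?thesis by (auto simp: L_def)
  qed
  finally have "\<forall>\<^sub>F i in sequentially. 0 < measure \<nu> (L i)"
    using y by (rule order_tendstoD)
  then obtain i where i: "0 < measure \<nu> (L i)" using eventually_happens by force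
  obtain M where M: "0 \<le> M" "0 < measure \<nu> {w \<in> L i. - M \<le> \<gamma> y (fst w)}"
    "{w \<in> L i. - M \<le> \<gamma> y (fst w)} \<in> sets \<nu>"
    by (rule exists_gamma_bound[OF Ls i])
  let ?E = "{w \<in> L i. - M \<le> \<gamma> y (fst w)}" and ?l = "1 / real (Suc i)"
  let ?e = "pmf (K x) y * min 1 (exp (- (\<theta> * M)) * a y / a x) * measure \<nu> ?E * 1"
  have e: "0 < ?e"
    using xy M(2) a_pos[of x] a_pos[of y] by (simp add: pmf_positive)
  have "hits_from_below x 1 (?l * exp (- M)) ?e"
    unfolding hits_from_below_def
  proof (intro conjI allI impI)
    fix \<Delta> h k z
    assume k: "tilted_kernel \<Delta> h k" and z: "z \<le> ?l * exp (- M) * \<Delta>"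
    have \<Delta>: "0 < \<Delta>" using k by (auto simp: tilted_kernel_def)
    have "ennreal ?e \<le> kernel_op k (indicator region_B) (x, z)"
    proof (rule kernel_lower_bound[OF k _ M(3)])
      show "(indicator region_B :: 's \<times> real \<Rightarrow> ennreal) \<in> borel_measurable state_space"
        by simp
      fix w assume w: "w \<in> ?E"
      have "z * exp (- \<gamma> y (fst w)) \<le> ?l * exp (- M) * \<Delta> * exp (- \<gamma> y (fst w))"
        using z by (rule mult_right_mono) simp
      also have "\<dots> \<le> ?l * exp (- M) * \<Delta> * exp M"
        using w \<Delta> by (intro mult_left_mono) auto
      also have "\<dots> = \<Delta> * ?l" by (simp add: exp_minus)
      also have "\<dots> \<le> \<Delta> * lam y (snd w)"
        using w \<Delta> by (intro mult_left_mono) (auto simp: L_def)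
      finally have "move \<Delta> y w z \<le> 0"
        by (simp add: move_def)
      then show "ennreal 1 \<le> indicator region_B (y, move \<Delta> y w z)"
        by (simp add: region_B_def)
    qed auto
    then show "ennreal ?e \<le> (kernel_op k ^^ 1) (indicator region_B) (x, z)" by simp
  qed (use e in auto)
  then show ?thesis by blast
qed

text \<open>
  Follow a path of the chain to a state \<open>t\<close> at which jumps occur.  Jumps happen on arrival, so a chain that starts
  in \<open>t\<close> has to make one further step first.
\<close>

lemma hits_from_below_exists: "\<exists>m \<kappa> \<epsilon>. hits_from_below x m \<kappa> \<epsilon>"
proof -
  obtain t where t: "0 < measure \<nu> {w. 0 < lam t (snd w)}" using lam_pos by blast
  have *: "y = t \<or> (\<exists>m \<kappa> \<epsilon>. hits_from_below y m \<kappa> \<epsilon>)" if "t \<in> set_pmf (n_step K n y)" for n y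
    using that
  proof (induction n arbitrary: y)
    case (Suc n)
    then obtain y1 where y1: "y1 \<in> set_pmf (K y)" "t \<in> set_pmf (n_step K n y1)" by auto
    from Suc.IH[OF y1(2)] show ?case
      using hits_from_below_pred[OF t, of y] hits_from_below_step[of y1 _ _ _ y] y1(1) by blast
  qed auto
  have reach: "y = t \<or> (\<exists>m \<kappa> \<epsilon>. hits_from_below y m \<kappa> \<epsilon>)" for y
    using irreducible *[of _ y] unfolding irreducible_chain_def by (metis pmf_positive_iff)
  obtain y1 where "y1 \<in> set_pmf (K x)" using set_pmf_not_empty[of "K x"] by blast
  with reach[of y1] show ?thesis
    using hits_from_below_pred[OF t, of x] hits_from_below_step[of y1 _ _ _ x] by blast
qed

text \<open>
  Since \<open>region_B\<close> is absorbing, waiting longer cannot hurt.  This allows one number of steps for all states.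
\<close>

lemma hit_probability_mono:
  assumes k: "tilted_kernel \<Delta> h k" and "m \<le> n"
  shows "(kernel_op k ^^ m) (indicator region_B) y \<le> (kernel_op k ^^ n) (indicator region_B) y"
  using \<open>m \<le> n\<close>
proof (induction rule: dec_induct)
  case (step n)
  have kk: "k \<in> state_space \<rightarrow>\<^sub>M prob_algebra state_space" using k by (auto simp: tilted_kernel_def)
  have "(kernel_op k ^^ n) (indicator region_B) y \<le> (kernel_op k ^^ n) (kernel_op k (indicator region_B)) y"
    using region_B_absorbing[OF k]
    by (intro kernel_op_iter_mono[OF kk]) (auto simp: region_B_def split: split_indicator)
  also have "\<dots> = (kernel_op k ^^ Suc n) (indicator region_B) y"
    by (simp add: funpow_swap1)
  finally show ?case using step.IH by (rule order_trans[rotated])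
qed simp

lemma uniform_hit_from_below:
  obtains m \<kappa> \<epsilon> where "\<And>x. hits_from_below x m \<kappa> \<epsilon>"
proof -
  obtain M \<kappa> \<epsilon> where *: "\<And>x. hits_from_below x (M x) (\<kappa> x) (\<epsilon> x)"
    using hits_from_below_exists by metis
  have "hits_from_below x (Max (range M)) (Min (range \<kappa>)) (Min (range \<epsilon>))" for x
    unfolding hits_from_below_def
  proof (intro conjI allI impI)
    show "0 < Min (range \<kappa>)" "0 < Min (range \<epsilon>)"
      using * by (auto simp: hits_from_below_def)
    fix \<Delta> h k z
    assume k: "tilted_kernel \<Delta> h k" and z: "z \<le> Min (range \<kappa>) * \<Delta>"
    have \<Delta>: "0 < \<Delta>" using k by (auto simp: tilted_kernel_def)
    have "Min (range \<kappa>) * \<Delta> \<le> \<kappa> x * \<Delta>" using \<Delta> by (intro mult_right_mono) auto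
    with z have "z \<le> \<kappa> x * \<Delta>" by simp
    then have "ennreal (\<epsilon> x) \<le> (kernel_op k ^^ M x) (indicator region_B) (x, z)"
      using *[of x] k by (auto simp: hits_from_below_def)
    also have "\<dots> \<le> (kernel_op k ^^ Max (range M)) (indicator region_B) (x, z)"
      by (rule hit_probability_mono[OF k]) simp
    finally show "ennreal (Min (range \<epsilon>)) \<le> (kernel_op k ^^ Max (range M)) (indicator region_B) (x, z)"
      by (rule order_trans[rotated]) (auto intro: ennreal_leI)
  qed
  then show ?thesis by (rule that)
qed

section \<open>Descent below the threshold with polynomially small probability\<close>

lemma weighted_step_mono:
  "(\<And>y. f y \<le> g y) \<Longrightarrow> weighted_step W \<Delta> f x z \<le> weighted_step W \<Delta> g x z"
  unfolding weighted_step_def by (intro sum_mono mult_left_mono nn_integral_mono) auto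

lemma weighted_step_add:
  assumes "\<And>y. W x y \<in> borel_measurable \<nu>"
    and "f \<in> borel_measurable state_space" "g \<in> borel_measurable state_space"
  shows "weighted_step W \<Delta> (\<lambda>y. f y + g y) x z = weighted_step W \<Delta> f x z + weighted_step W \<Delta> g x z"
proof -
  have [measurable]: "W x y \<in> borel_measurable \<nu>" "(\<lambda>w. f (y, move \<Delta> y w z)) \<in> borel_measurable \<nu>"
    "(\<lambda>w. g (y, move \<Delta> y w z)) \<in> borel_measurable \<nu>" for y
    using assms f_move_measurable by auto
  show ?thesis
    unfolding weighted_step_def
    by (simp add: distrib_left nn_integral_add sum.distrib)
qed

lemma weighted_step_cmult:
  assumes "\<And>y. W x y \<in> borel_measurable \<nu>" and "f \<in> borel_measurable state_space"
  shows "weighted_step W \<Delta> (\<lambda>y. c * f y) x z = c * weighted_step W \<Delta> f x z"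
proof -
  have [measurable]: "W x y \<in> borel_measurable \<nu>" "(\<lambda>w. f (y, move \<Delta> y w z)) \<in> borel_measurable \<nu>" for y
    using assms f_move_measurable by auto
  have "(\<integral>\<^sup>+ w. ennreal (W x y w) * (c * f (y, move \<Delta> y w z)) \<partial>\<nu>)
    = c * (\<integral>\<^sup>+ w. ennreal (W x y w) * f (y, move \<Delta> y w z) \<partial>\<nu>)" for y
    by (subst nn_integral_cmult[symmetric]) (auto simp: mult_ac)
  then show ?thesis
    unfolding weighted_step_def sum_distrib_left by (simp add: mult_ac)
qed

lemma weighted_step_weight_mono:
  assumes "\<And>y w. c * W x y w \<le> W' x y w" "0 \<le> c" "\<And>y. W x y \<in> borel_measurable \<nu>"
    and f: "f \<in> borel_measurable state_space"
  shows "ennreal c * weighted_step W \<Delta> f x z \<le> weighted_step W' \<Delta> f x z"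
proof -
  have "ennreal c * weighted_step W \<Delta> f x z = weighted_step W \<Delta> (\<lambda>y. ennreal c * f y) x z"
    using assms by (intro weighted_step_cmult[symmetric]) auto
  also have "\<dots> \<le> weighted_step W' \<Delta> f x z"
    unfolding weighted_step_def
  proof (intro sum_mono mult_left_mono nn_integral_mono)
    fix y w
    have "ennreal (W x y w) * (ennreal c * f (y, move \<Delta> y w z)) = ennreal (c * W x y w) * f (y, move \<Delta> y w z)"
      using assms(2) by (simp add: ennreal_mult' mult_ac)
    also have "\<dots> \<le> ennreal (W' x y w) * f (y, move \<Delta> y w z)"
      using assms(1) by (intro mult_right_mono ennreal_leI) auto
    finally show "ennreal (W x y w) * (ennreal c * f (y, move \<Delta> y w z)) \<le> ennreal (W' x y w) * f (y, move \<Delta> y w z)" .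
  qed auto
  finally show ?thesis .
qed

definition ratio_min :: real where "ratio_min = Min (range (\<lambda>x. v x / a x))"
definition ratio_max :: real where "ratio_max = Max (range (\<lambda>x. v x / a x))"

lemma ratio_bounds: "0 < ratio_min" "ratio_min \<le> v x / a x" "v x / a x \<le> ratio_max"
  using a_pos v_pos by (auto simp: ratio_min_def ratio_max_def)

lemma ratio_max_pos: "0 < ratio_max"
  using ratio_bounds by (meson less_le_trans order_trans)

text \<open>
  Both regimes dominate \<open>c\<close> times the truncated step.  Running the truncated step \<open>n\<close> times, the total mass is at
  least \<open>(\<surd>q)\<^sup>n\<close> while the integral of the potential is at most \<open>q\<^sup>n V\<close>, so by Markov's inequality mass at
  least \<open>(\<surd>q)\<^sup>n - q\<^sup>n V / (\<eta>\<^sup>\<delta> ratio_min)\<close> sits at height at most \<open>\<eta>\<close>.  The inequality is put in additive form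
  to avoid subtraction of extended reals, which also makes it stable under induction.
\<close>

lemma descent_probability:
  obtains c where "0 < c" "c \<le> 1"
    "\<And>\<Delta> h k \<eta> n x z. tilted_kernel \<Delta> h k \<Longrightarrow> 0 < \<eta> \<Longrightarrow>
      ennreal ((c * sqrt q) ^ n) \<le> (kernel_op k ^^ n) (indicator {y. snd y \<le> \<eta>}) (x, z)
        + ennreal ((c * q) ^ n / (\<eta> powr \<delta> * ratio_min) * potential (x, z))"
proof -
  obtain M where M: "0 \<le> M"
    "\<And>x \<Delta> z. ennreal (sqrt q) \<le> weighted_step (truncated_weight M) \<Delta> (\<lambda>_. 1) x z"
    using truncated_mass by blast
  define G where "G = (\<Sum>x\<in>UNIV. \<Sum>y\<in>UNIV. a y / a x)"
  have ratio_nonneg: "0 \<le> a y / a x" for x y using a_pos[of x] a_pos[of y] by simp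
  have G: "a y / a x \<le> G" for x y
  proof -
    have "a y / a x \<le> (\<Sum>y\<in>UNIV. a y / a x)" by (rule member_le_sum) (use ratio_nonneg in auto)
    also have "\<dots> \<le> G" unfolding G_def
      by (rule member_le_sum[where f="\<lambda>x. \<Sum>y\<in>UNIV. a y / a x"]) (use ratio_nonneg in \<open>auto intro: sum_nonneg\<close>)
    finally show ?thesis .
  qed
  have G0: "0 \<le> G" using G ratio_nonneg order_trans by blast
  \<comment> \<open>\<open>exp (\<theta> M) G\<close> bounds the truncated weight, and the summand 1 ensures \<open>c \<le> 1\<close>, as needed against the tilted weight.\<close>
  define c where "c = 1 / (1 + exp (\<theta> * M) * G)"
  have den: "1 \<le> 1 + exp (\<theta> * M) * G" using G0 by simp
  have c: "0 < c" "c \<le> 1" unfolding c_def using den by auto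
  have le_nominal: "c * truncated_weight M x y w \<le> nominal_weight x y w" for x y w
  proof (cases "\<gamma> y (fst w) \<le> M")
    case True
    have "exp (\<theta> * \<gamma> y (fst w)) * (a y / a x) \<le> exp (\<theta> * M) * G"
      using True G G0 ratio_nonneg theta_nonneg by (intro mult_mono) (auto intro: mult_left_mono)
    then have "truncated_weight M x y w \<le> 1 + exp (\<theta> * M) * G"
      using True by (simp add: truncated_weight_def tilted_weight_def)
    then show ?thesis using den by (simp add: c_def nominal_weight_def)
  qed (simp add: truncated_weight_def nominal_weight_def)
  have trunc_nonneg: "0 \<le> truncated_weight M x y w" for x y w
    using a_pos[of x] a_pos[of y] by (simp add: truncated_weight_def tilted_weight_def)
  have trunc_le: "truncated_weight M x y w \<le> tilted_weight x y w" for x y w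
    using a_pos[of x] a_pos[of y] by (simp add: truncated_weight_def tilted_weight_def)
  have le_tilted: "c * truncated_weight M x y w \<le> tilted_weight x y w" for x y w
    using mult_right_mono[OF c(2) trunc_nonneg[of x y w]] trunc_le[of x y w] by simp
  have "ennreal ((c * sqrt q) ^ n) \<le> (kernel_op k ^^ n) (indicator {y. snd y \<le> \<eta>}) (x, z)
        + ennreal ((c * q) ^ n / (\<eta> powr \<delta> * ratio_min) * potential (x, z))"
    if k: "tilted_kernel \<Delta> h k" and \<eta>: "0 < \<eta>" for \<Delta> h k \<eta> n x z
  proof (induction n arbitrary: x z)
    case 0
    show ?case
    proof (cases "z \<le> \<eta>")
      case False
      have "\<eta> powr \<delta> * ratio_min \<le> max 0 z powr \<delta> * (v x / a x)"
        using False \<eta> delta ratio_bounds(1) ratio_bounds(2)[of x] by (intro mult_mono powr_mono2) auto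
      then have "\<eta> powr \<delta> * ratio_min \<le> potential (x, z)" by (simp add: potential_def)
      then have "1 \<le> 1 / (\<eta> powr \<delta> * ratio_min) * potential (x, z)"
        using \<eta> ratio_bounds by simp
      then have "ennreal 1 \<le> ennreal (1 / (\<eta> powr \<delta> * ratio_min) * potential (x, z))" by (rule ennreal_leI)
      then show ?thesis by (simp add: add_increasing)
    qed (simp add: indicator_def)
  next
    case (Suc n)
    have kk: "k \<in> state_space \<rightarrow>\<^sub>M prob_algebra state_space" and \<Delta>: "0 < \<Delta>"
      using k by (auto simp: tilted_kernel_def)
    let ?D = "{y :: 's \<times> real. snd y \<le> \<eta>}" and ?T = "truncated_weight M"
    let ?f = "(kernel_op k ^^ n) (indicator ?D)" and ?v = "\<eta> powr \<delta> * ratio_min"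
    let ?C = "(c * q) ^ n / ?v"
    have C0: "0 \<le> ?C" using c q ratio_bounds(1) \<eta> by simp
    have D: "?D \<in> sets state_space" by (rule sublevel_sets)
    have fm: "?f \<in> borel_measurable state_space"
      using D by (intro kernel_op_iter_measurable[OF kk] borel_measurable_indicator)
    have "ennreal ((c * sqrt q) ^ n * sqrt q) = ennreal ((c * sqrt q) ^ n) * ennreal (sqrt q)"
      using c q by (intro ennreal_mult) auto
    also have "\<dots> \<le> ennreal ((c * sqrt q) ^ n) * weighted_step ?T \<Delta> (\<lambda>_. 1) x z"
      by (intro mult_left_mono M(2)) auto
    also have "\<dots> = weighted_step ?T \<Delta> (\<lambda>_. ennreal ((c * sqrt q) ^ n) * 1) x z"
      by (intro weighted_step_cmult[symmetric]) auto
    also have "\<dots> \<le> weighted_step ?T \<Delta> (\<lambda>y. ?f y + ennreal (?C * potential y)) x z"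
      using Suc.IH by (intro weighted_step_mono) (auto simp: split_paired_all)
    also have "\<dots> = weighted_step ?T \<Delta> (\<lambda>y. ?f y + ennreal ?C * ennreal (potential y)) x z"
      by (simp only: ennreal_mult[OF C0 potential_nonneg])
    also have "\<dots> = weighted_step ?T \<Delta> ?f x z + ennreal ?C * weighted_step ?T \<Delta> (\<lambda>y. ennreal (potential y)) x z"
      using fm potential_measurable by (simp add: weighted_step_add weighted_step_cmult)
    also have "weighted_step ?T \<Delta> (\<lambda>y. ennreal (potential y)) x z \<le> ennreal (q * potential (x, z))"
    proof -
      have "ennreal 1 * weighted_step ?T \<Delta> (\<lambda>y. ennreal (potential y)) x z \<le> weighted_step tilted_weight \<Delta> (\<lambda>y. ennreal (potential y)) x z"
        using trunc_le potential_measurable by (intro weighted_step_weight_mono) auto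
      also have "\<dots> \<le> ennreal (q * potential (x, z))" using \<Delta> by (intro weighted_step_tilted_potential) simp
      finally show ?thesis by simp
    qed
    finally have "ennreal ((c * sqrt q) ^ n * sqrt q) \<le> weighted_step ?T \<Delta> ?f x z + ennreal ?C * ennreal (q * potential (x, z))"
      by (simp add: add_left_mono mult_left_mono)
    then have "ennreal c * ennreal ((c * sqrt q) ^ n * sqrt q)
      \<le> ennreal c * (weighted_step ?T \<Delta> ?f x z + ennreal ?C * ennreal (q * potential (x, z)))"
      by (rule mult_left_mono) simp
    also have "\<dots> = ennreal c * weighted_step ?T \<Delta> ?f x z + ennreal (c * (?C * (q * potential (x, z))))"
    proof -
      have "ennreal (c * (?C * (q * potential (x, z)))) = ennreal c * ennreal (?C * (q * potential (x, z)))"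
        using c C0 q potential_nonneg by (intro ennreal_mult mult_nonneg_nonneg) auto
      also have "ennreal (?C * (q * potential (x, z))) = ennreal ?C * ennreal (q * potential (x, z))"
        using C0 q potential_nonneg by (intro ennreal_mult mult_nonneg_nonneg) auto
      finally show ?thesis by (simp only: distrib_left)
    qed
    also have "ennreal c * weighted_step ?T \<Delta> ?f x z \<le> kernel_op k ?f (x, z)"
    proof -
      have "ennreal c * weighted_step ?T \<Delta> ?f x z \<le> weighted_step (if h x < z then tilted_weight else nominal_weight) \<Delta> ?f x z"
        using le_nominal le_tilted c fm by (intro weighted_step_weight_mono) auto
      then show ?thesis using k fm by (simp add: tilted_kernel_def)
    qed
    also have "ennreal c * ennreal ((c * sqrt q) ^ n * sqrt q) = ennreal ((c * sqrt q) ^ Suc n)"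
      using c q by (simp add: ennreal_mult[symmetric] mult_ac)
    also have "c * (?C * (q * potential (x, z))) = (c * q) ^ Suc n / ?v * potential (x, z)"
      by (simp add: mult_ac)
    finally show ?case by (simp add: add_right_mono)
  qed
  with c show ?thesis by (rule that)
qed

text \<open>
  Descend to height \<open>\<kappa>\<Delta>\<close> in \<open>n\<close> steps, with \<open>n\<close> chosen such that the Markov term takes at most half of the
  mass, then spend \<open>m\<close> more steps to terminate.
\<close>

lemma hit_probability_lower_bound:
  fixes R :: real
  assumes R: "1 \<le> R"
  obtains C p where "0 < C" "0 < p"
    "\<And>\<Delta> h k l L. \<lbrakk>tilted_kernel \<Delta> h k; 0 < l; exp 1 \<le> L; l / \<Delta> \<le> L\<rbrakk> \<Longrightarrow>
      \<exists>N. real N \<le> C * ln L \<and> (\<forall>x z. z \<le> R * l \<longrightarrow>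
        ennreal (L powr (- p) / C) \<le> (kernel_op k ^^ N) (indicator region_B) (x, z))"
proof -
  obtain m \<kappa> \<epsilon> where hit: "\<And>x. hits_from_below x m \<kappa> \<epsilon>" by (rule uniform_hit_from_below) blast
  have \<kappa>: "0 < \<kappa>" and \<epsilon>: "0 < \<epsilon>" using hit by (auto simp: hits_from_below_def)
  obtain c where c: "0 < c" "c \<le> 1" and descent:
    "\<And>\<Delta> h k \<eta> n x z. tilted_kernel \<Delta> h k \<Longrightarrow> 0 < \<eta> \<Longrightarrow>
      ennreal ((c * sqrt q) ^ n) \<le> (kernel_op k ^^ n) (indicator {y. snd y \<le> \<eta>}) (x, z)
        + ennreal ((c * q) ^ n / (\<eta> powr \<delta> * ratio_min) * potential (x, z))"
    using descent_probability by blast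
  have sq: "0 < sqrt q" "sqrt q < 1" using q by (auto simp: real_sqrt_lt_1_iff)
  define A where "A = max 1 ((R / \<kappa>) powr \<delta> * (ratio_max / ratio_min))"
  have A: "1 \<le> A" "(R / \<kappa>) powr \<delta> * (ratio_max / ratio_min) \<le> A" by (auto simp: A_def)
  obtain C1 p where C1: "0 < C1" and p: "0 < p" and count:
    "\<And>L. exp 1 \<le> L \<Longrightarrow> \<exists>n::nat. real n \<le> C1 * ln L \<and> sqrt q ^ n * (A * L powr \<delta>) \<le> 1 / 2
       \<and> L powr (- p) \<le> (c * sqrt q) ^ n"
    using logarithmic_step_count[OF sq c A(1) delta(1)] by blast
  define C where "C = C1 + real m + 2 / \<epsilon>"
  have C: "0 < C" "C1 + real m \<le> C" "2 / \<epsilon> \<le> C" unfolding C_def using C1 \<epsilon> by (auto intro!: add_pos_nonneg)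
  have "\<exists>N. real N \<le> C * ln L \<and> (\<forall>x z. z \<le> R * l \<longrightarrow>
        ennreal (L powr (- p) / C) \<le> (kernel_op k ^^ N) (indicator region_B) (x, z))"
    if k: "tilted_kernel \<Delta> h k" and l: "0 < l" and L: "exp 1 \<le> L" "l / \<Delta> \<le> L" for \<Delta> h k l L
  proof -
    have kk: "k \<in> state_space \<rightarrow>\<^sub>M prob_algebra state_space" and \<Delta>: "0 < \<Delta>"
      using k by (auto simp: tilted_kernel_def)
    have L0: "0 < L" using L(1) by (meson exp_gt_zero less_le_trans)
    have lL: "1 \<le> ln L" using L L0 by (simp add: ln_ge_iff)
    obtain n where n: "real n \<le> C1 * ln L" "sqrt q ^ n * (A * L powr \<delta>) \<le> 1 / 2" "L powr (- p) \<le> (c * sqrt q) ^ n"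
      using count[OF L(1)] by blast
    let ?\<eta> = "\<kappa> * \<Delta>"
    have \<eta>: "0 < ?\<eta>" using \<kappa> \<Delta> by simp
    let ?D = "{y :: 's \<times> real. snd y \<le> ?\<eta>}"
    have D: "?D \<in> sets state_space" by (rule sublevel_sets)
    have "ennreal (L powr (- p) / C) \<le> (kernel_op k ^^ (n + m)) (indicator region_B) (x, z)"
      if z: "z \<le> R * l" for x z
    proof -
      define G where "G = (kernel_op k ^^ n) (indicator ?D) (x, z)"
      have "potential (x, z) / (?\<eta> powr \<delta> * ratio_min) \<le> A * L powr \<delta>"
      proof -
        have "max 0 z \<le> ?\<eta> * (R / \<kappa> * L)"
        proof -
          have "l \<le> \<Delta> * L" using L(2) \<Delta> by (simp add: pos_divide_le_eq mult.commute)
          then have "R * l \<le> R * (\<Delta> * L)" using R by (intro mult_left_mono) auto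
          moreover have "?\<eta> * (R / \<kappa> * L) = R * (\<Delta> * L)" using \<kappa> by simp
          moreover have "0 \<le> R * (\<Delta> * L)" using R \<Delta> L0 by simp
          ultimately show ?thesis using z by simp
        qed
        then have "max 0 z powr \<delta> \<le> (?\<eta> * (R / \<kappa> * L)) powr \<delta>"
          using delta by (intro powr_mono2) auto
        also have "\<dots> = ?\<eta> powr \<delta> * ((R / \<kappa>) powr \<delta> * L powr \<delta>)"
          using \<eta> R \<kappa> L0 powr_mult[of "R / \<kappa>" L \<delta>] powr_mult[of ?\<eta> "R / \<kappa> * L" \<delta>] by simp
        finally have "potential (x, z) \<le> (?\<eta> powr \<delta> * ((R / \<kappa>) powr \<delta> * L powr \<delta>)) * ratio_max"
          unfolding potential_def fst_conv snd_conv using ratio_bounds(3)[of x] ratio_bounds(1) ratio_bounds(2)[of x]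
          by (intro mult_mono) auto
        then have "potential (x, z) / (?\<eta> powr \<delta> * ratio_min)
          \<le> (?\<eta> powr \<delta> * ((R / \<kappa>) powr \<delta> * L powr \<delta>)) * ratio_max / (?\<eta> powr \<delta> * ratio_min)"
          using ratio_bounds(1) by (intro divide_right_mono) auto
        also have "\<dots> = ((R / \<kappa>) powr \<delta> * (ratio_max / ratio_min)) * L powr \<delta>"
          using \<kappa> \<Delta> ratio_bounds(1) by (simp add: field_simps)
        also have "\<dots> \<le> A * L powr \<delta>" using A(2) by (intro mult_right_mono) auto
        finally show ?thesis .
      qed
      then have "(c * q) ^ n * (potential (x, z) / (?\<eta> powr \<delta> * ratio_min)) \<le> (c * q) ^ n * (A * L powr \<delta>)"
        using c q by (intro mult_left_mono) auto
      then have "(c * q) ^ n / (?\<eta> powr \<delta> * ratio_min) * potential (x, z) \<le> (c * q) ^ n * (A * L powr \<delta>)"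
        by (simp only: times_divide_eq_left times_divide_eq_right)
      also have "(c * q) ^ n * (A * L powr \<delta>) = (c * sqrt q) ^ n * (sqrt q ^ n * (A * L powr \<delta>))"
      proof -
        have "c * q = c * sqrt q * sqrt q" using q by simp
        then have "(c * q) ^ n = (c * sqrt q) ^ n * sqrt q ^ n" by (simp only: power_mult_distrib)
        then show ?thesis by simp
      qed
      also have "\<dots> \<le> (c * sqrt q) ^ n * (1 / 2)"
        using n(2) c q by (intro mult_left_mono) auto
      finally have "(c * q) ^ n / (?\<eta> powr \<delta> * ratio_min) * potential (x, z) \<le> (c * sqrt q) ^ n * (1 / 2)" .
      then have "ennreal ((c * sqrt q) ^ n) \<le> G + ennreal ((c * sqrt q) ^ n / 2)"
        using descent[OF k \<eta>, of n x z] unfolding G_def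
        by (elim order_trans) (auto intro!: add_left_mono ennreal_leI)
      moreover have "ennreal ((c * sqrt q) ^ n) = ennreal ((c * sqrt q) ^ n / 2) + ennreal ((c * sqrt q) ^ n / 2)"
        using c q by (subst ennreal_plus[symmetric]) auto
      ultimately have G: "ennreal ((c * sqrt q) ^ n / 2) \<le> G"
        by (simp add: add.commute[of G] ennreal_add_left_cancel_le)
      have "L powr (- p) / C \<le> \<epsilon> * ((c * sqrt q) ^ n / 2)"
      proof -
        have "L powr (- p) / C \<le> L powr (- p) / (2 / \<epsilon>)"
          using C(1,3) \<epsilon> by (intro divide_left_mono) auto
        also have "\<dots> \<le> (c * sqrt q) ^ n / (2 / \<epsilon>)"
          using n(3) \<epsilon> by (intro divide_right_mono) auto
        finally show ?thesis by (simp add: mult.commute)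
      qed
      then have "ennreal (L powr (- p) / C) \<le> ennreal (\<epsilon> * ((c * sqrt q) ^ n / 2))" by (rule ennreal_leI)
      also have "\<dots> = ennreal \<epsilon> * ennreal ((c * sqrt q) ^ n / 2)"
        using \<epsilon> c q by (intro ennreal_mult) auto
      also have "\<dots> \<le> ennreal \<epsilon> * G" using G by (rule mult_left_mono) simp
      also have "\<dots> = (kernel_op k ^^ n) (\<lambda>y. ennreal \<epsilon> * indicator ?D y) (x, z)"
        unfolding G_def using D by (intro kernel_op_iter_cmult[OF kk, symmetric]) auto
      also have "\<dots> \<le> (kernel_op k ^^ n) ((kernel_op k ^^ m) (indicator region_B)) (x, z)"
      proof (rule kernel_op_iter_mono[OF kk])
        fix y :: "'s \<times> real"
        show "ennreal \<epsilon> * indicator ?D y \<le> (kernel_op k ^^ m) (indicator region_B) y"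
          using hit[of "fst y"] k by (cases y) (auto simp: hits_from_below_def split: split_indicator)
      qed simp
      also have "\<dots> = (kernel_op k ^^ (n + m)) (indicator region_B) (x, z)"
        by (simp add: funpow_add)
      finally show ?thesis .
    qed
    moreover have "real (n + m) \<le> C * ln L"
    proof -
      have "real m \<le> real m * ln L" using lL by (simp add: mult_le_cancel_left1)
      then have "real (n + m) \<le> (C1 + real m) * ln L" using n(1) by (simp add: distrib_right)
      also have "\<dots> \<le> C * ln L" using C(2) lL by (intro mult_right_mono) auto
      finally show ?thesis .
    qed
    ultimately show ?thesis by blast
  qed
  with C(1) p show ?thesis by (rule that)
qed

text \<open>
  The drift criterion with \<open>D\<close> the region below the threshold.  All thresholds are comparable to a common scale
  \<open>l\<close>, and \<open>L\<close> bounds \<open>l / \<Delta>\<close>; the requirement \<open>L \<ge> exp 1\<close> makes \<open>ln L \<ge> 1\<close>, so that additive constants can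
  be absorbed.
\<close>

section \<open>A bound on the expected termination time, uniform in the scale\<close>

lemma expected_hitting_time_bound:
  fixes R :: real
  assumes R: "1 \<le> R"
  obtains C p where "0 < C" "0 < p"
    "\<And>\<Delta> h k l L x z. \<lbrakk>tilted_kernel \<Delta> h k; 0 < l; \<forall>x. l \<le> h x \<and> h x \<le> R * l; exp 1 \<le> L; l / \<Delta> \<le> L\<rbrakk> \<Longrightarrow>
      (\<Sum>n. (kernel_op k ^^ n) (indicator (- region_B)) (x, z))
        \<le> ennreal (C * (L powr p * ln L + ln (1 + max 0 z / l)))"
proof -
  obtain b where b: "0 < b" "\<And>\<Delta> x z. 0 \<le> \<Delta> \<Longrightarrow>
       weighted_step nominal_weight \<Delta> (\<lambda>y. ennreal (potential y)) x z \<le> ennreal ((max 0 z) powr \<delta> * b)"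
    using weighted_step_nominal_potential by blast
  obtain C1 p where C1: "0 < C1" and p: "0 < p" and hit:
    "\<And>\<Delta> h k l L. \<lbrakk>tilted_kernel \<Delta> h k; 0 < l; exp 1 \<le> L; l / \<Delta> \<le> L\<rbrakk> \<Longrightarrow>
      \<exists>N. real N \<le> C1 * ln L \<and> (\<forall>x z. z \<le> R * l \<longrightarrow>
        ennreal (L powr (- p) / C1) \<le> (kernel_op k ^^ N) (indicator region_B) (x, z))"
    using hit_probability_lower_bound[OF R] by blast
  let ?\<alpha> = "ln (2 / (1 + q))" and ?\<rho> = "ratio_max / ratio_min"
  have rr: "0 < ?\<rho>" using ratio_bounds(1) ratio_max_pos by simp
  define B where "B = R powr \<delta> * b / (ratio_min * ?\<alpha>)"
  have B: "0 \<le> B" unfolding B_def using b ratio_bounds(1) rate_pos by simp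
  define C where "C = (ln (1 + ?\<rho>) + 1) / ?\<alpha> + (1 + B) * C1 * C1"
  have C: "0 < C" unfolding C_def using rr rate_pos B C1
    by (intro add_pos_nonneg divide_pos_pos add_nonneg_pos) auto
  have "(\<Sum>n. (kernel_op k ^^ n) (indicator (- region_B)) (x, z))
        \<le> ennreal (C * (L powr p * ln L + ln (1 + max 0 z / l)))"
    if k: "tilted_kernel \<Delta> h k" and l: "0 < l" and hh: "\<forall>x. l \<le> h x \<and> h x \<le> R * l"
      and L: "exp 1 \<le> L" "l / \<Delta> \<le> L" for \<Delta> h k l L x z
  proof -
    have h: "l \<le> h x" "h x \<le> R * l" for x using hh by auto
    have kk: "k \<in> state_space \<rightarrow>\<^sub>M prob_algebra state_space" and \<Delta>: "0 < \<Delta>"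
      using k by (auto simp: tilted_kernel_def)
    have L0: "0 < L" using L(1) by (meson exp_gt_zero less_le_trans)
    have lL: "1 \<le> ln L" using L L0 by (simp add: ln_ge_iff)
    obtain N where N: "real N \<le> C1 * ln L" and hitN: "\<And>x z. z \<le> R * l \<Longrightarrow>
        ennreal (L powr (- p) / C1) \<le> (kernel_op k ^^ N) (indicator region_B) (x, z)"
      using hit[OF k l L] by blast
    let ?\<epsilon> = "L powr (- p) / C1"
    have \<epsilon>: "0 < ?\<epsilon>" using L0 C1 by simp
    define v0 where "v0 = l powr \<delta> * ratio_min"
    have v0: "0 < v0" unfolding v0_def using l ratio_bounds(1) by simp
    let ?A = "- (region_B :: ('s \<times> real) set)" and ?D = "{(x, z). z \<le> h x}"
    have A: "?A \<in> sets state_space"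
      using sets.compl_sets[OF region_B_sets] by (simp add: Compl_eq_Diff_UNIV)
    have bound: "(\<Sum>n. (kernel_op k ^^ n) (indicator ?A) (x, z)) \<le> ennreal (log_potential v0 (x, z)) + ennreal ((1 + B) / ?\<epsilon> * N)"
    proof (rule expected_time_le[where D="?D", OF kk A log_potential_measurable[OF v0] B \<epsilon>])
      fix y :: "'s \<times> real" assume "y \<notin> ?A"
      then have y: "snd y \<le> 0" by (auto simp: region_B_def)
      then have "kernel_op k (indicator region_B) y = 1"
        using region_B_absorbing[OF k, of "snd y" "fst y"] by simp
      then show "kernel_op k (indicator ?A) y = 0"
        using kernel_op_iter_split[OF kk _ region_B_sets, of y 1] by simp
      show "ennreal (log_potential v0 y) = 0" using y by (simp add: log_potential_def potential_def)
    next
      fix y :: "'s \<times> real" assume y: "y \<in> ?A" "y \<notin> ?D"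
      obtain x z where yxz: "y = (x, z)" by fastforce
      have z: "h x < z" using y by (simp add: yxz)
      have "v0 \<le> max 0 z powr \<delta> * (v x / a x)"
        unfolding v0_def using z h(1)[of x] l delta ratio_bounds(1) ratio_bounds(2)[of x]
        by (intro mult_mono powr_mono2) auto
      then show "kernel_op k (\<lambda>y. ennreal (log_potential v0 y)) y + 1 \<le> ennreal (log_potential v0 y)"
        unfolding yxz using log_potential_drift_outer[OF k z v0] by (simp add: potential_def)
    next
      fix y :: "'s \<times> real" assume y: "y \<in> ?A" "y \<in> ?D"
      obtain x z where yxz: "y = (x, z)" by fastforce
      have z: "z \<le> h x" "0 < z" using y by (simp_all add: yxz region_B_def)
      have zR: "z \<le> R * l" using z(1) h(2)[of x] by simp
      have "max 0 z powr \<delta> * b / (v0 * ?\<alpha>) \<le> (R * l) powr \<delta> * b / (v0 * ?\<alpha>)"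
        using z zR b v0 rate_pos delta by (intro divide_right_mono mult_right_mono powr_mono2) auto
      also have "\<dots> = B"
        using l R by (simp add: B_def v0_def powr_mult)
      finally show "kernel_op k (\<lambda>y. ennreal (log_potential v0 y)) y \<le> ennreal B"
        unfolding yxz using log_potential_drift_inner[OF b(2) k z(1) v0] by (meson ennreal_leI order_trans)
      have "(kernel_op k ^^ N) (indicator ?A) y + ennreal ?\<epsilon>
        \<le> (kernel_op k ^^ N) (indicator ?A) y + (kernel_op k ^^ N) (indicator region_B) y"
        unfolding yxz using hitN[OF zR] by (rule add_left_mono)
      also have "\<dots> = 1"
        using kernel_op_iter_split[OF kk _ region_B_sets, of y N] by (simp add: add.commute)
      finally show "(kernel_op k ^^ N) (indicator ?A) y + ennreal ?\<epsilon> \<le> 1" .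
    qed simp
    have F_le: "log_potential v0 (x, z) \<le> (ln (1 + ?\<rho>) + ln (1 + max 0 z / l)) / ?\<alpha>"
    proof -
      let ?t = "max 0 z / l"
      have t: "0 \<le> ?t" using l by simp
      have "?t powr \<delta> \<le> 1 + ?t"
      proof (cases "?t \<le> 1")
        case True
        then have "?t powr \<delta> \<le> 1" using t delta by (intro powr_le1) auto
        then show ?thesis using t by simp
      next
        case False
        then have "?t powr \<delta> \<le> ?t powr 1" using delta by (intro powr_mono) auto
        then show ?thesis using t by simp
      qed
      have "potential (x, z) / v0 = ?t powr \<delta> * ((v x / a x) / ratio_min)"
        using l by (simp add: potential_def v0_def powr_divide)
      also have "\<dots> \<le> (1 + ?t) * ?\<rho>"
        using \<open>?t powr \<delta> \<le> 1 + ?t\<close> t ratio_bounds(1) ratio_bounds(3)[of x] a_pos[of x] v_pos[of x]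
        by (intro mult_mono divide_right_mono) auto
      finally have V_le: "potential (x, z) / v0 \<le> (1 + ?t) * ?\<rho>" .
      have "1 + X \<le> (1 + r) * (1 + t)" if "X \<le> (1 + t) * r" "0 \<le> t" for X r t :: real
        using that by (simp add: algebra_simps)
      from this[OF V_le t] have "1 + potential (x, z) / v0 \<le> (1 + ?\<rho>) * (1 + ?t)" .
      then have "ln (1 + potential (x, z) / v0) \<le> ln ((1 + ?\<rho>) * (1 + ?t))"
        using potential_nonneg[of "(x, z)"] v0 by (intro ln_mono) (auto intro: add_pos_nonneg)
      also have "\<dots> = ln (1 + ?\<rho>) + ln (1 + ?t)"
        using t rr by (intro ln_mult_pos) auto
      finally show ?thesis unfolding log_potential_def using rate_pos by (intro divide_right_mono) auto
    qed
    have main: "(1 + B) / ?\<epsilon> * N \<le> (1 + B) * C1 * C1 * (L powr p * ln L)"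
    proof -
      have "(1 + B) / ?\<epsilon> = (1 + B) * C1 * L powr p"
        using L0 C1 by (simp add: powr_minus field_simps)
      then have "(1 + B) / ?\<epsilon> * N \<le> (1 + B) * C1 * L powr p * (C1 * ln L)"
        using N B C1 by (auto intro!: mult_left_mono)
      then show ?thesis by (simp add: mult_ac)
    qed
    have "1 * 1 \<le> L powr p * ln L"
    proof (rule mult_mono)
      have "1 \<le> L" using L(1) one_le_exp_iff[of "1::real"] by linarith
      then show "1 \<le> L powr p" using p by (intro ge_one_powr_ge_zero) auto
    qed (use lL in auto)
    then have one: "1 \<le> L powr p * ln L" by simp
    have lt: "0 \<le> ln (1 + max 0 z / l)" using l by simp
    have "log_potential v0 (x, z) + (1 + B) / ?\<epsilon> * N
      \<le> (ln (1 + ?\<rho>) + ln (1 + max 0 z / l)) / ?\<alpha> + (1 + B) * C1 * C1 * (L powr p * ln L)"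
      using F_le main by (rule add_mono)
    also have "\<dots> \<le> C * (L powr p * ln L + ln (1 + max 0 z / l))"
    proof -
      have 1: "ln (1 + ?\<rho>) / ?\<alpha> \<le> (ln (1 + ?\<rho>) / ?\<alpha>) * (L powr p * ln L)"
      proof -
        have "0 \<le> ln (1 + ?\<rho>) / ?\<alpha>" using rr rate_pos by simp
        from mult_left_mono[OF one this] show ?thesis by simp
      qed
      have 2: "0 \<le> (1 / ?\<alpha>) * (L powr p * ln L)" using one rate_pos by simp
      have 3: "0 \<le> (ln (1 + ?\<rho>) / ?\<alpha> + (1 + B) * C1 * C1) * ln (1 + max 0 z / l)"
        using lt rr rate_pos B C1 by simp
      from 1 2 3 show ?thesis
        by (simp add: C_def add_divide_distrib algebra_simps)
    qed
    finally have fin: "log_potential v0 (x, z) + (1 + B) / ?\<epsilon> * N \<le> C * (L powr p * ln L + ln (1 + max 0 z / l))" .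
    have "0 \<le> log_potential v0 (x, z)" unfolding log_potential_def using potential_nonneg v0 rate_pos by simp
    moreover have "0 \<le> (1 + B) / ?\<epsilon> * N"
      using B \<epsilon> by (intro mult_nonneg_nonneg divide_nonneg_pos) auto
    ultimately have "ennreal (log_potential v0 (x, z)) + ennreal ((1 + B) / ?\<epsilon> * N) = ennreal (log_potential v0 (x, z) + (1 + B) / ?\<epsilon> * N)"
      by (rule ennreal_plus[symmetric])
    also have "\<dots> \<le> ennreal (C * (L powr p * ln L + ln (1 + max 0 z / l)))"
      using fin by (rule ennreal_leI)
    finally show ?thesis using bound by (rule order_trans[rotated])
  qed
  with C p show ?thesis by (rule that)
qed

end

section \<open>The sampler has a tilted kernel\<close>

lemma prob_space_pmf_sets: "measure_pmf p \<in> space (prob_algebra (count_space UNIV))"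
  by (simp add: space_prob_algebra measure_pmf.prob_space_axioms)

lemma Y_step_measurable:
  fixes p :: "'s::finite pmf"
  assumes J: "\<And>y. J y \<in> space (prob_algebra borel)"
  shows "Y_step \<Delta> p J \<in> borel \<rightarrow>\<^sub>M prob_algebra state_space"
proof -
  have "(\<lambda>w. distr (J y) state_space (\<lambda>(g, l). (y, w * exp (- g) - \<Delta> * l))) \<in> borel \<rightarrow>\<^sub>M prob_algebra (state_space :: ('s \<times> real) measure)" for y
  proof (rule measurable_distr_prob_space2)
    show "(\<lambda>w. J y) \<in> borel \<rightarrow>\<^sub>M prob_algebra borel" using J by simp
    show "(\<lambda>(w, v). case v of (g, l) \<Rightarrow> (y, w * exp (- g) - \<Delta> * l)) \<in> borel \<Otimes>\<^sub>M borel \<rightarrow>\<^sub>M (state_space :: ('s \<times> real) measure)"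
      unfolding state_space_def borel_prod[symmetric] by measurable
  qed
  then have "(\<lambda>(w, y). distr (J y) state_space (\<lambda>(g, l). (y, w * exp (- g) - \<Delta> * l)))
    \<in> borel \<Otimes>\<^sub>M count_space UNIV \<rightarrow>\<^sub>M prob_algebra (state_space :: ('s \<times> real) measure)"
    by (auto simp: case_prod_beta' intro!: measurable_compose_countable[OF measurable_compose[OF measurable_fst] measurable_snd])
  moreover have "(\<lambda>w. measure_pmf p) \<in> borel \<rightarrow>\<^sub>M prob_algebra (count_space UNIV)"
    by (simp add: prob_space_pmf_sets)
  ultimately show ?thesis
    unfolding Y_step_def[abs_def] by (intro measurable_bind_prob_space2)
qed

lemma nn_integral_Y_step:
  fixes p :: "'s::finite pmf"
  assumes J: "\<And>y. J y \<in> space (prob_algebra borel)" and f: "f \<in> borel_measurable state_space"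
  shows "(\<integral>\<^sup>+ y. f y \<partial>Y_step \<Delta> p J z)
    = (\<Sum>y\<in>UNIV. ennreal (pmf p y) * (\<integral>\<^sup>+ (g, l). f (y, z * exp (- g) - \<Delta> * l) \<partial>J y))"
proof -
  have sJ: "sets (J y) = sets borel" for y using J by (simp add: space_prob_algebra)
  have m: "(\<lambda>(g, l). (y, z * exp (- g) - \<Delta> * l)) \<in> J y \<rightarrow>\<^sub>M (state_space :: ('s \<times> real) measure)" for y
    unfolding measurable_cong_sets[OF sJ refl] state_space_def borel_prod[symmetric] by measurable
  have d: "distr (J y) state_space (\<lambda>(g, l). (y, z * exp (- g) - \<Delta> * l)) \<in> space (subprob_algebra (state_space :: ('s \<times> real) measure))" for y
    using prob_space.prob_space_distr[OF _ m] J
    by (auto simp: space_subprob_algebra space_prob_algebra intro!: prob_space_imp_subprob_space)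
  have "(\<integral>\<^sup>+ y. f y \<partial>Y_step \<Delta> p J z)
    = (\<integral>\<^sup>+ y. (\<integral>\<^sup>+ v. f v \<partial>distr (J y) state_space (\<lambda>(g, l). (y, z * exp (- g) - \<Delta> * l))) \<partial>measure_pmf p)"
    unfolding Y_step_def using d by (intro nn_integral_bind[OF f]) auto
  also have "\<dots> = (\<integral>\<^sup>+ y. (\<integral>\<^sup>+ (g, l). f (y, z * exp (- g) - \<Delta> * l) \<partial>J y) \<partial>measure_pmf p)"
    using m f by (intro nn_integral_cong) (simp add: nn_integral_distr case_prod_beta')
  also have "\<dots> = (\<Sum>y\<in>UNIV. ennreal (pmf p y) * (\<integral>\<^sup>+ (g, l). f (y, z * exp (- g) - \<Delta> * l) \<partial>J y))"
    by (subst nn_integral_measure_pmf_support[of UNIV]) (auto simp: mult.commute)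
  finally show ?thesis .
qed

text \<open>
  The logarithm in the definition of \<open>chi\<close> is applied to a positive number, as an integrable positive function has
  positive expectation.
\<close>

lemma mgf_eq_exp_chi:
  assumes "prob_space \<nu>" "chi_finite \<nu> \<gamma> \<theta>"
  shows "(\<integral>\<^sup>+ w. ennreal (exp (\<theta> * \<gamma> y (fst w))) \<partial>\<nu>) = ennreal (exp (chi \<nu> \<gamma> y \<theta>))"
proof -
  interpret prob_space \<nu> by fact
  have int: "integrable \<nu> (\<lambda>w. exp (\<theta> * \<gamma> y (fst w)))"
    using assms(2) by (simp add: chi_finite_def)
  then have "0 < (\<integral>w. exp (\<theta> * \<gamma> y (fst w)) \<partial>\<nu>)"
    by (intro expectation_greater) auto
  then have "exp (chi \<nu> \<gamma> y \<theta>) = (\<integral>w. exp (\<theta> * \<gamma> y (fst w)) \<partial>\<nu>)"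
    by (simp add: chi_def)
  then show ?thesis
    using nn_integral_eq_integral[OF int] by simp
qed

context tilted_chain begin

lemma pair_measurable: "(\<lambda>w. (\<gamma> y (fst w), lam y (snd w))) \<in> \<nu> \<rightarrow>\<^sub>M borel"
  unfolding borel_prod[symmetric] by measurable

lemma increment_law_prob: "increment_law \<nu> \<gamma> lam y \<in> space (prob_algebra borel)"
  unfolding increment_law_def
  by (simp add: space_prob_algebra nu.prob_space_distr[OF pair_measurable])

lemma tilted_density_integral:
  assumes f: "f \<in> borel_measurable borel"
  shows "(\<integral>\<^sup>+ v. f v \<partial>tilted_increment_law \<nu> \<gamma> lam \<theta> y)
    = (\<integral>\<^sup>+ w. ennreal (exp (\<theta> * \<gamma> y (fst w) - chi \<nu> \<gamma> y \<theta>)) * f (\<gamma> y (fst w), lam y (snd w)) \<partial>\<nu>)"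
proof -
  have d: "(\<lambda>(g, l). ennreal (exp (\<theta> * g - chi \<nu> \<gamma> y \<theta>))) \<in> borel_measurable (borel :: (real \<times> real) measure)"
    unfolding borel_prod[symmetric] by measurable
  have dI: "(\<lambda>(g, l). ennreal (exp (\<theta> * g - chi \<nu> \<gamma> y \<theta>))) \<in> borel_measurable (increment_law \<nu> \<gamma> lam y)"
    "f \<in> borel_measurable (increment_law \<nu> \<gamma> lam y)"
    using d f by (simp_all add: increment_law_def)
  have "(\<integral>\<^sup>+ v. f v \<partial>tilted_increment_law \<nu> \<gamma> lam \<theta> y)
    = (\<integral>\<^sup>+ v. (case v of (g, l) \<Rightarrow> ennreal (exp (\<theta> * g - chi \<nu> \<gamma> y \<theta>))) * f v \<partial>increment_law \<nu> \<gamma> lam y)"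
    unfolding tilted_increment_law_def by (rule nn_integral_density[OF dI])
  also have "\<dots> = (\<integral>\<^sup>+ w. (case (\<gamma> y (fst w), lam y (snd w)) of (g, l) \<Rightarrow>
      ennreal (exp (\<theta> * g - chi \<nu> \<gamma> y \<theta>))) * f (\<gamma> y (fst w), lam y (snd w)) \<partial>\<nu>)"
    unfolding increment_law_def using d f
    by (intro nn_integral_distr[OF pair_measurable] borel_measurable_times_ennreal) auto
  finally show ?thesis by simp
qed

text \<open>
  The normalising constant \<open>exp (chi)\<close> is exactly the moment generating function at \<open>\<theta>\<close>.
\<close>

lemma tilted_increment_law_prob:
  assumes "chi_finite \<nu> \<gamma> \<theta>"
  shows "tilted_increment_law \<nu> \<gamma> lam \<theta> y \<in> space (prob_algebra borel)"
proof -
  have "(\<integral>\<^sup>+ v. 1 \<partial>tilted_increment_law \<nu> \<gamma> lam \<theta> y)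
    = (\<integral>\<^sup>+ w. ennreal (exp (- chi \<nu> \<gamma> y \<theta>)) * ennreal (exp (\<theta> * \<gamma> y (fst w))) \<partial>\<nu>)"
    by (subst tilted_density_integral) (auto simp: ennreal_mult[symmetric] exp_add[symmetric])
  also have "\<dots> = ennreal (exp (- chi \<nu> \<gamma> y \<theta>)) * ennreal (exp (chi \<nu> \<gamma> y \<theta>))"
    unfolding mgf_eq_exp_chi[OF prob_nu assms, symmetric] by (rule nn_integral_cmult) measurable
  also have "\<dots> = 1" by (simp add: ennreal_mult[symmetric] exp_add[symmetric])
  finally have "emeasure (tilted_increment_law \<nu> \<gamma> lam \<theta> y) (space (tilted_increment_law \<nu> \<gamma> lam \<theta> y)) = 1"
    by simp
  then have "prob_space (tilted_increment_law \<nu> \<gamma> lam \<theta> y)" by (rule prob_spaceI)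
  then show ?thesis
    by (simp add: space_prob_algebra tilted_increment_law_def increment_law_def)
qed

lemma tilted_state_pmf:
  assumes chi: "chi_finite \<nu> \<gamma> \<theta>" and u: "\<And>x. u \<theta> $ x = a x"
  shows "pmf (tilted_state K \<nu> \<gamma> u \<theta> x) y = pmf (K x) y * exp (chi \<nu> \<gamma> y \<theta>) * a y / a x"
  unfolding tilted_state_def u
proof (rule pmf_embed_pmf)
  show nn: "0 \<le> pmf (K x) y * exp (chi \<nu> \<gamma> y \<theta>) * a y / a x" for y
    using a_pos[of x] a_pos[of y] by simp
  have "(\<integral>\<^sup>+ y. ennreal (pmf (K x) y * exp (chi \<nu> \<gamma> y \<theta>) * a y / a x) \<partial>count_space UNIV)
    = (\<Sum>y\<in>UNIV. ennreal (1 / a x) * (ennreal (pmf (K x) y * a y) * ennreal (exp (chi \<nu> \<gamma> y \<theta>))))"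
    using a_pos[of x] a_pos
    by (subst nn_integral_count_space_finite)
      (auto intro!: sum.cong simp: ennreal_mult[symmetric] less_imp_le mult_ac)
  also have "\<dots> = ennreal (1 / a x) * ennreal (a x)"
    unfolding sum_distrib_left[symmetric] using eigen_a[of x] by (simp add: mgf_eq_exp_chi[OF prob_nu chi])
  also have "\<dots> = 1" using a_pos[of x] by (simp add: ennreal_mult[symmetric])
  finally show "(\<integral>\<^sup>+ y. ennreal (pmf (K x) y * exp (chi \<nu> \<gamma> y \<theta>) * a y / a x) \<partial>count_space UNIV) = 1" .
qed

text \<open>
  The factor \<open>exp (chi)\<close> in the tilted transition matrix and \<open>exp (- chi)\<close> in the tilted increments cancel, which
  leaves the weight \<open>exp (\<theta> \<gamma>) a y / a x\<close>.
\<close>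

lemma sampler_tilted_kernel:
  assumes chi: "chi_finite \<nu> \<gamma> \<theta>" and u: "\<And>x. u \<theta> $ x = a x" and \<Delta>: "0 < \<Delta>"
    and h: "\<And>x. 0 < c_level B1 B2 \<theta> \<Delta> * \<Delta> * g_fun u \<theta> \<Delta> x"
  shows "tilted_kernel \<Delta> (\<lambda>x. c_level B1 B2 \<theta> \<Delta> * \<Delta> * g_fun u \<theta> \<Delta> x) (sampler_kernel K \<nu> \<gamma> lam u \<theta> B1 B2 \<Delta>)"
  unfolding tilted_kernel_def
proof (intro conjI allI ballI)
  let ?h = "\<lambda>x. c_level B1 B2 \<theta> \<Delta> * \<Delta> * g_fun u \<theta> \<Delta> x"
  let ?k = "sampler_kernel K \<nu> \<gamma> lam u \<theta> B1 B2 \<Delta>"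
  have k: "?k (x, z) = (if ?h x < z
     then Y_step \<Delta> (tilted_state K \<nu> \<gamma> u \<theta> x) (tilted_increment_law \<nu> \<gamma> lam \<theta>) z
     else Y_step \<Delta> (K x) (increment_law \<nu> \<gamma> lam) z)" for x z
    by (simp add: sampler_kernel_def region_C_def)
  show "?k \<in> state_space \<rightarrow>\<^sub>M prob_algebra state_space"
  proof (rule measurable_state_space)
    show "(\<lambda>z. ?k (x, z)) \<in> borel \<rightarrow>\<^sub>M prob_algebra state_space" for x
      unfolding k
      by (intro measurable_If Y_step_measurable tilted_increment_law_prob[OF chi] increment_law_prob) auto
  qed
  fix f :: "'s \<times> real \<Rightarrow> ennreal" and x z
  assume f: "f \<in> borel_measurable state_space"
  have fb: "(\<lambda>(g, l). f (y, z * exp (- g) - \<Delta> * l)) \<in> borel_measurable borel" for y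
  proof -
    have "(\<lambda>v::real \<times> real. f (y, z * exp (- fst v) - \<Delta> * snd v)) \<in> borel_measurable borel"
      unfolding borel_prod[symmetric]
      by (rule measurable_compose[OF _ measurable_state_space_slice[OF f]]) measurable
    then show ?thesis by (simp add: case_prod_beta')
  qed
  show "kernel_op ?k f (x, z) = weighted_step (if ?h x < z then tilted_weight else nominal_weight) \<Delta> f x z"
  proof (cases "?h x < z")
    case True
    have "kernel_op ?k f (x, z) = (\<Sum>y\<in>UNIV. ennreal (pmf (K x) y * exp (chi \<nu> \<gamma> y \<theta>) * a y / a x) *
      (\<integral>\<^sup>+ w. ennreal (exp (\<theta> * \<gamma> y (fst w) - chi \<nu> \<gamma> y \<theta>)) * f (y, move \<Delta> y w z) \<partial>\<nu>))"
      using True unfolding kernel_op_def k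
      by (simp add: nn_integral_Y_step[OF tilted_increment_law_prob[OF chi] f] tilted_state_pmf[where u=u, OF chi u]
          tilted_density_integral[OF fb] move_def)
    also have "\<dots> = weighted_step tilted_weight \<Delta> f x z"
      unfolding weighted_step_def
    proof (intro sum.cong refl)
      fix y
      let ?e = "exp (chi \<nu> \<gamma> y \<theta>) * a y / a x"
      have [measurable]: "(\<lambda>w. f (y, move \<Delta> y w z)) \<in> borel_measurable \<nu>" by (rule f_move_measurable[OF f])
      have e0: "0 \<le> ?e" using a_pos[of x] a_pos[of y] by simp
      have "ennreal (pmf (K x) y * exp (chi \<nu> \<gamma> y \<theta>) * a y / a x) *
        (\<integral>\<^sup>+ w. ennreal (exp (\<theta> * \<gamma> y (fst w) - chi \<nu> \<gamma> y \<theta>)) * f (y, move \<Delta> y w z) \<partial>\<nu>)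
        = ennreal (pmf (K x) y) * (ennreal ?e *
        (\<integral>\<^sup>+ w. ennreal (exp (\<theta> * \<gamma> y (fst w) - chi \<nu> \<gamma> y \<theta>)) * f (y, move \<Delta> y w z) \<partial>\<nu>))"
        using ennreal_mult[OF pmf_nonneg[of "K x" y] e0] by (simp add: mult.assoc)
      also have "ennreal ?e * (\<integral>\<^sup>+ w. ennreal (exp (\<theta> * \<gamma> y (fst w) - chi \<nu> \<gamma> y \<theta>)) * f (y, move \<Delta> y w z) \<partial>\<nu>)
        = (\<integral>\<^sup>+ w. ennreal ?e * (ennreal (exp (\<theta> * \<gamma> y (fst w) - chi \<nu> \<gamma> y \<theta>)) * f (y, move \<Delta> y w z)) \<partial>\<nu>)"
        by (rule nn_integral_cmult[symmetric]) measurable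
      also have "\<dots> = (\<integral>\<^sup>+ w. ennreal (tilted_weight x y w) * f (y, move \<Delta> y w z) \<partial>\<nu>)"
      proof (intro nn_integral_cong)
        fix w
        have "ennreal ?e * ennreal (exp (\<theta> * \<gamma> y (fst w) - chi \<nu> \<gamma> y \<theta>)) = ennreal (tilted_weight x y w)"
          using e0 by (simp add: ennreal_mult[symmetric] tilted_weight_def exp_diff mult.commute)
        then show "ennreal ?e * (ennreal (exp (\<theta> * \<gamma> y (fst w) - chi \<nu> \<gamma> y \<theta>)) * f (y, move \<Delta> y w z))
          = ennreal (tilted_weight x y w) * f (y, move \<Delta> y w z)"
          by (simp only: mult.assoc[symmetric])
      qed
      finally show "ennreal (pmf (K x) y * exp (chi \<nu> \<gamma> y \<theta>) * a y / a x) *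
        (\<integral>\<^sup>+ w. ennreal (exp (\<theta> * \<gamma> y (fst w) - chi \<nu> \<gamma> y \<theta>)) * f (y, move \<Delta> y w z) \<partial>\<nu>)
        = ennreal (pmf (K x) y) * (\<integral>\<^sup>+ w. ennreal (tilted_weight x y w) * f (y, move \<Delta> y w z) \<partial>\<nu>)" .
    qed
    finally show ?thesis using True by simp
  next
    case False
    then have "kernel_op ?k f (x, z) = (\<Sum>y\<in>UNIV. ennreal (pmf (K x) y) * (\<integral>\<^sup>+ v. (case v of (g, l) \<Rightarrow> f (y, z * exp (- g) - \<Delta> * l)) \<partial>increment_law \<nu> \<gamma> lam y))"
      unfolding kernel_op_def k by (simp add: nn_integral_Y_step[OF increment_law_prob f])
    also have "\<dots> = weighted_step nominal_weight \<Delta> f x z"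
      unfolding weighted_step_def increment_law_def
      by (simp add: nn_integral_distr[OF pair_measurable] fb nominal_weight_def move_def)
    finally show ?thesis using False by simp
  qed
qed (use \<Delta> h in auto)

end

section \<open>Asymptotics of the parameters\<close>

lemma rho_asymptotics:
  shows "(rho \<longlongrightarrow> 0) (at_right 0)"
    and "\<forall>\<^sub>F \<Delta> in at_right 0. 0 < \<Delta> \<and> \<Delta> < 1 \<and> 0 < rho \<Delta>"
proof -
  show "(rho \<longlongrightarrow> 0) (at_right 0)" unfolding rho_def[abs_def] by real_asymp
  have "\<forall>\<^sub>F \<Delta> in at_right 0. \<Delta> \<in> {0<..<1::real}" by (rule eventually_at_right_real) simp
  then show "\<forall>\<^sub>F \<Delta> in at_right 0. 0 < \<Delta> \<and> \<Delta> < 1 \<and> 0 < rho \<Delta>"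
    by eventually_elim (simp add: rho_def)
qed

text \<open>
  For small \<open>\<Delta>\<close> the exponent of \<open>1 / rho \<Delta>\<close> lies between 1 and \<open>1 + 1/\<theta>\<close>; the lower
  bound gives growth at least of order \<open>ln (1 / \<Delta>)\<close>.
\<close>

lemma c_level_at_top:
  assumes B: "0 < B1" "0 < B2" and \<theta>: "0 < \<theta>"
  shows "filterlim (c_level B1 B2 \<theta>) at_top (at_right 0)"
proof (rule filterlim_at_top_mono)
  show "filterlim (\<lambda>\<Delta>. B2 / B1 * ln (1 / \<Delta>)) at_top (at_right 0)"
  proof (rule filterlim_tendsto_pos_mult_at_top[OF tendsto_const])
    show "0 < B2 / B1" using B by simp
    show "filterlim (\<lambda>\<Delta>::real. ln (1 / \<Delta>)) at_top (at_right 0)" by real_asymp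
  qed
  have "\<forall>\<^sub>F \<Delta> in at_right 0. rho \<Delta> < min 1 \<theta>"
    using rho_asymptotics(1) \<theta> by (intro order_tendstoD) auto
  then show "\<forall>\<^sub>F \<Delta> in at_right 0. B2 / B1 * ln (1 / \<Delta>) \<le> c_level B1 B2 \<theta> \<Delta>"
    using rho_asymptotics(2)
  proof eventually_elim
    case (elim \<Delta>)
    have "ln (1 / \<Delta>) = rho \<Delta> powr (- 1)"
      using elim by (simp add: powr_minus_divide rho_def)
    also have "\<dots> \<le> rho \<Delta> powr (- (1 + 1 / (2 * \<theta> - rho \<Delta>)))"
      using elim \<theta> by (intro powr_mono') auto
    finally show ?case unfolding c_level_def using B by (intro mult_left_mono) auto
  qed
qed

text \<open>
  The exponent of \<open>1 / rho \<Delta>\<close> is at most \<open>1 + 1/\<theta>\<close>, so \<open>c_level\<close> grows like a power of \<open>ln (1 / \<Delta>)\<close> at most.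
\<close>

lemma c_level_mult_small:
  assumes B: "0 < B1" "0 < B2" and \<theta>: "0 < \<theta>"
  shows "\<forall>\<^sub>F \<Delta> in at_right 0. c_level B1 B2 \<theta> \<Delta> * \<Delta> < 1"
proof -
  define e where "e = 1 + 1 / \<theta>"
  have e: "0 < e" using \<theta> by (simp add: e_def add_pos_pos)
  have "((\<lambda>\<Delta>::real. \<Delta> * ln (1 / \<Delta>) powr e) \<longlongrightarrow> 0) (at_right 0)" using e by real_asymp
  then have "\<forall>\<^sub>F \<Delta> in at_right 0. \<Delta> * ln (1 / \<Delta>) powr e < B1 / B2"
    using B by (intro order_tendstoD) auto
  moreover have "\<forall>\<^sub>F \<Delta> in at_right 0. rho \<Delta> < min 1 \<theta>"
    using rho_asymptotics(1) \<theta> by (intro order_tendstoD) auto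
  ultimately show ?thesis using rho_asymptotics(2)
  proof eventually_elim
    case (elim \<Delta>)
    have "rho \<Delta> powr (- (1 + 1 / (2 * \<theta> - rho \<Delta>))) \<le> rho \<Delta> powr (- e)"
      unfolding e_def using elim \<theta> by (intro powr_mono') (auto intro!: divide_left_mono mult_pos_pos)
    also have "rho \<Delta> powr (- e) = ln (1 / \<Delta>) powr e"
      using elim by (simp add: rho_def powr_minus powr_divide)
    finally have "c_level B1 B2 \<theta> \<Delta> * \<Delta> \<le> (B2 / B1) * ln (1 / \<Delta>) powr e * \<Delta>"
      unfolding c_level_def using B elim by (intro mult_right_mono mult_left_mono) auto
    also have "\<dots> = (B2 / B1) * (\<Delta> * ln (1 / \<Delta>) powr e)" by simp
    also have "\<dots> < (B2 / B1) * (B1 / B2)"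
      using elim B by (intro mult_strict_left_mono) auto
    finally show ?case using B by simp
  qed
qed

lemma c_level_pos:
  "0 < B1 \<Longrightarrow> 0 < B2 \<Longrightarrow> 0 < \<Delta> \<Longrightarrow> \<Delta> < 1 \<Longrightarrow> 0 < c_level B1 B2 \<theta> \<Delta>"
  by (simp add: c_level_def rho_def)

text \<open>
  By continuity of the eigenvectors, \<open>g_fun u \<theta> \<Delta> x\<close> converges to a positive limit as \<open>\<Delta>\<close> decreases to 0.
\<close>

lemma g_fun_bounds:
  fixes u :: "real \<Rightarrow> real ^ 's::finite"
  assumes u: "\<And>x. 0 < u \<theta> $ x" and cont: "\<And>x. continuous_on {0<..\<theta>} (\<lambda>t. u t $ x)" and \<theta>: "0 < \<theta>"
  obtains lo hi where "0 < lo" "lo \<le> 1" "1 \<le> hi"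
    "\<forall>\<^sub>F \<Delta> in at_right 0. \<forall>x. lo \<le> g_fun u \<theta> \<Delta> x \<and> g_fun u \<theta> \<Delta> x \<le> hi"
proof -
  define G where "G x = (u \<theta> $ x) powr (1 / (2 * \<theta> - 0)) * (u \<theta> $ x) powr (1 / (2 * \<theta> - 0))" for x
  have G: "0 < G x" for x using u[of x] by (simp add: G_def)
  have lim: "((\<lambda>\<Delta>. g_fun u \<theta> \<Delta> x) \<longlongrightarrow> G x) (at_right 0)" for x
  proof -
    have "((\<lambda>\<Delta>. u (\<theta> - rho \<Delta>) $ x) \<longlongrightarrow> u \<theta> $ x) (at_right 0)"
    proof (rule continuous_on_tendsto_compose[OF cont])
      show "((\<lambda>\<Delta>. \<theta> - rho \<Delta>) \<longlongrightarrow> \<theta>) (at_right 0)"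
        using tendsto_diff[OF tendsto_const rho_asymptotics(1), of \<theta>] by simp
      have "\<forall>\<^sub>F \<Delta> in at_right 0. rho \<Delta> < \<theta>"
        using rho_asymptotics(1) \<theta> by (rule order_tendstoD)
      then show "\<forall>\<^sub>F \<Delta> in at_right 0. \<theta> - rho \<Delta> \<in> {0<..\<theta>}"
        using rho_asymptotics(2) by eventually_elim auto
    qed (use \<theta> in auto)
    moreover have "((\<lambda>\<Delta>. 1 / (2 * \<theta> - rho \<Delta>)) \<longlongrightarrow> 1 / (2 * \<theta> - 0)) (at_right 0)"
      using \<theta> by (intro tendsto_intros rho_asymptotics) auto
    ultimately show ?thesis
      unfolding g_fun_def G_def using u[of x] by (intro tendsto_mult tendsto_powr tendsto_const) auto
  qed
  have "\<forall>\<^sub>F \<Delta> in at_right 0. G x / 2 < g_fun u \<theta> \<Delta> x \<and> g_fun u \<theta> \<Delta> x < 2 * G x" for x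
    using order_tendstoD(1)[OF lim[of x], of "G x / 2"] order_tendstoD(2)[OF lim[of x], of "2 * G x"] G[of x]
    by (auto intro: eventually_conj)
  then have ev: "\<forall>\<^sub>F \<Delta> in at_right 0. \<forall>x. G x / 2 < g_fun u \<theta> \<Delta> x \<and> g_fun u \<theta> \<Delta> x < 2 * G x"
    by (intro eventually_all_finite) auto
  show ?thesis
  proof
    show "0 < min 1 (Min (range G) / 2)" "min 1 (Min (range G) / 2) \<le> 1" "1 \<le> max 1 (2 * Max (range G))"
      using G by auto
    show "\<forall>\<^sub>F \<Delta> in at_right 0. \<forall>x. min 1 (Min (range G) / 2) \<le> g_fun u \<theta> \<Delta> x \<and> g_fun u \<theta> \<Delta> x \<le> max 1 (2 * Max (range G))"
      using ev
    proof eventually_elim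
      case (elim \<Delta>)
      show ?case
      proof
        fix x
        have "Min (range G) \<le> G x" "G x \<le> Max (range G)" by auto
        with elim[THEN spec, of x]
        have "Min (range G) / 2 \<le> g_fun u \<theta> \<Delta> x" "g_fun u \<theta> \<Delta> x \<le> 2 * Max (range G)"
          by linarith+
        then show "min 1 (Min (range G) / 2) \<le> g_fun u \<theta> \<Delta> x \<and> g_fun u \<theta> \<Delta> x \<le> max 1 (2 * Max (range G))"
          by (intro conjI min.coboundedI2 max.coboundedI2)
      qed
    qed
  qed
qed

lemma chi_finite_between:
  fixes \<theta>s t :: real
  assumes nu: "prob_space \<nu>" "sets \<nu> = sets borel" and meas: "\<And>x. \<gamma> x \<in> borel_measurable borel"
    and fin: "chi_finite \<nu> \<gamma> \<theta>s" and t: "0 \<le> t" "t \<le> \<theta>s"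
  shows "chi_finite \<nu> \<gamma> t"
  unfolding chi_finite_def
proof
  fix x
  interpret prob_space \<nu> by fact
  have [measurable]: "(\<lambda>w. \<gamma> x (fst w)) \<in> borel_measurable \<nu>"
    unfolding measurable_cong_sets[OF nu(2) refl] borel_prod[symmetric]
    by (rule measurable_compose[OF measurable_fst meas])
  show "integrable \<nu> (\<lambda>w. exp (t * \<gamma> x (fst w)))"
  proof (rule Bochner_Integration.integrable_bound)
    show "integrable \<nu> (\<lambda>w. 1 + exp (\<theta>s * \<gamma> x (fst w)))"
      using fin by (simp add: chi_finite_def)
    show "AE w in \<nu>. norm (exp (t * \<gamma> x (fst w))) \<le> norm (1 + exp (\<theta>s * \<gamma> x (fst w)))"
    proof (intro AE_I2)
      fix w
      have "exp (t * \<gamma> x (fst w)) \<le> 1 + exp (\<theta>s * \<gamma> x (fst w))"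
      proof (cases "0 \<le> \<gamma> x (fst w)")
        case True
        then have "exp (t * \<gamma> x (fst w)) \<le> exp (\<theta>s * \<gamma> x (fst w))" using t by (simp add: mult_right_mono)
        then show ?thesis by (rule order_trans) simp
      next
        case False
        then have "exp (t * \<gamma> x (fst w)) \<le> 1" using t by (simp add: mult_nonneg_nonpos)
        then show ?thesis by (simp add: add_increasing2)
      qed
      then show "norm (exp (t * \<gamma> x (fst w))) \<le> norm (1 + exp (\<theta>s * \<gamma> x (fst w)))" by simp
    qed
  qed measurable
qed

lemma eigenvector_expectation:
  assumes nu: "prob_space \<nu>" and fin: "chi_finite \<nu> \<gamma> t"
    and pos: "\<And>x. 0 < (w :: real ^ 's::finite) $ x" and eig: "Q_matrix K \<nu> \<gamma> t *v w = r *\<^sub>R w"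
  shows "(\<Sum>y\<in>UNIV. ennreal (pmf (K x) y * w $ y) * (\<integral>\<^sup>+ v. ennreal (exp (t * \<gamma> y (fst v))) \<partial>\<nu>)) = ennreal (r * w $ x)"
proof -
  have "(\<Sum>y\<in>UNIV. ennreal (pmf (K x) y * w $ y) * (\<integral>\<^sup>+ v. ennreal (exp (t * \<gamma> y (fst v))) \<partial>\<nu>))
    = (\<Sum>y\<in>UNIV. ennreal (pmf (K x) y * exp (chi \<nu> \<gamma> y t) * w $ y))"
    using pos by (intro sum.cong refl) (simp add: mgf_eq_exp_chi[OF nu fin] ennreal_mult[symmetric] less_imp_le mult_ac)
  also have "\<dots> = ennreal ((Q_matrix K \<nu> \<gamma> t *v w) $ x)"
    using pos by (simp add: sum_ennreal less_imp_le Q_matrix_def matrix_vector_mult_def)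
  also have "\<dots> = ennreal (r * w $ x)" by (simp add: eig)
  finally show ?thesis .
qed

section \<open>The termination time of the sampler\<close>

theorem proposition2:
  fixes K :: "'s::finite \<Rightarrow> 's pmf"
    and \<nu> :: "(real \<times> real) measure"
    and \<gamma> lam :: "'s \<Rightarrow> real \<Rightarrow> real"
    and u :: "real \<Rightarrow> real ^ 's"
    and \<theta>s \<mu> B1 B2 b0 b1 b2 :: real
  assumes law: "prob_space \<nu>" "sets \<nu> = sets borel"
    and meas: "\<And>x. \<gamma> x \<in> borel_measurable borel" "\<And>x. lam x \<in> borel_measurable borel"
    and lam_nonneg: "\<And>x z. 0 \<le> lam x z"
    and lam_nondegenerate: "\<exists>x. 0 < measure \<nu> {w. 0 < lam x (snd w)}"
    and assumption1: "irreducible_chain K"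
      "\<exists>N. open N \<and> (0::real) \<in> N \<and>
         (SUP x. SUP \<theta>\<in>N. \<integral>\<^sup>+ w. ennreal (exp (\<theta> * \<gamma> x (fst w))) \<partial>\<nu>) < \<infinity>"
    and assumption2: "0 < \<theta>s" "psi K \<nu> \<gamma> \<theta>s = 0" "\<exists>\<theta>>\<theta>s. psi K \<nu> \<gamma> \<theta> < \<infinity>"
    and assumption3: "\<And>\<alpha>. 0 < \<alpha> \<Longrightarrow> (SUP x. nominal_E K \<nu> x (\<lambda>y w. lam y (snd w) powr \<alpha>)) < \<infinity>"
    and assumption4: "\<And>x. 0 < prob_space.variance \<nu> (\<lambda>w. \<gamma> x (fst w))"
    and u_eigenvector: "\<And>\<theta>. chi_finite \<nu> \<gamma> \<theta> \<Longrightarrow>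
         (\<forall>x. 0 < u \<theta> $ x) \<and>
         Q_matrix K \<nu> \<gamma> \<theta> *v u \<theta> = exp (real_of_ereal (psi K \<nu> \<gamma> \<theta>)) *\<^sub>R u \<theta>"
    and u_continuous: "\<And>x. continuous_on {0<..\<theta>s} (\<lambda>\<theta>. u \<theta> $ x)"
    and mu: "((\<lambda>\<theta>. real_of_ereal (psi K \<nu> \<gamma> \<theta>)) has_real_derivative \<mu>) (at \<theta>s)" "0 < \<mu>"
    and b0: "0 < 1 / (INF (\<theta>, x) \<in> {0<..<\<theta>s} \<times> UNIV. u \<theta> $ x)\<^sup>2"
      "1 / (INF (\<theta>, x) \<in> {0<..<\<theta>s} \<times> UNIV. u \<theta> $ x)\<^sup>2 \<le> b0"
    and b1: "0 < b1"
      "\<And>\<delta>. 0 < \<delta> \<Longrightarrow> \<delta> < \<theta>s \<Longrightarrow>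
         exp (real_of_ereal (psi K \<nu> \<gamma> (\<theta>s - \<delta>))) \<le> 1 - \<delta> * \<mu> + b1 * \<delta>\<^sup>2"
    and b2: "0 < b2"
      "(SUP (x, \<delta>) \<in> UNIV \<times> {0<..<\<theta>s}. nominal_E K \<nu> x
          (\<lambda>y w. lam y (snd w) powr (2 * \<theta>s - \<delta>) * exp ((\<theta>s - \<delta>) * \<gamma> y (fst w)))) \<le> ennreal b2"
    and B12: "0 < B1" "0 < B2"
      "\<forall>\<^sub>F \<Delta> in at_right 0. B1 * rho \<Delta> < 1 \<and>
         b0 * b2 * rho \<Delta> / B2 powr (2 * \<theta>s - rho \<Delta>)
           + (1 - rho \<Delta> * \<mu> + b1 * (rho \<Delta>)\<^sup>2) / (1 - B1 * rho \<Delta>) powr (2 * \<theta>s - rho \<Delta>) \<le> 1"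
  shows "\<forall>y0 :: 's \<times> real.
      (\<forall>\<Delta>. 0 < \<Delta> \<and> \<Delta> < 1 \<and> rho \<Delta> < \<theta>s \<longrightarrow>
         measure (sampler_law K \<nu> \<gamma> lam u \<theta>s B1 B2 \<Delta> y0)
           {\<omega> \<in> space (sampler_law K \<nu> \<gamma> lam u \<theta>s B1 B2 \<Delta> y0). T_B \<omega> < \<infinity>} = 1) \<and>
      (\<exists>p>0.
         (\<forall>\<^sub>F \<Delta> in at_right 0.
            (\<integral>\<^sup>+ \<omega>. ennreal_of_enat (T_B \<omega>) \<partial>sampler_law K \<nu> \<gamma> lam u \<theta>s B1 B2 \<Delta> y0) < \<infinity>) \<and>
         (\<lambda>\<Delta>. enn2real (\<integral>\<^sup>+ \<omega>. ennreal_of_enat (T_B \<omega>) \<partial>sampler_law K \<nu> \<gamma> lam u \<theta>s B1 B2 \<Delta> y0))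
           \<in> O[at_right 0](\<lambda>\<Delta>. c_level B1 B2 \<theta>s \<Delta> powr p * ln (c_level B1 B2 \<theta>s \<Delta>)
               + ln (1 / (c_level B1 B2 \<theta>s \<Delta> * \<Delta>))))"
proof -
  have chi_s: "chi_finite \<nu> \<gamma> \<theta>s" and psi_s: "real_of_ereal (psi K \<nu> \<gamma> \<theta>s) = 0"
    using assumption2(2) by (auto simp: psi_def split: if_splits)
  have chi: "chi_finite \<nu> \<gamma> t" if "0 \<le> t" "t \<le> \<theta>s" for t
    using chi_finite_between[OF law meas(1) chi_s that] by simp
  obtain S where S: "open S" "(0::real) \<in> S"
    "(SUP x. SUP t\<in>S. \<integral>\<^sup>+ w. ennreal (exp (t * \<gamma> x (fst w))) \<partial>\<nu>) < \<infinity>"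
    using assumption1(2) by blast
  obtain r where r: "0 < r" "ball 0 r \<subseteq> S"
    using S(1,2) open_contains_ball by blast
  \<comment> \<open>The four bounds ensure that \<open>- \<delta>\<close> lies in the neighbourhood of 0 where exponential
    moments are bounded, that \<open>z\<^sup>\<delta> \<le> 1 + z\<close>,
    that \<open>\<theta>s - \<delta> > 0\<close>, and that the linear term in \<open>1 - \<delta>\<mu> + b1 \<delta>\<^sup>2\<close> dominates.\<close>
  define \<delta> where "\<delta> = Min {r / 2, 1, \<theta>s / 2, \<mu> / (2 * b1)}"
  have \<delta>: "0 < \<delta>" "\<delta> \<le> r / 2" "\<delta> \<le> 1" "\<delta> \<le> \<theta>s / 2" "\<delta> \<le> \<mu> / (2 * b1)"
    using r(1) assumption2(1) mu(2) b1(1) by (auto simp: \<delta>_def)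
  define q where "q = exp (real_of_ereal (psi K \<nu> \<gamma> (\<theta>s - \<delta>)))"
  have "q < 1"
  proof -
    have "b1 * \<delta> \<le> \<mu> / 2" using \<delta>(5) b1(1) by (simp add: field_simps)
    then have "\<delta> * (b1 * \<delta>) \<le> \<delta> * (\<mu> / 2)" using \<delta>(1) by (intro mult_left_mono) auto
    moreover have "q \<le> 1 - \<delta> * \<mu> + b1 * \<delta>\<^sup>2"
      unfolding q_def using \<delta> assumption2(1) by (intro b1(2)) auto
    moreover have "0 < \<delta> * (\<mu> / 2)" using \<delta>(1) mu(2) by simp
    ultimately show ?thesis by (simp add: power2_eq_square algebra_simps)
  qed
  have u_pos: "0 < u t $ x" if "0 \<le> t" "t \<le> \<theta>s" for t x
    using u_eigenvector[OF chi[OF that]] by blast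
  have eig: "(\<Sum>y\<in>UNIV. ennreal (pmf (K x) y * u t $ y) * (\<integral>\<^sup>+ w. ennreal (exp (t * \<gamma> y (fst w))) \<partial>\<nu>))
      = ennreal (exp (real_of_ereal (psi K \<nu> \<gamma> t)) * u t $ x)" if "0 \<le> t" "t \<le> \<theta>s" for t x
    using eigenvector_expectation[OF law(1) chi[OF that] u_pos[OF that]] u_eigenvector[OF chi[OF that]] by blast
  have moment: "(\<integral>\<^sup>+ w. ennreal (exp (- \<delta> * \<gamma> y (fst w))) \<partial>\<nu>) < \<infinity>" for y
  proof -
    have "- \<delta> \<in> S" using r \<delta>(1,2) by (auto simp: subset_eq dist_real_def)
    then have "(\<integral>\<^sup>+ w. ennreal (exp (- \<delta> * \<gamma> y (fst w))) \<partial>\<nu>) \<le> (SUP t\<in>S. \<integral>\<^sup>+ w. ennreal (exp (t * \<gamma> y (fst w))) \<partial>\<nu>)"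
      by (rule SUP_upper)
    also have "\<dots> \<le> (SUP x. SUP t\<in>S. \<integral>\<^sup>+ w. ennreal (exp (t * \<gamma> x (fst w))) \<partial>\<nu>)"
      by (rule SUP_upper) simp
    finally show ?thesis using S(3) by (rule le_less_trans)
  qed
  interpret tilted_chain K \<nu> \<gamma> lam \<theta>s \<delta> q "\<lambda>x. u \<theta>s $ x" "\<lambda>x. u (\<theta>s - \<delta>) $ x"
  proof (rule tilted_chain.intro)
    show "(\<Sum>y\<in>UNIV. ennreal (pmf (K x) y * u \<theta>s $ y) * (\<integral>\<^sup>+ w. ennreal (exp (\<theta>s * \<gamma> y (fst w))) \<partial>\<nu>))
      = ennreal (u \<theta>s $ x)" for x
      using eig[of \<theta>s x] assumption2(1) by (simp add: psi_s)
    show "(\<Sum>y\<in>UNIV. ennreal (pmf (K x) y * u (\<theta>s - \<delta>) $ y) * (\<integral>\<^sup>+ w. ennreal (exp ((\<theta>s - \<delta>) * \<gamma> y (fst w))) \<partial>\<nu>))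
      = ennreal (q * u (\<theta>s - \<delta>) $ x)" for x
      unfolding q_def using \<delta> assumption2(1) by (intro eig) auto
    show "0 \<le> \<theta>s" using assumption2(1) by simp
    show "0 < q" by (simp add: q_def)
    show "0 < u \<theta>s $ x" "0 < u (\<theta>s - \<delta>) $ x" for x
      using \<delta> assumption2(1) by (auto intro!: u_pos)
  qed (fact law meas lam_nonneg lam_nondegenerate assumption1(1) \<delta>(1,3) \<open>q < 1\<close> moment)+
  define h where "h \<Delta> x = c_level B1 B2 \<theta>s \<Delta> * \<Delta> * g_fun u \<theta>s \<Delta> x" for \<Delta> x
  let ?k = "sampler_kernel K \<nu> \<gamma> lam u \<theta>s B1 B2"
  have h_pos: "0 < h \<Delta> x" if "0 < \<Delta>" "\<Delta> < 1" "rho \<Delta> < \<theta>s" for \<Delta> x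
  proof -
    have "0 < rho \<Delta>" using that by (simp add: rho_def)
    then have "0 < g_fun u \<theta>s \<Delta> x"
      using that u_pos[of \<theta>s x] u_pos[of "\<theta>s - rho \<Delta>" x] assumption2(1) by (simp add: g_fun_def)
    then show ?thesis using c_level_pos[OF B12(1,2) that(1,2)] that by (simp add: h_def)
  qed
  have kernel: "tilted_kernel \<Delta> (h \<Delta>) (?k \<Delta>)" if "0 < \<Delta>" "\<Delta> < 1" "rho \<Delta> < \<theta>s" for \<Delta>
    unfolding h_def[abs_def] using h_pos[OF that] that(1)
    by (intro sampler_tilted_kernel[OF chi_s]) (auto simp: h_def)
  have kernel_meas: "?k \<Delta> \<in> state_space \<rightarrow>\<^sub>M prob_algebra state_space"
    if "0 < \<Delta>" "\<Delta> < 1" "rho \<Delta> < \<theta>s" for \<Delta>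
    using kernel[OF that] by (simp add: tilted_kernel_def)
  have terminates: "measure (sampler_law K \<nu> \<gamma> lam u \<theta>s B1 B2 \<Delta> y0)
      {\<omega> \<in> space (sampler_law K \<nu> \<gamma> lam u \<theta>s B1 B2 \<Delta> y0). T_B \<omega> < \<infinity>} = 1"
    if \<Delta>: "0 < \<Delta>" "\<Delta> < 1" "rho \<Delta> < \<theta>s" for \<Delta> and y0 :: "'s \<times> real"
  proof -
    obtain x0 z0 where y0: "y0 = (x0, z0)" by fastforce
    \<comment> \<open>For fixed \<open>\<Delta>\<close> any finite bound suffices, so the ratio of the thresholds may depend on \<open>\<Delta>\<close>.\<close>
    define l where "l = Min (range (h \<Delta>))"
    define R where "R = Max (range (h \<Delta>)) / l"
    have l: "0 < l" using h_pos[OF \<Delta>] by (auto simp: l_def)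
    have lh: "l \<le> h \<Delta> x" for x by (auto simp: l_def)
    have hR: "h \<Delta> x \<le> R * l" for x using l by (auto simp: R_def)
    have "l \<le> R * l" using lh[of x0] hR[of x0] by (rule order_trans)
    then have R1: "1 \<le> R" using l by simp
    obtain C p where Cp: "\<And>\<Delta> h k l L x z. \<lbrakk>tilted_kernel \<Delta> h k; 0 < l; \<forall>x. l \<le> h x \<and> h x \<le> R * l; exp 1 \<le> L; l / \<Delta> \<le> L\<rbrakk> \<Longrightarrow>
      (\<Sum>n. (kernel_op k ^^ n) (indicator (- region_B)) (x, z))
        \<le> ennreal (C * (L powr p * ln L + ln (1 + max 0 z / l)))"
      by (rule expected_hitting_time_bound[OF R1]) (rule that)
    let ?L = "max (exp 1) (l / \<Delta>)"
    have "(\<Sum>n. (kernel_op (?k \<Delta>) ^^ n) (indicator (- region_B)) y0)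
      \<le> ennreal (C * (?L powr p * ln ?L + ln (1 + max 0 z0 / l)))"
      unfolding y0 by (rule Cp[OF kernel[OF \<Delta>] l]) (use lh hR in simp_all)
    also have "\<dots> < \<infinity>" by simp
    finally have "(\<Sum>n. (kernel_op (?k \<Delta>) ^^ n) (indicator (- region_B)) y0) < \<infinity>" .
    then show ?thesis
      unfolding sampler_law_def by (rule T_B_expectation_le(2)[OF kernel_meas[OF \<Delta>]])
  qed
  have us: "0 < u \<theta>s $ x" for x using u_pos assumption2(1) by simp
  obtain lo hi where lohi: "0 < lo" "lo \<le> 1" "1 \<le> hi"
    and g: "\<forall>\<^sub>F \<Delta> in at_right 0. \<forall>x. lo \<le> g_fun u \<theta>s \<Delta> x \<and> g_fun u \<theta>s \<Delta> x \<le> hi"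
    using g_fun_bounds[OF us u_continuous assumption2(1)] by blast
  have R1: "1 \<le> hi / lo" using lohi by simp
  obtain C p where C: "0 < C" and p: "0 < p" and Cp: "\<And>\<Delta> h k l L x z. \<lbrakk>tilted_kernel \<Delta> h k; 0 < l;
      \<forall>x. l \<le> h x \<and> h x \<le> hi / lo * l; exp 1 \<le> L; l / \<Delta> \<le> L\<rbrakk> \<Longrightarrow>
      (\<Sum>n. (kernel_op k ^^ n) (indicator (- region_B)) (x, z))
        \<le> ennreal (C * (L powr p * ln L + ln (1 + max 0 z / l)))"
    by (rule expected_hitting_time_bound[OF R1]) (rule that)
  define rate where "rate \<Delta> = c_level B1 B2 \<theta>s \<Delta> powr p * ln (c_level B1 B2 \<theta>s \<Delta>)
               + ln (1 / (c_level B1 B2 \<theta>s \<Delta> * \<Delta>))" for \<Delta>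
  have bound: "\<forall>\<^sub>F \<Delta> in at_right 0. 0 \<le> rate \<Delta> \<and>
      (\<integral>\<^sup>+ \<omega>. ennreal_of_enat (T_B \<omega>) \<partial>sampler_law K \<nu> \<gamma> lam u \<theta>s B1 B2 \<Delta> (x0, z0))
        \<le> ennreal ((1 + C + C * ln (1 + max 0 z0 / lo)) * rate \<Delta>)" for x0 z0
  proof -
    have e: "\<forall>\<^sub>F \<Delta> in at_right 0. exp 1 \<le> c_level B1 B2 \<theta>s \<Delta>"
      using c_level_at_top[OF B12(1,2) assumption2(1)] by (simp add: filterlim_at_top)
    have "\<forall>\<^sub>F \<Delta> in at_right 0. rho \<Delta> < \<theta>s"
      using rho_asymptotics(1) assumption2(1) by (rule order_tendstoD)
    with e g c_level_mult_small[OF B12(1,2) assumption2(1)] rho_asymptotics(2) show ?thesis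
    proof eventually_elim
      case (elim \<Delta>)
      let ?c = "c_level B1 B2 \<theta>s \<Delta>" and ?Z = "max 0 z0 / lo"
      have \<Delta>: "0 < \<Delta>" "\<Delta> < 1" "rho \<Delta> < \<theta>s" using elim by auto
      have c: "0 < ?c" using c_level_pos[OF B12(1,2) \<Delta>(1,2)] .
      \<comment> \<open>Since \<open>lo \<le> 1\<close>, the value \<open>L = c\<close> is admissible at this scale.\<close>
      define l where "l = ?c * \<Delta> * lo"
      have l: "0 < l" using c \<Delta> lohi by (simp add: l_def)
      have lh: "l \<le> h \<Delta> x" for x
        unfolding l_def h_def using elim c \<Delta> by (intro mult_left_mono) auto
      have hR: "h \<Delta> x \<le> hi / lo * l" for x
      proof -
        have "h \<Delta> x \<le> ?c * \<Delta> * hi"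
          unfolding h_def using elim c \<Delta> by (intro mult_left_mono) auto
        then show ?thesis using lohi by (simp add: l_def mult_ac)
      qed
      have "l / \<Delta> = ?c * lo" using \<Delta> by (simp add: l_def)
      also have "\<dots> \<le> ?c" using lohi c by (simp add: mult_left_le)
      finally have lc: "l / \<Delta> \<le> ?c" .
      \<comment> \<open>Because \<open>c\<Delta> < 1\<close>, the logarithm splits into a part depending on \<open>z0\<close> and \<open>log (1 / (c\<Delta>))\<close>.\<close>
      have w: "1 \<le> 1 / (?c * \<Delta>)" using elim c \<Delta> by simp
      have Z: "0 \<le> ?Z" using lohi by simp
      have "ln (1 + max 0 z0 / l) \<le> ln ((1 + ?Z) * (1 / (?c * \<Delta>)))"
      proof (rule ln_mono)
        have "max 0 z0 / l = ?Z * (1 / (?c * \<Delta>))" by (simp add: l_def mult_ac)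
        then show "1 + max 0 z0 / l \<le> (1 + ?Z) * (1 / (?c * \<Delta>))"
          using w by (simp only: distrib_right)
        show "0 < 1 + max 0 z0 / l" using l by (intro add_pos_nonneg) auto
      qed
      also have "\<dots> = ln (1 + ?Z) + ln (1 / (?c * \<Delta>))"
        using Z c \<Delta> by (intro ln_mult_pos) auto
      finally have lnl: "ln (1 + max 0 z0 / l) \<le> ln (1 + ?Z) + ln (1 / (?c * \<Delta>))" .
      have lw: "0 \<le> ln (1 / (?c * \<Delta>))" using w by (rule ln_ge_zero)
      have "1 \<le> ?c powr p * ln ?c"
      proof -
        have "1 \<le> ?c" using elim one_le_exp_iff[of "1::real"] by linarith
        then have "1 \<le> ?c powr p" using p by (intro ge_one_powr_ge_zero) auto
        moreover have "1 \<le> ln ?c" using elim c by (simp add: ln_ge_iff)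
        ultimately have "1 * 1 \<le> ?c powr p * ln ?c" by (intro mult_mono) auto
        then show ?thesis by simp
      qed
      then have rate1: "1 \<le> rate \<Delta>" using lw by (simp add: rate_def)
      have lZ: "0 \<le> ln (1 + ?Z)" using Z by simp
      have "C * (?c powr p * ln ?c + ln (1 + max 0 z0 / l)) \<le> C * (rate \<Delta> + ln (1 + ?Z))"
        using lnl C by (intro mult_left_mono) (auto simp: rate_def)
      moreover have "(1 + C * ln (1 + ?Z)) * 1 \<le> (1 + C * ln (1 + ?Z)) * rate \<Delta>"
        using rate1 C lZ by (intro mult_left_mono) auto
      ultimately have total: "1 + C * (?c powr p * ln ?c + ln (1 + max 0 z0 / l)) \<le> (1 + C + C * ln (1 + ?Z)) * rate \<Delta>"
        by (simp add: algebra_simps)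
      have nonneg: "0 \<le> C * (?c powr p * ln ?c + ln (1 + max 0 z0 / l))"
      proof -
        have "0 \<le> ln (1 + max 0 z0 / l)" using l by simp
        then have "0 \<le> ?c powr p * ln ?c + ln (1 + max 0 z0 / l)"
          using \<open>1 \<le> ?c powr p * ln ?c\<close> by linarith
        then show ?thesis using C by simp
      qed
      have "(\<integral>\<^sup>+ \<omega>. ennreal_of_enat (T_B \<omega>) \<partial>sampler_law K \<nu> \<gamma> lam u \<theta>s B1 B2 \<Delta> (x0, z0))
        \<le> 1 + (\<Sum>n. (kernel_op (?k \<Delta>) ^^ n) (indicator (- region_B)) (x0, z0))"
        unfolding sampler_law_def by (rule T_B_expectation_le(1)[OF kernel_meas[OF \<Delta>]])
      also have "\<dots> \<le> 1 + ennreal (C * (?c powr p * ln ?c + ln (1 + max 0 z0 / l)))"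
        using elim lh hR by (intro add_left_mono Cp[OF kernel[OF \<Delta>] l _ _ lc]) auto
      also have "\<dots> = ennreal (1 + C * (?c powr p * ln ?c + ln (1 + max 0 z0 / l)))"
        using ennreal_plus[OF zero_le_one nonneg] by simp
      also have "\<dots> \<le> ennreal ((1 + C + C * ln (1 + ?Z)) * rate \<Delta>)"
        using total by (rule ennreal_leI)
      finally show ?case using rate1 by simp
    qed
  qed
  have expectation: "(\<forall>\<^sub>F \<Delta> in at_right 0.
        (\<integral>\<^sup>+ \<omega>. ennreal_of_enat (T_B \<omega>) \<partial>sampler_law K \<nu> \<gamma> lam u \<theta>s B1 B2 \<Delta> y0) < \<infinity>) \<and>
      (\<lambda>\<Delta>. enn2real (\<integral>\<^sup>+ \<omega>. ennreal_of_enat (T_B \<omega>) \<partial>sampler_law K \<nu> \<gamma> lam u \<theta>s B1 B2 \<Delta> y0))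
        \<in> O[at_right 0](rate)" for y0 :: "'s \<times> real"
  proof -
    obtain x0 z0 where y0: "y0 = (x0, z0)" by fastforce
    define D where "D = 1 + C + C * ln (1 + max 0 z0 / lo)"
    have D: "0 \<le> D" using C lohi by (simp add: D_def)
    note b = bound[of x0 z0, folded D_def y0]
    show ?thesis
    proof
      show "\<forall>\<^sub>F \<Delta> in at_right 0.
        (\<integral>\<^sup>+ \<omega>. ennreal_of_enat (T_B \<omega>) \<partial>sampler_law K \<nu> \<gamma> lam u \<theta>s B1 B2 \<Delta> y0) < \<infinity>"
        using b by eventually_elim (auto intro: order_le_less_trans)
      show "(\<lambda>\<Delta>. enn2real (\<integral>\<^sup>+ \<omega>. ennreal_of_enat (T_B \<omega>) \<partial>sampler_law K \<nu> \<gamma> lam u \<theta>s B1 B2 \<Delta> y0))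
        \<in> O[at_right 0](rate)"
      proof (rule bigoI)
        show "\<forall>\<^sub>F \<Delta> in at_right 0. norm (enn2real (\<integral>\<^sup>+ \<omega>. ennreal_of_enat (T_B \<omega>) \<partial>sampler_law K \<nu> \<gamma> lam u \<theta>s B1 B2 \<Delta> y0))
          \<le> D * norm (rate \<Delta>)"
          using b
        proof eventually_elim
          case (elim \<Delta>)
          then show ?case using D by (auto intro!: enn2real_leI)
        qed
      qed
    qed
  qed
  show ?thesis
    using terminates expectation p unfolding rate_def[abs_def] by blast
qed

end
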